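(* Let $L$ be a link in $S^3$ with at least 3 components. Then the link group $G_L=\pi_1(S^3-L)$ admits a surjective homomorphism to $D_n$ for every integer $n\ge 3$.
   Context: $D_n=\langle a,b\mid a^2=b^n=(ab)^2=e\rangle$ denotes the dihedral group of degree $n$ (order $2n$). *)

theory Defs
  imports "HOL-Analysis.Analysis" "HOL-Algebra.Group"
begin

section \<open>The fundamental group\<close>

definition loops_at :: "'a::topological_space set \<Rightarrow> 'a \<Rightarrow> (real \<Rightarrow> 'a) set" where
  "loops_at S x =
     {p. path p \<and> path_image p \<subseteq> S \<and> pathstart p = x \<and> pathfinish p = x}"

definition loop_homotopy :: "'a::topological_space set \<Rightarrow> 'a \<Rightarrow> (real \<Rightarrow> 'a) rel" where
  "loop_homotopy S x =
     {(p, q). p \<in> loops_at S x \<and> q \<in> loops_at S x \<and> homotopic_paths S p q}"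

definition fundamental_group ::
    "'a::topological_space set \<Rightarrow> 'a \<Rightarrow> (real \<Rightarrow> 'a) set monoid" where
  "fundamental_group S x =
     \<lparr> carrier = loops_at S x // loop_homotopy S x,
       mult = (\<lambda>A B. \<Union>p\<in>A. \<Union>q\<in>B. loop_homotopy S x `` {p +++ q}),
       one = loop_homotopy S x `` {\<lambda>_. x} \<rparr>"

lemma equiv_loop_homotopy: "equiv (loops_at S x) (loop_homotopy S x)"
  by (rule equivI)
     (auto simp: loop_homotopy_def loops_at_def refl_on_def sym_def trans_def
           intro: homotopic_paths_sym homotopic_paths_trans)

lemma loop_join_cong:
  assumes "(p, p') \<in> loop_homotopy S x" "(q, q') \<in> loop_homotopy S x"
  shows "(p +++ q, p' +++ q') \<in> loop_homotopy S x"
  using assms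
  by (auto simp: loop_homotopy_def loops_at_def path_image_join intro: homotopic_paths_join)

lemma fundamental_group_mult:
  assumes "p \<in> loops_at S x" "q \<in> loops_at S x"
  shows "loop_homotopy S x `` {p} \<otimes>\<^bsub>fundamental_group S x\<^esub> loop_homotopy S x `` {q}
           = loop_homotopy S x `` {p +++ q}"
proof -
  have "congruent2 (loop_homotopy S x) (loop_homotopy S x)
          (\<lambda>p q. loop_homotopy S x `` {p +++ q})"
    by (rule congruent2I')
       (use loop_join_cong equiv_class_eq[OF equiv_loop_homotopy] in blast)
  from UN_equiv_class2[OF equiv_loop_homotopy equiv_loop_homotopy this assms]
  show ?thesis by (simp add: fundamental_group_def)
qed

lemma group_fundamental_group:
  fixes x :: "'a::real_normed_vector"
  assumes "x \<in> S"
  shows "group (fundamental_group S x)"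
proof -
  let ?G = "fundamental_group S x" and ?c = "\<lambda>p. loop_homotopy S x `` {p}"
  have car: "carrier ?G = ?c ` loops_at S x"
    by (auto simp: fundamental_group_def quotient_def)
  have const: "(\<lambda>_. x) = linepath x x"
    by (auto simp: linepath_def fun_eq_iff simp flip: scaleR_add_left)
  have one: "\<one>\<^bsub>?G\<^esub> = ?c (linepath x x)"
    by (simp add: fundamental_group_def const)
  have lin: "linepath x x \<in> loops_at S x"
    using assms by (simp add: loops_at_def)
  have join: "p +++ q \<in> loops_at S x" if "p \<in> loops_at S x" "q \<in> loops_at S x" for p q
    using that by (simp add: loops_at_def path_image_join)
  have rev: "reversepath p \<in> loops_at S x" if "p \<in> loops_at S x" for p
    using that by (simp add: loops_at_def)
  have eq: "?c p = ?c q"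
    if "p \<in> loops_at S x" "q \<in> loops_at S x" "homotopic_paths S p q" for p q
    by (rule equiv_class_eq[OF equiv_loop_homotopy]) (use that in \<open>simp add: loop_homotopy_def\<close>)
  show ?thesis
  proof (rule groupI)
    fix A B assume "A \<in> carrier ?G" "B \<in> carrier ?G"
    then show "A \<otimes>\<^bsub>?G\<^esub> B \<in> carrier ?G"
      by (auto simp: car fundamental_group_mult join)
  next
    show "\<one>\<^bsub>?G\<^esub> \<in> carrier ?G"
      using lin by (auto simp: car one)
  next
    fix A B C assume "A \<in> carrier ?G" "B \<in> carrier ?G" "C \<in> carrier ?G"
    then obtain p q r where pqr: "A = ?c p" "B = ?c q" "C = ?c r"
      "p \<in> loops_at S x" "q \<in> loops_at S x" "r \<in> loops_at S x"
      by (auto simp: car)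
    have "homotopic_paths S ((p +++ q) +++ r) (p +++ (q +++ r))"
      using pqr(4-6) by (intro homotopic_paths_sym[OF homotopic_paths_assoc]) (auto simp: loops_at_def)
    then show "A \<otimes>\<^bsub>?G\<^esub> B \<otimes>\<^bsub>?G\<^esub> C = A \<otimes>\<^bsub>?G\<^esub> (B \<otimes>\<^bsub>?G\<^esub> C)"
      using pqr by (simp add: fundamental_group_mult join eq)
  next
    fix A assume "A \<in> carrier ?G"
    then obtain p where p: "A = ?c p" "p \<in> loops_at S x"
      by (auto simp: car)
    have "homotopic_paths S (linepath x x +++ p) p"
      using p(2) homotopic_paths_lid[of p S] by (auto simp: loops_at_def)
    then show "\<one>\<^bsub>?G\<^esub> \<otimes>\<^bsub>?G\<^esub> A = A"
      using p lin by (simp add: one fundamental_group_mult join eq)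
    have "homotopic_paths S (reversepath p +++ p) (linepath x x)"
      using p(2) homotopic_paths_linv[of p S] by (auto simp: loops_at_def)
    then show "\<exists>B\<in>carrier ?G. B \<otimes>\<^bsub>?G\<^esub> A = \<one>\<^bsub>?G\<^esub>"
      using p lin rev[OF p(2)]
      by (intro bexI[of _ "?c (reversepath p)"]) (simp_all add: car one fundamental_group_mult join eq)
  qed
qed


section \<open>Groups given by generators and relators\<close>

text \<open>
  A letter is a generator \<open>g\<close>, written \<open>(g, True)\<close>, or its formal inverse, written
  \<open>(g, False)\<close>. The generating set is the whole type \<open>'g\<close>.
\<close>

type_synonym 'g gen_word = "('g \<times> bool) list"

inductive word_eq :: "'g gen_word set \<Rightarrow> 'g gen_word \<Rightarrow> 'g gen_word \<Rightarrow> bool" for R where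
  refl: "word_eq R u u"
| sym: "word_eq R u v \<Longrightarrow> word_eq R v u"
| trans: "word_eq R u v \<Longrightarrow> word_eq R v w \<Longrightarrow> word_eq R u w"
| append: "word_eq R u u' \<Longrightarrow> word_eq R v v' \<Longrightarrow> word_eq R (u @ v) (u' @ v')"
| cancel: "word_eq R [(g, s), (g, \<not> s)] []"
| relator: "r \<in> R \<Longrightarrow> word_eq R r []"

definition word_rel :: "'g gen_word set \<Rightarrow> 'g gen_word rel" where
  "word_rel R = {(u, v). word_eq R u v}"

definition presented_group :: "'g gen_word set \<Rightarrow> 'g gen_word set monoid" where
  "presented_group R =
     \<lparr> carrier = UNIV // word_rel R,
       mult = (\<lambda>A B. \<Union>u\<in>A. \<Union>v\<in>B. word_rel R `` {u @ v}),
       one = word_rel R `` {[]} \<rparr>"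

lemma equiv_word_eq: "equiv UNIV (word_rel R)"
  by (rule equivI) (auto simp: word_rel_def refl_on_def sym_def trans_def intro: word_eq.intros)

lemma presented_group_mult:
  "word_rel R `` {u} \<otimes>\<^bsub>presented_group R\<^esub> word_rel R `` {v}
     = word_rel R `` {u @ v}"
proof -
  have "congruent2 (word_rel R) (word_rel R)
          (\<lambda>u v. word_rel R `` {u @ v})"
    by (rule congruent2I', rule equiv_class_eq[OF equiv_word_eq]) (auto simp: word_rel_def intro: word_eq.append)
  from UN_equiv_class2[OF equiv_word_eq equiv_word_eq this]
  show ?thesis by (simp add: presented_group_def)
qed

lemma word_eq_inverse:
  "word_eq R (rev (map (\<lambda>(g, s). (g, \<not> s)) u) @ u) []"
proof (induction u)
  case (Cons a u)
  obtain g s where a: "a = (g, s)" by force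
  let ?i = "rev (map (\<lambda>(g, s). (g, \<not> s)) u)"
  have "word_eq R [(g, \<not> s), (g, s)] []"
    using word_eq.cancel[of R g "\<not> s"] by simp
  then have "word_eq R (?i @ ([(g, \<not> s), (g, s)] @ u)) (?i @ ([] @ u))"
    by (intro word_eq.append word_eq.refl)
  then show ?case
    using Cons.IH word_eq.trans by (simp add: a) blast
qed (simp add: word_eq.refl)

lemma group_presented_group: "group (presented_group R)"
proof -
  let ?G = "presented_group R" and ?c = "\<lambda>u. word_rel R `` {u}"
  have car: "carrier ?G = range ?c"
    by (auto simp: presented_group_def quotient_def)
  have one: "\<one>\<^bsub>?G\<^esub> = ?c []"
    by (simp add: presented_group_def)
  have inv: "?c (rev (map (\<lambda>(g, s). (g, \<not> s)) u) @ u) = ?c []" for u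
    by (rule equiv_class_eq[OF equiv_word_eq]) (simp add: word_rel_def word_eq_inverse)
  show ?thesis
  proof (rule groupI)
    fix A assume "A \<in> carrier ?G"
    then obtain u where "A = ?c u" by (auto simp: car)
    then show "\<exists>B\<in>carrier ?G. B \<otimes>\<^bsub>?G\<^esub> A = \<one>\<^bsub>?G\<^esub>"
      by (intro bexI[of _ "?c (rev (map (\<lambda>(g, s). (g, \<not> s)) u))"])
         (simp_all add: presented_group_mult inv one car)
  qed (auto simp: car one presented_group_mult)
qed

datatype dihedral_gen = Gen_a | Gen_b

definition dihedral_relators :: "nat \<Rightarrow> dihedral_gen gen_word set" where
  "dihedral_relators n =
     { [(Gen_a, True), (Gen_a, True)],
       replicate n (Gen_b, True),
       [(Gen_a, True), (Gen_b, True), (Gen_a, True), (Gen_b, True)] }"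

definition dihedral_group :: "nat \<Rightarrow> dihedral_gen gen_word set monoid" where
  "dihedral_group n =
     presented_group (dihedral_relators n)"

text \<open>
  The presented group has the expected order \<open>2 * n\<close>: a word is evaluated to the affine map
  \<open>x \<mapsto> s * x + t\<close>, recorded as \<open>(s, t)\<close>, with \<open>a\<close> acting by negation and \<open>b\<close> by translation
  by one.
\<close>

fun dihedral_eval :: "dihedral_gen gen_word \<Rightarrow> int \<times> int" where
  "dihedral_eval [] = (1, 0)"
| "dihedral_eval ((Gen_a, e) # w) = (- fst (dihedral_eval w), - snd (dihedral_eval w))"
| "dihedral_eval ((Gen_b, e) # w) =
     (fst (dihedral_eval w), snd (dihedral_eval w) + (if e then 1 else - 1))"

lemma dihedral_eval_append:
  "dihedral_eval (u @ v) =
     (fst (dihedral_eval u) * fst (dihedral_eval v),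
      snd (dihedral_eval u) + fst (dihedral_eval u) * snd (dihedral_eval v))"
  by (induction u rule: dihedral_eval.induct) (auto simp: algebra_simps)

lemma dihedral_eval_replicate: "dihedral_eval (replicate k (Gen_b, True)) = (1, int k)"
  by (induction k) auto

lemma dihedral_eval_cong:
  assumes "word_eq (dihedral_relators n) u v"
  shows "fst (dihedral_eval u) = fst (dihedral_eval v) \<and>
         int n dvd snd (dihedral_eval u) - snd (dihedral_eval v)"
  using assms
proof (induction rule: word_eq.induct)
  case (sym u v)
  then show ?case by (metis dvd_minus_iff minus_diff_eq)
next
  case (trans u v w)
  then show ?case using dvd_add[of "int n" "snd (dihedral_eval u) - snd (dihedral_eval v)"
      "snd (dihedral_eval v) - snd (dihedral_eval w)"] by simp
next
  case (append u u' v v')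
  then have "int n dvd (snd (dihedral_eval u) - snd (dihedral_eval u')) +
      fst (dihedral_eval u) * (snd (dihedral_eval v) - snd (dihedral_eval v'))"
    by (intro dvd_add dvd_mult) auto
  with append show ?case by (simp add: dihedral_eval_append algebra_simps)
next
  case (cancel g s)
  show ?case by (cases g) auto
next
  case (relator r)
  then show ?case by (auto simp: dihedral_relators_def dihedral_eval_replicate)
qed auto

definition dihedral_normal_form :: "nat \<Rightarrow> dihedral_gen gen_word set" where
  "dihedral_normal_form n =
     (\<lambda>(e, k). (if e then [(Gen_a, True)] else []) @ replicate k (Gen_b, True)) `
       (UNIV \<times> {..<n})"

lemma dihedral_letter_normal_form:
  assumes "n > 0" "v \<in> dihedral_normal_form n"
  shows "\<exists>w\<in>dihedral_normal_form n. word_eq (dihedral_relators n) (l # v) w"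
proof -
  let ?a = "(Gen_a, True)" and ?b = "(Gen_b, True)" and ?eq = "word_eq (dihedral_relators n)"
  note [trans] = word_eq.trans
  have app: "?eq (u @ v) (u' @ v)" if "?eq u u'" for u u' v
    by (intro word_eq.append that word_eq.refl)
  have appr: "?eq (v @ u) (v @ u')" if "?eq u u'" for u u' v
    by (intro word_eq.append that word_eq.refl)
  have aa: "?eq [?a, ?a] []" and bn: "?eq (replicate n ?b) []" and abab: "?eq [?a, ?b, ?a, ?b] []"
    by (rule word_eq.relator, simp add: dihedral_relators_def)+
  have a': "?eq [(Gen_a, False)] [?a]"
  proof -
    have "?eq [(Gen_a, False)] ([(Gen_a, False)] @ [?a, ?a])"
      using appr[OF word_eq.sym[OF aa], of "[(Gen_a, False)]"] by simp
    also have "?eq ([(Gen_a, False)] @ [?a, ?a]) [?a]"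
      using app[OF word_eq.cancel[of _ Gen_a False], of "[?a]"] by simp
    finally show ?thesis .
  qed
  have b': "?eq [(Gen_b, False)] (replicate (n - 1) ?b)"
  proof -
    have "?eq [(Gen_b, False)] ([(Gen_b, False)] @ replicate n ?b)"
      using appr[OF word_eq.sym[OF bn], of "[(Gen_b, False)]"] by simp
    also have "[(Gen_b, False)] @ replicate n ?b = [(Gen_b, False), ?b] @ replicate (n - 1) ?b"
      using \<open>n > 0\<close> by (cases n) auto
    also have "?eq \<dots> (replicate (n - 1) ?b)"
      using app[OF word_eq.cancel[of _ Gen_b False]] by simp
    finally show ?thesis .
  qed
  have ba: "?eq [?b, ?a] (?a # replicate (n - 1) ?b)"
  proof -
    have "?eq [?b, ?a] ([?a, ?a] @ [?b, ?a])"
      using app[OF word_eq.sym[OF aa], of "[?b, ?a]"] by simp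
    also have "?eq \<dots> ([?a, ?a, ?b, ?a] @ replicate n ?b)"
      using appr[OF word_eq.sym[OF bn], of "[?a, ?a, ?b, ?a]"] by simp
    also have "[?a, ?a, ?b, ?a] @ replicate n ?b = [?a] @ [?a, ?b, ?a, ?b] @ replicate (n - 1) ?b"
      using \<open>n > 0\<close> by (cases n) auto
    also have "?eq \<dots> ([?a] @ [] @ replicate (n - 1) ?b)"
      by (intro appr app abab)
    finally show ?thesis by simp
  qed
  have red: "\<exists>j<n. ?eq (replicate k ?b) (replicate j ?b)" for k
  proof (induction k rule: less_induct)
    case (less k)
    show ?case
    proof (cases "k < n")
      case True
      then show ?thesis using word_eq.refl by blast
    next
      case False
      then obtain j where j: "j < n" "?eq (replicate (k - n) ?b) (replicate j ?b)"
        using less.IH[of "k - n"] \<open>n > 0\<close> by auto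
      have "replicate k ?b = replicate n ?b @ replicate (k - n) ?b"
        using False by (simp flip: replicate_add)
      also have "?eq \<dots> ([] @ replicate j ?b)"
        by (intro word_eq.append bn j)
      finally show ?thesis using j(1) by auto
    qed
  qed
  have nf: "\<exists>w\<in>dihedral_normal_form n. ?eq (u @ replicate k ?b) w"
    if "u = [] \<or> u = [?a]" for u k
  proof -
    obtain j where j: "j < n" "?eq (replicate k ?b) (replicate j ?b)" using red by blast
    have "u @ replicate j ?b \<in> dihedral_normal_form n"
      unfolding dihedral_normal_form_def
      using that j(1) by (intro image_eqI[of _ _ "(u = [?a], j)"]) auto
    then show ?thesis using appr[OF j(2)] by blast
  qed
  have fin: ?thesis if "?eq (l # v) (u @ replicate k ?b)" "u = [] \<or> u = [?a]" for u k
    using nf[OF that(2), of k] word_eq.trans[OF that(1)] by blast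
  obtain e k where v: "v = (if e then [?a] else []) @ replicate k ?b"
    using assms(2) by (auto simp: dihedral_normal_form_def)
  obtain g s where l: "l = (g, s)" by force
  show ?thesis
  proof (cases g)
    case Gen_a
    have "?eq [l] [?a]"
      using a' word_eq.refl by (cases s) (auto simp: l Gen_a)
    from app[OF this, of v] have lv: "?eq (l # v) (?a # v)" by simp
    show ?thesis
    proof (cases e)
      case True
      have "?eq (?a # v) (replicate k ?b)"
        using app[OF aa, of "replicate k ?b"] True by (simp add: v)
      then show ?thesis using fin[of "[]" k] word_eq.trans[OF lv] by simp
    next
      case False
      then show ?thesis using fin[of "[?a]" k] lv by (simp add: v)
    qed
  next
    case Gen_b
    have "\<exists>m. ?eq [l] (replicate m ?b)"
    proof (cases s)
      case True
      then have "?eq [l] (replicate 1 ?b)" by (simp add: l Gen_b word_eq.refl)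
      then show ?thesis by blast
    next
      case False
      then show ?thesis using b' by (auto simp: l Gen_b)
    qed
    then obtain m where m: "?eq [l] (replicate m ?b)" by blast
    from app[OF m, of v] have lv: "?eq (l # v) (replicate m ?b @ v)" by simp
    show ?thesis
    proof (cases e)
      case True
      have "\<exists>i. ?eq (replicate m ?b @ [?a]) ([?a] @ replicate i ?b)"
      proof (induction m)
        case 0
        show ?case using word_eq.refl[of _ "[?a]"] by (intro exI[of _ 0]) simp
      next
        case (Suc m)
        then obtain i where i: "?eq (replicate m ?b @ [?a]) ([?a] @ replicate i ?b)" by blast
        have "?eq (replicate (Suc m) ?b @ [?a]) ([?b] @ [?a] @ replicate i ?b)"
          using appr[OF i, of "[?b]"] by simp
        also have "?eq \<dots> ((?a # replicate (n - 1) ?b) @ replicate i ?b)"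
          using app[OF ba, of "replicate i ?b"] by simp
        also have "\<dots> = [?a] @ replicate (n - 1 + i) ?b" by (simp add: replicate_add)
        finally show ?case by blast
      qed
      then obtain i where "?eq (replicate m ?b @ [?a]) ([?a] @ replicate i ?b)" by blast
      from app[OF this, of "replicate k ?b"]
      have "?eq (replicate m ?b @ v) ([?a] @ replicate (i + k) ?b)"
        using True by (simp add: v replicate_add)
      then show ?thesis using fin[of "[?a]" "i + k"] word_eq.trans[OF lv] by simp
    next
      case False
      then show ?thesis
        using fin[of "[]" "m + k"] lv by (simp add: v replicate_add)
    qed
  qed
qed

lemma order_dihedral_group:
  assumes "n > 0"
  shows "card (carrier (dihedral_group n)) = 2 * n"
proof -
  let ?N = "dihedral_normal_form n" and ?r = "word_rel (dihedral_relators n)"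
  let ?w = "\<lambda>(e, k). (if e then [(Gen_a, True)] else []) @ replicate k (Gen_b, True)"
  have red: "\<exists>v\<in>?N. word_eq (dihedral_relators n) u v" for u
  proof (induction u)
    case Nil
    have "[] \<in> ?N"
      using assms unfolding dihedral_normal_form_def
      by (intro image_eqI[of _ _ "(False, 0)"]) auto
    then show ?case using word_eq.refl by blast
  next
    case (Cons l u)
    then obtain v where v: "v \<in> ?N" "word_eq (dihedral_relators n) u v" by blast
    have "word_eq (dihedral_relators n) (l # u) (l # v)"
      using word_eq.append[OF word_eq.refl[of _ "[l]"] v(2)] by simp
    then show ?case
      using dihedral_letter_normal_form[OF assms v(1), of l] word_eq.trans by blast
  qed
  have cls: "\<exists>v\<in>?N. ?r `` {u} = ?r `` {v}" for u
  proof -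
    obtain v where v: "v \<in> ?N" "(u, v) \<in> ?r"
      using red[of u] by (auto simp: word_rel_def)
    then show ?thesis by (intro bexI[of _ v] equiv_class_eq[OF equiv_word_eq v(2)] v(1))
  qed
  have car: "carrier (dihedral_group n) = (\<lambda>v. ?r `` {v}) ` ?N"
  proof -
    have "carrier (dihedral_group n) = range (\<lambda>v. ?r `` {v})"
      by (auto simp: dihedral_group_def presented_group_def quotient_def)
    also have "\<dots> = (\<lambda>v. ?r `` {v}) ` ?N"
      using cls by (intro equalityI[OF _ image_mono[OF subset_UNIV]]) (simp add: image_subset_iff image_iff)
    finally show ?thesis .
  qed
  have ev: "dihedral_eval (?w (e, k)) = (if e then (- 1, - int k) else (1, int k))" for e k
    by (simp add: dihedral_eval_replicate)
  have inj: "inj_on (\<lambda>p. ?r `` {?w p}) (UNIV \<times> {..<n})"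
  proof (rule inj_onI)
    fix p q :: "bool \<times> nat"
    assume p: "p \<in> UNIV \<times> {..<n}" and q: "q \<in> UNIV \<times> {..<n}" and "?r `` {?w p} = ?r `` {?w q}"
    then have "(?w p, ?w q) \<in> ?r"
      using eq_equiv_class_iff[OF equiv_word_eq UNIV_I UNIV_I] by blast
    then have "word_eq (dihedral_relators n) (?w p) (?w q)"
      by (simp only: word_rel_def mem_Collect_eq case_prod_conv)
    note c = dihedral_eval_cong[OF this]
    obtain e k e' k' where pq: "p = (e, k)" "q = (e', k')" by force
    have e: "e = e'" using c unfolding pq ev by (auto split: if_splits)
    have "int n dvd int k - int k'"
      using c unfolding pq ev e by (auto split: if_splits simp: dvd_diff_commute)
    then have "int k mod int n = int k' mod int n" by (simp add: mod_eq_dvd_iff)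
    then have "k = k'" using p q by (simp add: pq)
    then show "p = q" by (simp add: pq e)
  qed
  have "carrier (dihedral_group n) = (\<lambda>p. ?r `` {?w p}) ` (UNIV \<times> {..<n})"
    unfolding car dihedral_normal_form_def image_image ..
  then show ?thesis
    using card_image[OF inj] by (simp add: card_cartesian_product)
qed


section \<open>Links in the 3-sphere\<close>

abbreviation three_sphere :: "(real^4) set" where
  "three_sphere \<equiv> sphere 0 1"

definition polygonal :: "'a::real_vector set \<Rightarrow> bool" where
  "polygonal S \<longleftrightarrow>
     (\<exists>E. finite E \<and> (\<forall>e\<in>E. \<exists>a b. e = closed_segment a b) \<and> S = \<Union>E)"

text \<open>
  A link is tame if some homeomorphism of the 3-sphere onto the one-point compactification of
  \<open>\<real>\<^sup>3\<close> takes it to a polygonal link in \<open>\<real>\<^sup>3\<close>. Such a homeomorphism is the same as one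
  from the complement of a point \<open>p\<close>, which is sent to infinity, onto \<open>\<real>\<^sup>3\<close>. All
  smooth, piecewise linear and locally flat links are tame.
\<close>

definition tame :: "(real^4) set \<Rightarrow> bool" where
  "tame L \<longleftrightarrow>
     (\<exists>p h h'. p \<in> three_sphere - L \<and>
        homeomorphism (three_sphere - {p}) (UNIV :: (real^3) set) h h' \<and>
        polygonal (h ` L))"

text \<open>
  As the components are finite in number and compact, they are also open in \<open>L\<close>, so \<open>L\<close>
  is homeomorphic to a disjoint union of circles.
\<close>

definition is_link :: "(real^4) set \<Rightarrow> bool" where
  "is_link L \<longleftrightarrow>
     L \<subseteq> three_sphere \<and> finite (components L) \<and>
     (\<forall>C\<in>components L. C homeomorphic sphere (0::real^2) 1) \<and> tame L"

abbreviation link_group :: "(real^4) set \<Rightarrow> real^4 \<Rightarrow> (real \<Rightarrow> real^4) set monoid" where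
  "link_group L x \<equiv> fundamental_group (three_sphere - L) x"

end

theory Submission
  imports Defs "HOL-Computational_Algebra.Polynomial"
begin

text \<open>
  Among three components one can choose a nonempty set \<open>S\<close> of one or two of the first two such that
  the third component \<open>K\<close> has even linking number with \<open>S\<close>. Colour the strands of \<open>S\<close> by reflections
  \<open>x \<mapsto> t - x\<close> of \<open>\<int>\<close>, those of \<open>K\<close> by translations \<open>x \<mapsto> x \<plusminus> y\<close> (the parity makes the signs
  consistent around \<open>K\<close>) and all others by the identity. The Wirtinger relations become homogeneous
  linear equations for the integers \<open>t\<close> and \<open>y\<close>: there is one unknown per strand of \<open>S\<close> and the extra
  unknown \<open>y\<close>, and one equation per vertex of \<open>S\<close>, of which one is redundant. So there is a nonzero
  solution even if some fixed \<open>t\<close> is required to vanish, which after division by the greatest common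
  divisor yields a surjection onto the infinite dihedral group \<open>\<int> \<rtimes> {\<plusminus>1}\<close>, and hence onto
  \<open>D\<^sub>n\<close>.

  Instead of computing the link group, the homomorphism is obtained as the holonomy of a local system
  on the complement: crossing the vertical wall below a strand multiplies by its colour.
\<close>

section \<open>Local systems and holonomy\<close>

text \<open>The normalization excludes a solution that always exists: the same \<open>t\<close> on
  all strands of the reflection set and \<open>y = 0\<close>, whose image has order two. With it
  there are as many equations as reflection strands, and a determinant might forbid a nonzero
  solution; the component coloured by translations supplies the one further unknown. Its signs have
  to close up after one turn around that component. The obstruction is a sign that is multiplicative
  in the reflection set, so if two candidates are both obstructed, their union is not.

  Colours do not commute, so relations compare ordered products. Strands are cut wherever
  projections cross, and any number of them may end over one point of the plane. The relations then
  say that at every height the colours above it have the same product on the left and on the right.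

  One equation is redundant because the product over a whole level plane is trivial: it does not
  change from plane to plane, and a far plane misses the link. The point of the sphere sent to
  infinity belongs to the complement, so the local system also has to be extended across it.\<close>

definition local_system :: "'a::topological_space set \<Rightarrow> ('a \<Rightarrow> 'a \<Rightarrow> 'g::group_add) \<Rightarrow> bool" where
  "local_system X f \<longleftrightarrow>
     (\<forall>x0\<in>X. \<forall>\<^sub>F x1 in nhds x0. x1 \<in> X \<longrightarrow>
        (\<exists>g. \<forall>\<^sub>F y in nhds x1. y \<in> X \<longrightarrow> f x0 y = g + f x1 y))"

text \<open>\<open>f x0\<close> is one section near \<open>x0\<close>, and the others are its left
  translates; \<open>group_add\<close> does not assume commutativity, so the side matters. The
  functions \<open>f x0\<close> may jump; only the comparison of their germs is locally
  constant.\<close>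

abbreviation section_at ::
    "('a \<Rightarrow> 'a \<Rightarrow> 'g::group_add) \<Rightarrow> 'k::topological_space set \<Rightarrow> ('k \<Rightarrow> 'a) \<Rightarrow> ('k \<Rightarrow> 'g) \<Rightarrow> 'k \<Rightarrow> bool"
  where
  "section_at f K q F t0 \<equiv> \<exists>g. \<forall>\<^sub>F t in nhds t0. t \<in> K \<longrightarrow> F t = g + f (q t0) (q t)"

definition section_along ::
    "('a \<Rightarrow> 'a \<Rightarrow> 'g::group_add) \<Rightarrow> 'k::topological_space set \<Rightarrow> ('k \<Rightarrow> 'a) \<Rightarrow> ('k \<Rightarrow> 'g) \<Rightarrow> bool"
  where
  "section_along f K q F \<longleftrightarrow>
     (\<forall>t0\<in>K. section_at f K q F t0)"

lemma eventually_nhdsE: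
  assumes "\<forall>\<^sub>F x in nhds a. P x"
  obtains U where "open U" "a \<in> U" "\<And>x. x \<in> U \<Longrightarrow> P x"
  using assms unfolding eventually_nhds by blast

lemma continuous_on_eventually_nhds:
  assumes "continuous_on K q" "t \<in> K" "\<forall>\<^sub>F y in nhds (q t). P y"
  shows "\<forall>\<^sub>F s in nhds t. s \<in> K \<longrightarrow> P (q s)"
proof -
  obtain W where W: "open W" "q t \<in> W" "\<And>y. y \<in> W \<Longrightarrow> P y"
    using eventually_nhdsE[OF assms(3)] by metis
  then obtain U where "open U" "t \<in> U" "\<forall>s\<in>K. s \<in> U \<longrightarrow> q s \<in> W"
    using assms(1)[unfolded continuous_on_topological, rule_format, OF assms(2)] by metis
  then show ?thesis
    unfolding eventually_nhds using W(3) by (intro exI[of _ U]) simp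
qed

lemma section_along_local:
  assumes "local_system X f" "continuous_on K q" "q ` K \<subseteq> X" "t0 \<in> K"
  obtains U where "open U" "t0 \<in> U" "section_along f (K \<inter> U) q (\<lambda>t. f (q t0) (q t))"
proof -
  have qt0: "q t0 \<in> X" using assms(3,4) by blast
  have "\<forall>\<^sub>F x1 in nhds (q t0). x1 \<in> X \<longrightarrow>
      (\<exists>g. \<forall>\<^sub>F y in nhds x1. y \<in> X \<longrightarrow> f (q t0) y = g + f x1 y)"
    using assms(1)[unfolded local_system_def] qt0 by (rule bspec)
  note ev0 = continuous_on_eventually_nhds[OF assms(2,4) this]
  obtain U where U: "open U" "t0 \<in> U"
    and ev1: "\<And>s. s \<in> U \<Longrightarrow> s \<in> K \<longrightarrow> q s \<in> X \<longrightarrow>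
      (\<exists>g. \<forall>\<^sub>F y in nhds (q s). y \<in> X \<longrightarrow> f (q t0) y = g + f (q s) y)"
    using eventually_nhdsE[OF ev0] by metis
  have ev: "\<exists>g. \<forall>\<^sub>F y in nhds (q s). y \<in> X \<longrightarrow> f (q t0) y = g + f (q s) y" if "s \<in> U" "s \<in> K" for s
  proof -
    have "q s \<in> X" using assms(3) that(2) by (rule subsetD[OF _ imageI])
    with ev1[OF that(1)] that(2) show ?thesis by simp
  qed
  have "section_along f (K \<inter> U) q (\<lambda>t. f (q t0) (q t))"
    unfolding section_along_def
  proof
    fix s assume s: "s \<in> K \<inter> U"
    then obtain g where g: "\<forall>\<^sub>F y in nhds (q s). y \<in> X \<longrightarrow> f (q t0) y = g + f (q s) y"
      using ev by (elim IntE) metis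
    have "s \<in> K" using s by simp
    from continuous_on_eventually_nhds[OF assms(2) this g]
    have "\<forall>\<^sub>F t in nhds s. t \<in> K \<longrightarrow> q t \<in> X \<longrightarrow> f (q t0) (q t) = g + f (q s) (q t)" .
    then have "\<forall>\<^sub>F t in nhds s. t \<in> K \<inter> U \<longrightarrow> f (q t0) (q t) = g + f (q s) (q t)"
      by (rule eventually_mono) (use assms(3) in blast)
    then show "\<exists>g. \<forall>\<^sub>F t in nhds s. t \<in> K \<inter> U \<longrightarrow> f (q t0) (q t) = g + f (q s) (q t)" by blast
  qed
  with U that show ?thesis by blast
qed

lemma section_along_subset:
  "section_along f K q F \<Longrightarrow> K' \<subseteq> K \<Longrightarrow> section_along f K' q F"
  unfolding section_along_def
proof
  fix t0 assume F: "\<forall>t0\<in>K. section_at f K q F t0"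
    and sub: "K' \<subseteq> K" and "t0 \<in> K'"
  then obtain g where "\<forall>\<^sub>F t in nhds t0. t \<in> K \<longrightarrow> F t = g + f (q t0) (q t)" by blast
  then have "\<forall>\<^sub>F t in nhds t0. t \<in> K' \<longrightarrow> F t = g + f (q t0) (q t)"
    by (rule eventually_mono) (use sub in auto)
  then show "section_at f K' q F t0" ..
qed

lemma section_along_cong:
  assumes "section_along f K q F" "\<And>t. t \<in> K \<Longrightarrow> F t = F' t" "\<And>t. t \<in> K \<Longrightarrow> q t = q' t"
  shows "section_along f K q' F'"
  unfolding section_along_def
proof
  fix t0 assume t0: "t0 \<in> K"
  then obtain g where "\<forall>\<^sub>F t in nhds t0. t \<in> K \<longrightarrow> F t = g + f (q t0) (q t)"
    using assms(1) unfolding section_along_def by blast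
  then have "\<forall>\<^sub>F t in nhds t0. t \<in> K \<longrightarrow> F' t = g + f (q' t0) (q' t)"
    by (rule eventually_mono) (use assms(2,3) t0 in auto)
  then show "section_at f K q' F' t0" by blast
qed

lemma section_along_translate:
  "section_along f K q F \<Longrightarrow> section_along f K q (\<lambda>t. c + F t)"
  unfolding section_along_def
proof
  fix t0 assume "\<forall>t0\<in>K. section_at f K q F t0" "t0 \<in> K"
  then obtain g where "\<forall>\<^sub>F t in nhds t0. t \<in> K \<longrightarrow> F t = g + f (q t0) (q t)" by blast
  then have "\<forall>\<^sub>F t in nhds t0. t \<in> K \<longrightarrow> c + F t = (c + g) + f (q t0) (q t)"
    by (rule eventually_mono) (simp add: add.assoc)
  then show "\<exists>g. \<forall>\<^sub>F t in nhds t0. t \<in> K \<longrightarrow> c + F t = g + f (q t0) (q t)" by blast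
qed

lemma section_along_compose:
  assumes "section_along f K q F" "continuous_on K' \<phi>" "\<phi> ` K' \<subseteq> K"
  shows "section_along f K' (\<lambda>t. q (\<phi> t)) (\<lambda>t. F (\<phi> t))"
  unfolding section_along_def
proof
  fix t0 assume t0: "t0 \<in> K'"
  then obtain g where "\<forall>\<^sub>F t in nhds (\<phi> t0). t \<in> K \<longrightarrow> F t = g + f (q (\<phi> t0)) (q t)"
    using assms(1,3) unfolding section_along_def by blast
  from continuous_on_eventually_nhds[OF assms(2) t0 this]
  have "\<forall>\<^sub>F s in nhds t0. s \<in> K' \<longrightarrow> F (\<phi> s) = g + f (q (\<phi> t0)) (q (\<phi> s))"
    by (rule eventually_mono) (use assms(3) in blast)
  then show "\<exists>g. \<forall>\<^sub>F s in nhds t0. s \<in> K' \<longrightarrow> F (\<phi> s) = g + f (q (\<phi> t0)) (q (\<phi> s))" by blast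
qed

text \<open>In \<open>F' t - F t\<close> the common germ cancels on the right, so two sections
  differ by a constant left translation, which \<open>- F s + F t\<close> does not see.\<close>

lemma section_along_unique:
  assumes "connected K" "section_along f K q F" "section_along f K q F'" "s \<in> K" "t \<in> K"
  shows "- F s + F t = - F' s + F' t"
proof -
  have "(\<lambda>t. F' t - F t) constant_on K"
  proof (rule locally_constant_imp_constant[OF assms(1)])
    fix t0 assume t0: "t0 \<in> K"
    obtain g where g: "\<forall>\<^sub>F t in nhds t0. t \<in> K \<longrightarrow> F t = g + f (q t0) (q t)"
      using assms(2) t0 unfolding section_along_def by blast
    obtain g' where g': "\<forall>\<^sub>F t in nhds t0. t \<in> K \<longrightarrow> F' t = g' + f (q t0) (q t)"
      using assms(3) t0 unfolding section_along_def by blast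
    have "\<forall>\<^sub>F t in nhds t0. t \<in> K \<longrightarrow> F' t - F t = g' - g"
      using g g' by eventually_elim
        (metis add_diff_cancel diff_add_eq_diff_diff_swap)
    then obtain U where U: "open U" "t0 \<in> U" "\<And>t. t \<in> U \<Longrightarrow> t \<in> K \<Longrightarrow> F' t - F t = g' - g"
      unfolding eventually_nhds by blast
    show "\<exists>T. openin (top_of_set K) T \<and> t0 \<in> T \<and> (\<forall>x\<in>T. F' x - F x = F' t0 - F t0)"
      using U t0 by (intro exI[of _ "K \<inter> U"]) auto
  qed
  then obtain c where "\<And>t. t \<in> K \<Longrightarrow> F' t - F t = c"
    unfolding constant_on_def by blast
  then have F': "F' t = c + F t" if "t \<in> K" for t
    using that by (metis diff_add_cancel)
  show ?thesis
    using assms(4,5) by (simp add: F' minus_add add.assoc[symmetric])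
qed

lemma section_along_Un:
  assumes "section_along f K1 q F1" "section_along f K2 q F2"
    and "closed K1" "closed K2" "connected (K1 \<inter> K2)" "K1 \<inter> K2 \<noteq> {}"
  shows "\<exists>F. section_along f (K1 \<union> K2) q F"
proof -
  obtain s where s: "s \<in> K1 \<inter> K2" using assms(6) by blast
  \<comment> \<open>The second section is translated to agree with the first at \<open>s\<close>; by
    uniqueness they then agree on the whole connected intersection.\<close>
  define F where "F t = (if t \<in> K1 then F1 t else (F1 s - F2 s) + F2 t)" for t
  have s1: "section_along f K1 q F"
    by (rule section_along_cong[OF assms(1)]) (auto simp: F_def)
  have s2: "section_along f K2 q F"
  proof (rule section_along_cong[OF section_along_translate[OF assms(2), of "F1 s - F2 s"]])
    fix t assume t: "t \<in> K2"
    show "F1 s - F2 s + F2 t = F t"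
    proof (cases "t \<in> K1")
      case True
      have "- F1 s + F1 t = - F2 s + F2 t"
        by (rule section_along_unique[of "K1 \<inter> K2" f q])
           (use assms s t True section_along_subset in blast)+
      then have "F1 s + (- F1 s + F1 t) = F1 s + (- F2 s + F2 t)" by simp
      then show ?thesis by (simp add: F_def True) (simp add: add.assoc[symmetric])
    qed (simp add: F_def)
  qed simp
  have "section_along f (K1 \<union> K2) q F"
    unfolding section_along_def
  proof
    fix t0 assume "t0 \<in> K1 \<union> K2"
    have part: "\<exists>g. (t0 \<in> K \<longrightarrow> F t0 = g + f (q t0) (q t0)) \<and>
        (\<forall>\<^sub>F t in nhds t0. t \<in> K \<longrightarrow> F t = g + f (q t0) (q t))"
      if "section_along f K q F" "closed K" for K
    proof (cases "t0 \<in> K")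
      case True
      then obtain g where g: "\<forall>\<^sub>F t in nhds t0. t \<in> K \<longrightarrow> F t = g + f (q t0) (q t)"
        using \<open>section_along f K q F\<close> unfolding section_along_def by blast
      then show ?thesis using eventually_nhds_x_imp_x[OF g] by blast
    next
      case False
      have "\<forall>\<^sub>F t in nhds t0. t \<in> - K"
        using False \<open>closed K\<close> by (intro eventually_nhds_in_open) auto
      then show ?thesis using False by (auto elim: eventually_mono)
    qed
    obtain g1 where g1: "t0 \<in> K1 \<longrightarrow> F t0 = g1 + f (q t0) (q t0)"
        "\<forall>\<^sub>F t in nhds t0. t \<in> K1 \<longrightarrow> F t = g1 + f (q t0) (q t)"
      using part[OF s1 assms(3)] by blast
    obtain g2 where g2: "t0 \<in> K2 \<longrightarrow> F t0 = g2 + f (q t0) (q t0)"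
        "\<forall>\<^sub>F t in nhds t0. t \<in> K2 \<longrightarrow> F t = g2 + f (q t0) (q t)"
      using part[OF s2 assms(4)] by blast
    have out: "\<forall>\<^sub>F t in nhds t0. t \<notin> K" if "t0 \<notin> K" "closed K" for K
      using that eventually_nhds_in_open[of "- K" t0] by auto
    consider "t0 \<in> K1" "t0 \<in> K2" | "t0 \<in> K1" "t0 \<notin> K2" | "t0 \<notin> K1" "t0 \<in> K2"
      using \<open>t0 \<in> K1 \<union> K2\<close> by blast
    then show "section_at f (K1 \<union> K2) q F t0"
    proof cases
      case 1
      \<comment> \<open>Both descriptions give the value \<open>F t0\<close> at \<open>t0\<close>
        itself, which fixes the translation.\<close>
      then have "g1 = g2" using g1(1) g2(1) by simp
      then have "\<forall>\<^sub>F t in nhds t0. t \<in> K1 \<union> K2 \<longrightarrow> F t = g1 + f (q t0) (q t)"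
        using g1(2) g2(2) by (auto elim: eventually_elim2)
      then show ?thesis by blast
    next
      case 2
      have "\<forall>\<^sub>F t in nhds t0. t \<in> K1 \<union> K2 \<longrightarrow> F t = g1 + f (q t0) (q t)"
        using g1(2) out[OF 2(2) assms(4)] by eventually_elim auto
      then show ?thesis by blast
    next
      case 3
      have "\<forall>\<^sub>F t in nhds t0. t \<in> K1 \<union> K2 \<longrightarrow> F t = g2 + f (q t0) (q t)"
        using g2(2) out[OF 3(1) assms(3)] by eventually_elim auto
      then show ?thesis by blast
    qed
  qed
  then show ?thesis by blast
qed

section \<open>Continuation of sections over the unit square\<close>

text \<open>Compactness enters as Bolzano's bisection, twice: small boxes are glued in the second
  coordinate to a strip of positive width, then strips in the first coordinate to the square.
  Neighbouring pieces share a segment, which is connected as gluing demands.\<close>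

lemma section_along_square:
  fixes q :: "real \<times> real \<Rightarrow> 'a::topological_space"
  assumes ls: "local_system X f" and q: "continuous_on ({0..1} \<times> {0..1}) q"
    and im: "q ` ({0..1} \<times> {0..1}) \<subseteq> X"
  shows "\<exists>F. section_along f ({0..1} \<times> {0..1}) q F"
proof -
  have ex_strip: "\<exists>\<delta>>0. \<exists>F. section_along f (({s - \<delta>..s + \<delta>} \<inter> {0..1}) \<times> {0..1}) q F"
    if s: "s \<in> {0..1}" for s
  proof -
    let ?P = "\<lambda>t1 t2. t1 \<in> {0..1} \<and> t2 \<in> {0..1} \<longrightarrow>
        (\<exists>\<delta>>0. \<exists>F. section_along f (({s - \<delta>..s + \<delta>} \<inter> {0..1}) \<times> {t1..t2}) q F)"
    have "?P 0 1"
    proof (rule Bolzano[of 0 1 ?P])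
      fix a b c :: real
      assume P: "?P a b" "?P b c" and le: "a \<le> b" "b \<le> c"
      show "?P a c"
      proof
        assume ac: "a \<in> {0..1} \<and> c \<in> {0..1}"
        then obtain d1 F1 d2 F2 where
          F1: "d1 > 0" "section_along f (({s - d1..s + d1} \<inter> {0..1}) \<times> {a..b}) q F1" and
          F2: "d2 > 0" "section_along f (({s - d2..s + d2} \<inter> {0..1}) \<times> {b..c}) q F2"
          using P le by fastforce
        define d where "d = min d1 d2"
        let ?I = "{s - d..s + d} \<inter> {0..1}"
        have d: "d > 0" using F1 F2 by (simp add: d_def)
        have eq: "?I \<times> {a..b} \<inter> ?I \<times> {b..c} = ?I \<times> {b}" "?I \<times> {a..b} \<union> ?I \<times> {b..c} = ?I \<times> {a..c}"
          using le by auto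
        have "\<exists>F. section_along f (?I \<times> {a..b} \<union> ?I \<times> {b..c}) q F"
        proof (rule section_along_Un)
          show "section_along f (?I \<times> {a..b}) q F1"
            by (rule section_along_subset[OF F1(2)]) (auto simp: d_def)
          show "section_along f (?I \<times> {b..c}) q F2"
            by (rule section_along_subset[OF F2(2)]) (auto simp: d_def)
          show "closed (?I \<times> {a..b})" "closed (?I \<times> {b..c})"
            by (intro closed_Times closed_Int closed_atLeastAtMost)+
          have "connected ?I"
            by (simp add: connected_Icc)
          then show "connected (?I \<times> {a..b} \<inter> ?I \<times> {b..c})"
            unfolding eq by (intro connected_Times) auto
          have "(s, b) \<in> ?I \<times> {b}" using s d by auto
          then show "?I \<times> {a..b} \<inter> ?I \<times> {b..c} \<noteq> {}" unfolding eq by blast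
        qed
        then show "\<exists>\<delta>>0. \<exists>F. section_along f (({s - \<delta>..s + \<delta>} \<inter> {0..1}) \<times> {a..c}) q F"
          unfolding eq using d by blast
      qed
    next
      fix t :: real assume t: "0 \<le> t" "t \<le> 1"
      obtain U where U: "open U" "(s, t) \<in> U"
        "section_along f (({0..1} \<times> {0..1}) \<inter> U) q (\<lambda>x. f (q (s,t)) (q x))"
        by (rule section_along_local[OF ls q im, of "(s, t)"]) (use s t in auto)
      obtain A B where AB: "open A" "open B" "s \<in> A" "t \<in> B" "A \<times> B \<subseteq> U"
        using open_prod_elim[OF U(1,2)] by (metis mem_Sigma_iff)
      obtain d where d: "d > 0" "cball s d \<subseteq> A" using AB open_contains_cball by blast
      obtain e where e: "e > 0" "cball t e \<subseteq> B" using AB open_contains_cball by blast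
      have "\<exists>\<delta>>0. \<exists>F. section_along f (({s - \<delta>..s + \<delta>} \<inter> {0..1}) \<times> {a..b}) q F"
        if ab: "a \<le> t \<and> t \<le> b \<and> b - a < e" "a \<in> {0..1} \<and> b \<in> {0..1}" for a b
      proof -
        have "({s - d..s + d} \<inter> {0..1}) \<times> {a..b} \<subseteq> ({0..1} \<times> {0..1}) \<inter> U"
        proof -
          have "{s - d..s + d} \<subseteq> A" using d(2) by (auto simp: cball_eq_atLeastAtMost)
          moreover have "{a..b} \<subseteq> B" using e(2) ab(1) by (auto simp: cball_eq_atLeastAtMost)
          ultimately have "({s - d..s + d} \<inter> {0..1}) \<times> {a..b} \<subseteq> A \<times> B" by blast
          moreover have "({s - d..s + d} \<inter> {0..1}) \<times> {a..b} \<subseteq> {0..1} \<times> {0..1}"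
            using ab(2) by auto
          ultimately show ?thesis using AB(5) by blast
        qed
        from section_along_subset[OF U(3) this]
        show "\<exists>\<delta>>0. \<exists>F. section_along f (({s - \<delta>..s + \<delta>} \<inter> {0..1}) \<times> {a..b}) q F"
          using d(1) by blast
      qed
      then show "\<exists>d>0. \<forall>a b. a \<le> t \<and> t \<le> b \<and> b - a < d \<longrightarrow> ?P a b"
        using e(1) by blast
    qed auto
    then show ?thesis by auto
  qed
  let ?P = "\<lambda>s1 s2. s1 \<in> {0..1} \<and> s2 \<in> {0..1} \<longrightarrow>
      (\<exists>F. section_along f ({s1..s2} \<times> {0..1}) q F)"
  have "?P 0 1"
  proof (rule Bolzano[of 0 1 ?P])
    fix a b c :: real
    assume P: "?P a b" "?P b c" and le: "a \<le> b" "b \<le> c"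
    show "?P a c"
    proof
      assume ac: "a \<in> {0..1} \<and> c \<in> {0..1}"
      then obtain F1 F2 where
        F1: "section_along f ({a..b} \<times> {0..1}) q F1" and F2: "section_along f ({b..c} \<times> {0..1}) q F2"
        using P le by fastforce
      have eq: "{a..b} \<times> {0..1} \<inter> {b..c} \<times> {0..1} = {b} \<times> {0..1::real}"
        "{a..b} \<times> {0..1} \<union> {b..c} \<times> {0..1} = {a..c} \<times> {0..1::real}"
        using le by auto
      have "\<exists>F. section_along f ({a..b} \<times> {0..1} \<union> {b..c} \<times> {0..1}) q F"
        by (rule section_along_Un[OF F1 F2])
           (auto simp: eq intro!: closed_Times connected_Times)
      then show "\<exists>F. section_along f ({a..c} \<times> {0..1}) q F" unfolding eq .
    qed
  next
    fix s :: real assume s: "0 \<le> s" "s \<le> 1"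
    obtain d F where d: "d > 0" "section_along f (({s - d..s + d} \<inter> {0..1}) \<times> {0..1}) q F"
      using ex_strip[of s] s by auto
    show "\<exists>d>0. \<forall>a b. a \<le> s \<and> s \<le> b \<and> b - a < d \<longrightarrow> ?P a b"
    proof (intro exI[of _ d] conjI allI impI d)
      fix a b :: real
      assume "a \<le> s \<and> s \<le> b \<and> b - a < d" "a \<in> {0..1} \<and> b \<in> {0..1}"
      then have "{a..b} \<times> {0..1} \<subseteq> ({s - d..s + d} \<inter> {0..1}) \<times> {0..1::real}" by auto
      from section_along_subset[OF d(2) this]
      show "\<exists>F. section_along f ({a..b} \<times> {0..1}) q F" by blast
    qed
  qed auto
  then show ?thesis by auto
qed

lemma section_along_path:
  assumes ls: "local_system X f" and "path p" "path_image p \<subseteq> X"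
  obtains F where "section_along f {0..1} p F"
proof -
  have "continuous_on ({0..1} \<times> {0..1}) (\<lambda>x::real \<times> real. p (snd x))"
    using assms(2) unfolding path_def
    by (rule continuous_on_compose2[of "{0..1}" p]) (auto intro: continuous_intros)
  then obtain F where F: "section_along f ({0..1} \<times> {0..1}) (\<lambda>x::real \<times> real. p (snd x)) F"
    using section_along_square[OF ls] assms(3) unfolding path_image_def by fastforce
  have "section_along f {0..1} (\<lambda>t. p (snd (0::real, t))) (\<lambda>t. F (0, t))"
    by (rule section_along_compose[OF F]) (auto intro!: continuous_intros)
  then show ?thesis using that by simp
qed

section \<open>Holonomy of paths\<close>

definition holonomy :: "('a::topological_space \<Rightarrow> 'a \<Rightarrow> 'g::group_add) \<Rightarrow> (real \<Rightarrow> 'a) \<Rightarrow> 'g" where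
  "holonomy f p = (THE g. \<exists>F. section_along f {0..1} p F \<and> g = - F 0 + F 1)"

lemma holonomy_eq:
  assumes "section_along f {0..1} p F"
  shows "holonomy f p = - F 0 + F 1"
  unfolding holonomy_def
proof (rule the_equality)
  fix g assume "\<exists>F. section_along f {0..1} p F \<and> g = - F 0 + F 1"
  then show "g = - F 0 + F 1"
    using section_along_unique[OF connected_Icc _ assms, of _ 0 1] by auto
qed (use assms in blast)

text \<open>A section over the square of the homotopy restricts to sections along both paths. On the
  two sides where the homotopy rests, constants are sections, so the corner values agree in
  pairs.\<close>

lemma holonomy_homotopic:
  assumes ls: "local_system X f" and "homotopic_paths X p q"
  shows "holonomy f p = holonomy f q"
proof -
  obtain h where h: "continuous_on ({0..1} \<times> {0..1}) h" "h ` ({0..1} \<times> {0..1}) \<subseteq> X"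
    and h0: "\<And>x. x \<in> {0..1} \<Longrightarrow> h (0, x) = p x" and h1: "\<And>x. x \<in> {0..1} \<Longrightarrow> h (1, x) = q x"
    and he: "\<And>t. t \<in> {0..1::real} \<Longrightarrow> h (t, 0) = p 0 \<and> h (t, 1) = p 1"
    using assms(2) unfolding homotopic_paths
    by (auto simp: pathstart_def pathfinish_def image_subset_iff_funcset)
  obtain F where F: "section_along f ({0..1} \<times> {0..1}) h F"
    using section_along_square[OF ls h] by blast
  have row: "section_along f {0..1} (\<lambda>t. h (s, t)) (\<lambda>t. F (s, t))" if "s \<in> {0..1}" for s
    by (rule section_along_compose[OF F]) (use that in \<open>auto intro!: continuous_intros\<close>)
  have col: "section_along f {0..1} (\<lambda>s. h (s, t)) (\<lambda>s. F (s, t))" if "t \<in> {0..1}" for t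
    by (rule section_along_compose[OF F]) (use that in \<open>auto intro!: continuous_intros\<close>)
  have const: "F (0, t) = F (1, t)" if "t \<in> {0..1}" "\<And>s. s \<in> {0..1} \<Longrightarrow> h (s, t) = c" for t c
  proof -
    have "section_along f {0..1} (\<lambda>s::real. c) (\<lambda>s. F (s, t))"
      by (rule section_along_cong[OF col[OF that(1)]]) (use that in auto)
    moreover have "section_along f {0..1::real} (\<lambda>s. c) (\<lambda>s. f c c)"
      unfolding section_along_def by (auto intro!: exI[of _ 0])
    ultimately have "- F (0, t) + F (1, t) = - f c c + f c c"
      by (rule section_along_unique[OF connected_Icc]) auto
    then show ?thesis by (simp add: eq_neg_iff_add_eq_0 add_eq_0_iff)
  qed
  have "holonomy f p = - F (0, 0) + F (0, 1)"
    by (rule holonomy_eq[OF section_along_cong[OF row[of 0]]]) (use h0 in auto)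
  moreover have "holonomy f q = - F (1, 0) + F (1, 1)"
    by (rule holonomy_eq[OF section_along_cong[OF row[of 1]]]) (use h1 in auto)
  ultimately show ?thesis
    using const[of 0 "p 0"] const[of 1 "p 1"] he by simp
qed

lemma holonomy_join:
  assumes ls: "local_system X f"
    and "path p" "path_image p \<subseteq> X" "path q" "path_image q \<subseteq> X" "pathfinish p = pathstart q"
  shows "holonomy f (p +++ q) = holonomy f p + holonomy f q"
proof -
  obtain F where F: "section_along f {0..1} (p +++ q) F"
    by (rule section_along_path[OF ls, of "p +++ q"]) (use assms in \<open>auto simp: path_image_join\<close>)
  have "section_along f {0..1} (\<lambda>t. (p +++ q) (t / 2)) (\<lambda>t. F (t / 2))"
    by (rule section_along_compose[OF F]) (auto intro!: continuous_intros)
  then have "section_along f {0..1} p (\<lambda>t. F (t / 2))"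
    by (rule section_along_cong) (auto simp: joinpaths_def)
  moreover have "section_along f {0..1} (\<lambda>t. (p +++ q) ((t + 1) / 2)) (\<lambda>t. F ((t + 1) / 2))"
    by (rule section_along_compose[OF F]) (auto intro!: continuous_intros)
  then have "section_along f {0..1} q (\<lambda>t. F ((t + 1) / 2))"
    by (rule section_along_cong)
       (use assms(6) in \<open>auto simp: joinpaths_def pathfinish_def pathstart_def field_simps\<close>)
  ultimately show ?thesis
    using holonomy_eq[OF F] by (simp add: holonomy_eq add.assoc)
qed

lemma holonomy_reversepath:
  assumes ls: "local_system X f" and "path p" "path_image p \<subseteq> X"
  shows "holonomy f (reversepath p) = - holonomy f p"
proof -
  obtain F where F: "section_along f {0..1} p F"
    by (rule section_along_path[OF assms])
  have "section_along f {0..1} (\<lambda>t. p (1 - t)) (\<lambda>t. F (1 - t))"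
    by (rule section_along_compose[OF F]) (auto intro!: continuous_intros)
  then have "section_along f {0..1} (reversepath p) (\<lambda>t. F (1 - t))"
    by (simp add: reversepath_def)
  from holonomy_eq[OF this] show ?thesis
    using holonomy_eq[OF F] by (simp add: minus_add)
qed

definition group_add_monoid :: "'g::group_add itself \<Rightarrow> 'g monoid" where
  "group_add_monoid _ = \<lparr>carrier = UNIV, mult = (+), one = 0\<rparr>"

lemma epi_fundamental_group:
  fixes f :: "'a::topological_space \<Rightarrow> 'a \<Rightarrow> 'g::group_add"
  assumes ls: "local_system X f" and onto: "\<And>g. \<exists>p\<in>loops_at X x. holonomy f p = g"
  shows "(\<lambda>A. holonomy f (SOME p. p \<in> A)) \<in> epi (fundamental_group X x) (group_add_monoid TYPE('g))"
proof -
  let ?c = "\<lambda>p. loop_homotopy X x `` {p}" and ?\<rho> = "\<lambda>A. holonomy f (SOME p. p \<in> A)"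
  have car: "carrier (fundamental_group X x) = ?c ` loops_at X x"
    by (auto simp: fundamental_group_def quotient_def)
  have rho: "?\<rho> (?c p) = holonomy f p" if "p \<in> loops_at X x" for p
  proof -
    have "p \<in> ?c p" using that equiv_loop_homotopy by (metis equiv_class_self)
    then have "(SOME q. q \<in> ?c p) \<in> ?c p" by (rule someI[of "\<lambda>q. q \<in> ?c p"])
    moreover have "homotopic_paths X p r" if "r \<in> ?c p" for r
      using that by (simp add: loop_homotopy_def)
    ultimately show ?thesis using holonomy_homotopic[OF ls] by metis
  qed
  have join: "p +++ q \<in> loops_at X x" if "p \<in> loops_at X x" "q \<in> loops_at X x" for p q
    using that by (simp add: loops_at_def path_image_join)
  show ?thesis
    unfolding epi_def
  proof (intro CollectI conjI)
    show "?\<rho> \<in> hom (fundamental_group X x) (group_add_monoid TYPE('g))"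
    proof (rule homI)
      fix A B assume "A \<in> carrier (fundamental_group X x)" "B \<in> carrier (fundamental_group X x)"
      then obtain p q where pq: "A = ?c p" "B = ?c q" "p \<in> loops_at X x" "q \<in> loops_at X x"
        by (auto simp: car)
      then have "holonomy f (p +++ q) = holonomy f p + holonomy f q"
        by (intro holonomy_join[OF ls]) (auto simp: loops_at_def)
      then show "?\<rho> (A \<otimes>\<^bsub>fundamental_group X x\<^esub> B) =
          ?\<rho> A \<otimes>\<^bsub>group_add_monoid TYPE('g)\<^esub> ?\<rho> B"
        unfolding pq(1,2) fundamental_group_mult[OF pq(3,4)] rho[OF pq(3)] rho[OF pq(4)]
          rho[OF join[OF pq(3,4)]] by (simp add: group_add_monoid_def)
    qed (simp add: group_add_monoid_def)
    have "g \<in> ?\<rho> ` carrier (fundamental_group X x)" for g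
    proof -
      obtain p where "p \<in> loops_at X x" "holonomy f p = g" using onto by blast
      then have "g = ?\<rho> (?c p)" "?c p \<in> carrier (fundamental_group X x)"
        unfolding car using rho[of p] by auto
      then show ?thesis by (rule image_eqI)
    qed
    then show "?\<rho> ` carrier (fundamental_group X x) = carrier (group_add_monoid TYPE('g))"
      by (auto simp: group_add_monoid_def)
  qed
qed


section \<open>The infinite dihedral group\<close>

text \<open>\<open>Aff e k\<close> encodes the map \<open>x \<mapsto> k - x\<close> if
  \<open>e\<close> holds and \<open>x \<mapsto> k + x\<close> otherwise; addition is composition of
  maps.\<close>

datatype aff = Aff (flip: bool) (shift: int)

instantiation aff :: group_add
begin

definition zero_aff :: aff where "0 = Aff False 0"

definition plus_aff :: "aff \<Rightarrow> aff \<Rightarrow> aff" where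
  "x + y = Aff (flip x \<noteq> flip y) (shift x + (if flip x then - shift y else shift y))"

definition uminus_aff :: "aff \<Rightarrow> aff" where
  "- x = Aff (flip x) (if flip x then shift x else - shift x)"

definition minus_aff :: "aff \<Rightarrow> aff \<Rightarrow> aff" where
  "(x :: aff) - y = x + - y"

instance
  by standard (auto simp: zero_aff_def plus_aff_def uminus_aff_def minus_aff_def intro: aff.expand)

end

text \<open>Composition with \<open>Aff True 0\<close> turns a reflection
  \<open>Aff True (t i)\<close> into the translation by \<open>t i\<close>. The translations in
  \<open>H\<close> form a subgroup of the integers whose least positive element divides every
  \<open>t i\<close>, hence is \<open>1\<close>.\<close>

lemma aff_subgroup_eq_UNIV:
  fixes H :: "aff set" and t :: "'i \<Rightarrow> int"
  assumes add: "\<And>x y. x \<in> H \<Longrightarrow> y \<in> H \<Longrightarrow> x + y \<in> H"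
    and neg: "\<And>x. x \<in> H \<Longrightarrow> - x \<in> H"
    and refl: "Aff True 0 \<in> H"
    and mem: "\<And>i. i \<in> I \<Longrightarrow> Aff True (t i) \<in> H \<or> Aff False (t i) \<in> H"
    and gcd: "\<And>d. (\<And>i. i \<in> I \<Longrightarrow> d dvd t i) \<Longrightarrow> is_unit d"
  shows "H = UNIV"
proof -
  define K where "K = {k. Aff False k \<in> H}"
  have K: "k + l \<in> K" "- k \<in> K" if "k \<in> K" "l \<in> K" for k l
    using that add[of "Aff False k" "Aff False l"] neg[of "Aff False k"]
    by (auto simp: K_def plus_aff_def uminus_aff_def)
  have "Aff True 0 + Aff True 0 \<in> H" using add refl by blast
  then have K0: "0 \<in> K" by (simp add: K_def plus_aff_def)
  have tK: "t i \<in> K" if "i \<in> I" for i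
    using mem[OF that] add[OF _ refl, of "Aff True (t i)"] by (auto simp: K_def plus_aff_def)
  \<comment> \<open>Otherwise \<open>0\<close> would divide every \<open>t i\<close> and be a
    unit.\<close>
  have "\<exists>i\<in>I. t i \<noteq> 0"
    using gcd[of 0] by auto
  then obtain k0 where k0: "k0 \<in> K" "k0 > 0"
    using tK K(2) by (metis neg_0_less_iff_less not_less_iff_gr_or_eq)
  define d where "d = (LEAST n. n > 0 \<and> int n \<in> K)"
  have ex: "\<exists>n. n > 0 \<and> int n \<in> K"
    using k0 by (intro exI[of _ "nat k0"]) auto
  have d: "d > 0" "int d \<in> K"
    using LeastI_ex[OF ex] by (auto simp: d_def)
  have mul: "int n * k \<in> K" if "k \<in> K" for n k
    by (induction n) (use K0 K(1) that in \<open>auto simp: algebra_simps\<close>)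
  have mulz: "m * k \<in> K" if "k \<in> K" for m k
    using mul[OF that, of "nat \<bar>m\<bar>"] K(2) by (cases "m \<ge> 0") fastforce+
  have "int d dvd t i" if "i \<in> I" for i
  proof -
    have "t i + - (t i div int d) * int d \<in> K"
      using K(1) tK[OF that] mulz[OF d(2)] by blast
    then have "t i mod int d \<in> K" by (simp add: minus_div_mult_eq_mod)
    moreover have "nat (t i mod int d) < d" using d(1) by (simp add: nat_less_iff)
    ultimately have "\<not> t i mod int d > 0"
      using not_less_Least[of "nat (t i mod int d)" "\<lambda>n. n > 0 \<and> int n \<in> K"] by (auto simp: d_def)
    moreover have "t i mod int d \<ge> 0" using d(1) by simp
    ultimately show ?thesis by (simp add: dvd_eq_mod_eq_0)
  qed
  then have "int d = 1" using gcd[of "int d"] d(1) by auto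
  then have Kall: "k \<in> K" for k using mulz[OF d(2), of k] by simp
  have "x \<in> H" for x
  proof (cases "flip x")
    case True
    have "Aff False (shift x) + Aff True 0 \<in> H"
      using Kall[of "shift x"] refl add by (simp add: K_def)
    then show ?thesis using True by (cases x) (simp add: plus_aff_def)
  next
    case False
    then show ?thesis using Kall[of "shift x"] by (cases x) (simp add: K_def)
  qed
  then show ?thesis by blast
qed

text \<open>Translation by one goes to \<open>b\<close> and \<open>x \<mapsto> - x\<close> to
  \<open>a\<close>. Additivity comes from \<open>a\<close> conjugating \<open>b\<close> to its
  inverse, which the first and third relators express.\<close>

lemma dihedral_epi:
  fixes D (structure)
  assumes D: "D = dihedral_group n"
  shows "\<exists>\<theta>. \<theta> \<in> epi (group_add_monoid TYPE(aff)) D"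
proof -
  let ?R = "word_rel (dihedral_relators n)"
  let ?c = "\<lambda>w. ?R `` {w}"
  interpret D: group D unfolding D dihedral_group_def by (rule group_presented_group)
  have one: "\<one> = ?c []" by (simp add: D dihedral_group_def presented_group_def)
  have mult: "?c u \<otimes> ?c v = ?c (u @ v)" for u v
    unfolding D dihedral_group_def by (rule presented_group_mult)
  have car: "carrier D = range ?c"
    by (auto simp: D dihedral_group_def presented_group_def quotient_def)
  have eqI: "?c u = ?c v" if "word_eq (dihedral_relators n) u v" for u v
    by (rule equiv_class_eq[OF equiv_word_eq]) (simp add: word_rel_def that)
  define A B where "A = ?c [(Gen_a, True)]" and "B = ?c [(Gen_b, True)]"
  have AB: "A \<in> carrier D" "B \<in> carrier D" by (simp_all add: A_def B_def car)
  have AA: "A \<otimes> A = \<one>"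
    unfolding A_def mult one by (rule eqI, rule word_eq.relator) (simp add: dihedral_relators_def)
  have ABAB: "A \<otimes> B \<otimes> A \<otimes> B = \<one>"
    unfolding A_def B_def mult one by (rule eqI, rule word_eq.relator) (simp add: dihedral_relators_def)
  have AAx: "A \<otimes> (A \<otimes> y) = y" if "y \<in> carrier D" for y
    using AA AB that by (simp add: D.m_assoc[symmetric])
  have invA: "inv A = A" using AA AB by (simp add: D.inv_equality)
  have ABA: "A \<otimes> B \<otimes> A = inv B"
    using ABAB AB by (intro D.inv_equality[symmetric]) auto
  have conjn: "A \<otimes> (B [^] (k::int)) = (inv (B [^] k)) \<otimes> A" for k
  proof -
    have nat: "A \<otimes> (B [^] (m::nat)) \<otimes> A = (inv B) [^] m" for m
    proof (induction m)
      case (Suc m)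
      have "A \<otimes> (B [^] Suc m) \<otimes> A
          = (A \<otimes> (B [^] m) \<otimes> A) \<otimes> (A \<otimes> B \<otimes> A)"
        using AB by (simp add: D.m_assoc AAx)
      also have "\<dots> = (inv B) [^] m \<otimes> inv B"
        unfolding ABA Suc.IH ..
      finally show ?case by simp
    qed (simp add: AA AB)
    have "A \<otimes> (B [^] k) \<otimes> A = inv (B [^] k)"
    proof (cases "k \<ge> 0")
      case True
      then obtain m where "k = int m" using nonneg_eq_int by blast
      then show ?thesis using nat[of m] AB by (simp add: int_pow_int D.nat_pow_inv)
    next
      case False
      define m where "m = nat (- k)"
      have k: "k = - int m" using False by (simp add: m_def)
      have "inv (A \<otimes> (B [^] m) \<otimes> A) = B [^] m"
        using nat[of m] AB by (simp add: D.nat_pow_inv)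
      then have "A \<otimes> inv (B [^] m) \<otimes> A = B [^] m"
        using AB by (simp add: D.inv_mult_group invA D.m_assoc)
      then show ?thesis using AB by (simp add: k D.int_pow_neg int_pow_int)
    qed
    then have "A \<otimes> (B [^] k) \<otimes> A \<otimes> A = inv (B [^] k) \<otimes> A" by simp
    then show ?thesis using AB AA by (simp add: D.m_assoc)
  qed
  define \<theta> where "\<theta> x = B [^] shift x \<otimes> (if flip x then A else \<one>)" for x
  have cl: "\<theta> x \<in> carrier D" for x using AB by (simp add: \<theta>_def)
  have add: "\<theta> (x + y) = \<theta> x \<otimes> \<theta> y" for x y
  proof (cases "flip x")
    case True
    have "\<theta> x \<otimes> \<theta> y
        = B [^] shift x \<otimes> (A \<otimes> B [^] shift y) \<otimes> (if flip y then A else \<one>)"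
      using True AB by (simp add: \<theta>_def D.m_assoc)
    also have "\<dots> = (B [^] shift x \<otimes> B [^] (- shift y)) \<otimes> (A \<otimes> (if flip y then A else \<one>))"
      using AB unfolding conjn by (simp add: D.m_assoc D.int_pow_neg)
    also have "\<dots> = \<theta> (x + y)"
      using True AB AA D.int_pow_mult[of B "shift x" "- shift y"] by (simp add: \<theta>_def plus_aff_def)
    finally show ?thesis by simp
  next
    case False
    then show ?thesis
      using AB by (simp add: \<theta>_def plus_aff_def D.int_pow_mult D.m_assoc)
  qed
  have gen: "?c w \<in> range \<theta>" for w
  proof (induction w)
    case Nil
    have "\<theta> 0 = ?c []" by (simp add: \<theta>_def zero_aff_def flip: one)
    then show ?case by (metis rangeI)
  next
    case (Cons l w)
    then obtain y where y: "?c w = \<theta> y" by blast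
    obtain g s where l: "l = (g, s)" by force
    have "\<exists>x. ?c [l] = \<theta> x"
    proof -
      have inv: "?c [(h, False)] = inv ?c [(h, True)]" for h
      proof (rule D.inv_equality[symmetric])
        show "?c [(h, False)] \<otimes> ?c [(h, True)] = \<one>"
          unfolding mult one using word_eq.cancel[of _ h False] by (intro eqI) simp
      qed (simp_all add: car)
      have "\<theta> (Aff True 0) = A" "\<theta> (Aff False 1) = B" "\<theta> (Aff False (- 1)) = inv B"
        using AB by (simp_all add: \<theta>_def D.int_pow_neg)
      then show ?thesis
        using inv[of g] invA by (cases g; cases s) (metis A_def B_def l)+
    qed
    then obtain x where x: "?c [l] = \<theta> x" by blast
    have "?c (l # w) = \<theta> (x + y)" using mult[of "[l]" w] by (simp add: add x y)
    then show ?case by (metis rangeI)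
  qed
  have "\<theta> \<in> epi (group_add_monoid TYPE(aff)) D"
    unfolding epi_def
  proof (intro CollectI conjI homI)
    show "\<theta> ` carrier (group_add_monoid TYPE(aff)) = carrier D"
      using gen cl by (auto simp: group_add_monoid_def car)
  qed (simp_all add: group_add_monoid_def cl add)
  then show ?thesis by blast
qed


section \<open>Link diagrams and their wall systems\<close>

text \<open>The factors stand in increasing order of the index; a finite sum would require
  commutativity.\<close>

primrec wsum :: "(nat \<Rightarrow> 'g::monoid_add) \<Rightarrow> (nat \<Rightarrow> bool) \<Rightarrow> nat \<Rightarrow> 'g" where
  "wsum g P 0 = 0"
| "wsum g P (Suc n) = wsum g P n + (if P n then g n else 0)"

lemma wsum_cong: "(\<And>i. i < n \<Longrightarrow> P i = Q i) \<Longrightarrow> wsum g P n = wsum g Q n"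
  by (induction n) auto

lemma wsum_eq_0: "(\<And>i. i < n \<Longrightarrow> P i \<Longrightarrow> g i = 0) \<Longrightarrow> wsum g P n = 0"
  by (induction n) auto

lemma wsum_split:
  assumes "\<And>i. i < n \<Longrightarrow> P i \<longleftrightarrow> A i \<or> B i"
    and "\<And>i j. i < n \<Longrightarrow> j < n \<Longrightarrow> A i \<Longrightarrow> B j \<Longrightarrow> i < j"
  shows "wsum g P n = wsum g A n + wsum g B n"
  using assms
proof (induction n)
  case (Suc n)
  have IH: "wsum g P n = wsum g A n + wsum g B n"
    using Suc.prems by (intro Suc.IH) auto
  show ?case
  proof (cases "A n")
    case True
    have "wsum g B (Suc n) = 0"
      using Suc.prems(2)[of n] True by (intro wsum_eq_0) (metis not_less_eq lessI)
    moreover from this have "wsum g B n = 0"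
      using Suc.prems(2)[of n] True by (intro wsum_eq_0) (metis less_SucI lessI not_less_iff_gr_or_eq)
    ultimately show ?thesis using IH True Suc.prems(1)[of n] by (simp add: add.assoc split: if_splits)
  next
    case False
    then show ?thesis using IH Suc.prems(1)[of n] by (simp add: add.assoc)
  qed
qed simp

lemma wsum_single: "j < n \<Longrightarrow> wsum g (\<lambda>i. i = j) n = g j"
proof (induction n)
  case (Suc n)
  show ?case
  proof (cases "j = n")
    case True
    then have "wsum g (\<lambda>i. i = j) n = 0" by (intro wsum_eq_0) auto
    then show ?thesis using True by simp
  qed (use Suc in auto)
qed simp

type_synonym point = "real \<times> real \<times> real"

section \<open>Strand diagrams\<close>

text \<open>A strand is a graph over an interval of abscissae: \<open>\<beta>\<close> is the other
  coordinate of the projection plane, \<open>\<zeta>\<close> the height. Inside a slab the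
  projections are disjoint, so vertices and crossings lie on slab boundaries. Within a slab the
  numbering follows decreasing \<open>\<beta>\<close>, which turns products by index into products
  in geometric order.\<close>

locale strand_diagram =
  fixes N :: nat and l r :: "nat \<Rightarrow> real" and \<beta> \<zeta> :: "nat \<Rightarrow> real \<Rightarrow> real"
  assumes lr: "i < N \<Longrightarrow> l i < r i"
    and cont_\<beta>: "i < N \<Longrightarrow> continuous_on UNIV (\<beta> i)"
    and cont_\<zeta>: "i < N \<Longrightarrow> continuous_on UNIV (\<zeta> i)"
    and slab: "i < N \<Longrightarrow> j < N \<Longrightarrow> (l i = l j \<and> r i = r j) \<or> r i \<le> l j \<or> r j \<le> l i"
    and order: "i < j \<Longrightarrow> j < N \<Longrightarrow> l i = l j \<Longrightarrow> l i < a \<Longrightarrow> a < r i \<Longrightarrow> \<beta> i a > \<beta> j a"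
begin

definition strand :: "nat \<Rightarrow> point set" where
  "strand i = (\<lambda>a. (a, \<beta> i a, \<zeta> i a)) ` {l i..r i}"

definition link :: "point set" where
  "link = (\<Union>i<N. strand i)"

text \<open>\<open>act True i a\<close> (\<open>act False i a\<close>): strand \<open>i\<close> has points immediately to the left (right) of
  abscissa \<open>a\<close>, including its value at \<open>a\<close>.\<close>

definition act :: "bool \<Rightarrow> nat \<Rightarrow> real \<Rightarrow> bool" where
  "act s i a \<longleftrightarrow> (if s then l i < a \<and> a \<le> r i else l i \<le> a \<and> a < r i)"

abbreviation row :: "(nat \<Rightarrow> 'g::monoid_add) \<Rightarrow> bool \<Rightarrow> real \<Rightarrow> 'g" where
  "row g s a \<equiv> wsum g (\<lambda>i. act s i a) N"

abbreviation column :: "(nat \<Rightarrow> 'g::monoid_add) \<Rightarrow> bool \<Rightarrow> real \<Rightarrow> real \<Rightarrow> 'g" where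
  "column g s a b \<equiv> wsum g (\<lambda>i. act s i a \<and> \<beta> i a = b) N"

lemma act_range: "act s i a \<Longrightarrow> l i \<le> a \<and> a \<le> r i"
  by (auto simp: act_def split: if_splits)

lemma act_link: "i < N \<Longrightarrow> act s i a \<Longrightarrow> (a, \<beta> i a, \<zeta> i a) \<in> link"
  using act_range[of s i a] unfolding link_def strand_def by (intro UN_I[of i] image_eqI[of _ _ a]) auto

lemma act_slab: "i < N \<Longrightarrow> j < N \<Longrightarrow> act s i a \<Longrightarrow> act s j a \<Longrightarrow> l i = l j \<and> r i = r j"
  using slab[of i j] by (auto simp: act_def split: if_splits)

text \<open>In the interior of a slab this is \<open>order\<close>; on its boundary the weak
  inequality survives by continuity, enough to exclude the reverse numbering.\<close>

lemma act_order:
  assumes "i < N" "j < N" "act s i a" "act s j a" "\<beta> i a > \<beta> j a"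
  shows "i < j"
proof (rule ccontr)
  assume "\<not> i < j"
  then have "j < i" using assms(5) by (metis less_irrefl nat_neq_iff)
  have sl: "l i = l j" "r i = r j" using act_slab[OF assms(1-4)] by auto
  have "closed {x. \<beta> i x \<le> \<beta> j x}"
    using cont_\<beta> assms(1,2) by (intro closed_Collect_le)
  then have "closure {l i<..<r i} \<subseteq> {x. \<beta> i x \<le> \<beta> j x}"
    using order[OF \<open>j < i\<close> assms(1)] sl by (intro closure_minimal) (auto intro: less_imp_le)
  then have "a \<in> {x. \<beta> i x \<le> \<beta> j x}"
    using lr[OF assms(1)] act_range[OF assms(3)] by (auto simp: closure_greaterThanLessThan)
  then show False using assms(5) by simp
qed

lemma act_near:
  "\<forall>\<^sub>F a in nhds a0. \<forall>i<N. \<forall>s. a \<noteq> a0 \<longrightarrow> act s i a = act (a < a0) i a0"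
proof -
  have "\<forall>\<^sub>F a in nhds a0. \<forall>s. a \<noteq> a0 \<longrightarrow> act s i a = act (a < a0) i a0" for i
  proof -
    have lt: "\<forall>\<^sub>F a in nhds a0. c < a0 \<longrightarrow> c < a" "\<forall>\<^sub>F a in nhds a0. a0 < c \<longrightarrow> a < c" for c :: real
      using eventually_nhds_in_open[of "{c<..}" a0] eventually_nhds_in_open[of "{..<c}" a0]
      by (cases "c < a0"; cases "a0 < c"; simp)+
    show ?thesis
      using lt(1)[of "l i"] lt(1)[of "r i"] lt(2)[of "l i"] lt(2)[of "r i"]
    proof eventually_elim
      case (elim a)
      show ?case
      proof (intro allI impI)
        fix s assume "a \<noteq> a0"
        then show "act s i a = act (a < a0) i a0"
          using elim by (cases s; cases "a < a0") (auto simp: act_def)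
      qed
    qed
  qed
  then have "\<forall>\<^sub>F a in nhds a0. \<forall>i\<in>{..<N}. \<forall>s. a \<noteq> a0 \<longrightarrow> act s i a = act (a < a0) i a0"
    by (intro eventually_ball_finite) auto
  then show ?thesis by (rule eventually_mono) simp
qed

lemma eventually_nhds_fst: "\<forall>\<^sub>F a in nhds a0. P a \<Longrightarrow> \<forall>\<^sub>F x in nhds (a0, b0). P (fst x)"
  using continuous_on_eventually_nhds[of UNIV fst "(a0, b0)" P] by (simp add: continuous_on_fst)

abbreviation same_sides where
  "same_sides a0 b0 z0 a b z \<equiv> \<forall>i<N.
     (\<forall>s. a \<noteq> a0 \<longrightarrow> act s i a = act (a < a0) i a0) \<and>
     (\<beta> i a0 < b0 \<longrightarrow> \<beta> i a < b) \<and> (\<beta> i a0 > b0 \<longrightarrow> \<beta> i a > b) \<and>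
     (\<zeta> i a0 < z0 \<longrightarrow> \<zeta> i a < z) \<and> (\<zeta> i a0 > z0 \<longrightarrow> \<zeta> i a > z)"

lemma coords_near:
  "\<forall>\<^sub>F x in nhds (a0, b0, z0). case x of (a, b, z) \<Rightarrow> same_sides a0 b0 z0 a b z"
proof -
  let ?n = "nhds (a0, b0, z0)"
  have gen: "\<forall>\<^sub>F x in ?n. (u (a0, b0, z0) < v (a0, b0, z0) \<longrightarrow> u x < v x)"
    if "continuous_on UNIV u" "continuous_on UNIV v" for u v :: "point \<Rightarrow> real"
  proof (cases "u (a0, b0, z0) < v (a0, b0, z0)")
    case True
    have "open {x. u x < v x}" using that by (rule open_Collect_less)
    from eventually_nhds_in_open[OF this, of "(a0, b0, z0)"] True show ?thesis
      by (simp add: eventually_mono)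
  qed simp
  have c: "continuous_on UNIV (\<lambda>x. \<beta> i (fst x))" "continuous_on UNIV (\<lambda>x. \<zeta> i (fst x))"
    "continuous_on UNIV (\<lambda>x::point. fst (snd x))"
    "continuous_on UNIV (\<lambda>x::point. snd (snd x))" if "i < N" for i
    using cont_\<beta>[OF that] cont_\<zeta>[OF that]
    by (auto intro!: continuous_intros continuous_on_compose2[of UNIV "\<beta> i"] continuous_on_compose2[of UNIV "\<zeta> i"])
  have "\<forall>\<^sub>F x in ?n. \<forall>i\<in>{..<N}.
     (\<beta> i a0 < b0 \<longrightarrow> \<beta> i (fst x) < fst (snd x)) \<and> (\<beta> i a0 > b0 \<longrightarrow> \<beta> i (fst x) > fst (snd x)) \<and>
     (\<zeta> i a0 < z0 \<longrightarrow> \<zeta> i (fst x) < snd (snd x)) \<and> (\<zeta> i a0 > z0 \<longrightarrow> \<zeta> i (fst x) > snd (snd x))"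
    (is "eventually (\<lambda>x. \<forall>i\<in>{..<N}. ?P x i) _")
  proof (intro eventually_ball_finite ballI)
    fix i assume "i \<in> {..<N}"
    note c = c[of i, OF this[simplified]]
    show "\<forall>\<^sub>F x in ?n. ?P x i"
      using gen[OF c(1,3)] gen[OF c(3,1)] gen[OF c(2,4)] gen[OF c(4,2)]
      by eventually_elim simp
  qed simp
  moreover have "\<forall>\<^sub>F x in ?n. \<forall>i<N. \<forall>s. fst x \<noteq> a0 \<longrightarrow> act s i (fst x) = act (fst x < a0) i a0"
    by (rule eventually_nhds_fst[OF act_near])
  ultimately show ?thesis
    by eventually_elim (auto split: prod.split)
qed

section \<open>The local system of walls\<close>

text \<open>The wall of a strand consists of the points vertically below it. Counted are the walls
  through the first point that continue to the side of \<open>a0\<close> where the second point lies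
  and have larger \<open>\<beta>\<close> than it, that is, those met when coming from large
  \<open>b\<close>. For \<open>a = a0\<close> the right side is taken, an arbitrary choice.\<close>

definition wall_system ::
    "(nat \<Rightarrow> 'g::monoid_add) \<Rightarrow> point \<Rightarrow> point \<Rightarrow> 'g" where
  "wall_system g = (\<lambda>(a0, b0, z0) (a, b, z).
     wsum g (\<lambda>i. act (a < a0) i a0 \<and> \<beta> i a0 = b0 \<and> \<zeta> i a0 > z0 \<and> \<beta> i a > b) N)"

definition stack :: "(nat \<Rightarrow> 'g::monoid_add) \<Rightarrow> bool \<Rightarrow> real \<Rightarrow> real \<Rightarrow> real \<Rightarrow> 'g" where
  "stack g s a b z = wsum g (\<lambda>i. act s i a \<and> \<beta> i a = b \<and> \<zeta> i a > z) N"

text \<open>If the base point moves to another abscissa, the walls at larger \<open>b\<close> come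
  first in the product and split off as a left factor, while those at smaller \<open>b\<close> drop
  out. If it moves to smaller \<open>b\<close> at the same abscissa, its neighbourhood meets both
  sides and all walls are counted; \<open>rel\<close> makes their product independent of the
  side.\<close>

lemma local_system_wall_system:
  fixes g :: "nat \<Rightarrow> 'g::group_add"
  assumes rel: "\<And>a b z. (a, b, z) \<notin> link \<Longrightarrow> stack g True a b z = stack g False a b z"
  shows "local_system (- link) (wall_system g)"
  unfolding local_system_def
proof
  fix x0 assume x0: "x0 \<in> - link"
  obtain a0 b0 z0 where x0_eq: "x0 = (a0, b0, z0)" by (metis prod_cases3)
  have zne: "\<zeta> i a0 \<noteq> z0" if "i < N" "act s i a0" "\<beta> i a0 = b0" for i s
    using act_link[OF that(1,2)] x0 that(3) by (auto simp: x0_eq)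
  show "\<forall>\<^sub>F x1 in nhds x0. x1 \<in> - link \<longrightarrow>
      (\<exists>c. \<forall>\<^sub>F y in nhds x1. y \<in> - link \<longrightarrow> wall_system g x0 y = c + wall_system g x1 y)"
    using coords_near[of a0 b0 z0] unfolding x0_eq
  proof (rule eventually_mono, intro impI)
    fix x1 :: point
    obtain a1 b1 z1 where x1_eq: "x1 = (a1, b1, z1)" by (metis prod_cases3)
    assume "case x1 of (a, b, z) \<Rightarrow> same_sides a0 b0 z0 a b z"
    then have act1: "\<And>i s. i < N \<Longrightarrow> a1 \<noteq> a0 \<Longrightarrow> act s i a1 = act (a1 < a0) i a0"
      and b1: "\<And>i. i < N \<Longrightarrow> \<beta> i a1 = b1 \<Longrightarrow> \<beta> i a0 = b0"
      and z1: "\<And>i. i < N \<Longrightarrow> \<zeta> i a0 \<noteq> z0 \<Longrightarrow> \<zeta> i a1 > z1 \<longleftrightarrow> \<zeta> i a0 > z0"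
      unfolding x1_eq prod.case by (simp, metis less_irrefl linorder_neqE_linordered_idom,
        metis less_asym linorder_neqE_linordered_idom)
    have key: "\<exists>c. \<forall>\<^sub>F (a, b, z) in nhds x1.
        wall_system g (a0, b0, z0) (a, b, z) = c + wall_system g (a1, b1, z1) (a, b, z)"
    proof (cases "a1 = a0")
      case False
      let ?s = "a1 < a0"
      let ?base = "\<lambda>i. act ?s i a0 \<and> \<beta> i a0 = b0 \<and> \<zeta> i a0 > z0"
      have ev: "\<forall>\<^sub>F a in nhds a1. (a < a0) = ?s"
        using False eventually_nhds_in_open[of "{..<a0}" a1] eventually_nhds_in_open[of "{a0<..}" a1]
        by (cases "a1 < a0") (auto elim!: eventually_mono)
      have "\<forall>\<^sub>F x in nhds x1. case x of (a, b, z) \<Rightarrow>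
          wall_system g (a0, b0, z0) (a, b, z)
            = wsum g (\<lambda>i. ?base i \<and> \<beta> i a1 > b1) N + wall_system g (a1, b1, z1) (a, b, z)"
        using coords_near[of a1 b1 z1] eventually_nhds_fst[OF ev, of "(b1, z1)"] unfolding x1_eq
      proof eventually_elim
        case (elim x)
        obtain a b z where x: "x = (a, b, z)" by (metis prod_cases3)
        have s: "(a < a0) = ?s" using elim(2) by (simp add: x)
        have "wall_system g (a1, b1, z1) (a, b, z)
            = wsum g (\<lambda>i. ?base i \<and> \<beta> i a1 = b1 \<and> \<beta> i a > b) N"
          unfolding wall_system_def prod.case
        proof (rule wsum_cong)
          fix i assume i: "i < N"
          show "(act (a < a1) i a1 \<and> \<beta> i a1 = b1 \<and> z1 < \<zeta> i a1 \<and> b < \<beta> i a) =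
              (?base i \<and> \<beta> i a1 = b1 \<and> b < \<beta> i a)"
            using act1[OF i False, of "a < a1"] b1[OF i] z1[OF i] zne[OF i] by blast
        qed
        moreover have "wall_system g (a0, b0, z0) (a, b, z)
            = wsum g (\<lambda>i. ?base i \<and> \<beta> i a1 > b1) N + wsum g (\<lambda>i. ?base i \<and> \<beta> i a1 = b1 \<and> \<beta> i a > b) N"
          unfolding wall_system_def prod.case s
        proof (rule wsum_split)
          fix i assume "i < N"
          then have "\<beta> i a1 < b1 \<longrightarrow> \<beta> i a < b" "\<beta> i a1 > b1 \<longrightarrow> \<beta> i a > b"
            using elim(1) by (auto simp: x)
          then show "act ?s i a0 \<and> \<beta> i a0 = b0 \<and> z0 < \<zeta> i a0 \<and> b < \<beta> i a \<longleftrightarrow>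
              ?base i \<and> \<beta> i a1 > b1 \<or> ?base i \<and> \<beta> i a1 = b1 \<and> \<beta> i a > b"
            by (cases "\<beta> i a1" b1 rule: linorder_cases) auto
        next
          fix i j assume ij: "i < N" "j < N" "?base i \<and> \<beta> i a1 > b1" "?base j \<and> \<beta> j a1 = b1 \<and> \<beta> j a > b"
          then have "act True i a1" "act True j a1" using act1 False by auto
          then show "i < j" using act_order ij by auto
        qed
        ultimately show ?case by (simp add: x)
      qed
      then show ?thesis by blast
    next
      case True
      consider "b1 > b0" | "b1 < b0" | "b1 = b0" by linarith
      then show ?thesis
      proof cases
        case 1
        have "\<forall>\<^sub>F x in nhds x1. case x of (a, b, z) \<Rightarrow>
          wall_system g (a0, b0, z0) (a, b, z) = 0 + wall_system g (a1, b1, z1) (a, b, z)"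
          using coords_near[of a1 b1 z1] unfolding x1_eq
        proof eventually_elim
          case (elim x)
          obtain a b z where x: "x = (a, b, z)" by (metis prod_cases3)
          have "wall_system g (a0, b0, z0) (a, b, z) = 0"
            unfolding wall_system_def prod.case
            by (rule wsum_eq_0) (use elim 1 True in \<open>auto simp: x\<close>)
          moreover have "wall_system g (a1, b1, z1) (a, b, z) = 0"
            unfolding wall_system_def prod.case
            by (rule wsum_eq_0) (use b1 1 True in force)
          ultimately show ?case by (simp add: x)
        qed
        then show ?thesis by blast
      next
        case 2
        have "\<forall>\<^sub>F x in nhds x1. case x of (a, b, z) \<Rightarrow>
          wall_system g (a0, b0, z0) (a, b, z) = stack g True a0 b0 z0 + wall_system g (a1, b1, z1) (a, b, z)"
          using coords_near[of a1 b1 z1] unfolding x1_eq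
        proof eventually_elim
          case (elim x)
          obtain a b z where x: "x = (a, b, z)" by (metis prod_cases3)
          have "wall_system g (a0, b0, z0) (a, b, z) = stack g (a < a0) a0 b0 z0"
            unfolding wall_system_def stack_def prod.case
            by (rule wsum_cong) (use elim 2 True in \<open>auto simp: x\<close>)
          also have "\<dots> = stack g True a0 b0 z0"
            using rel[of a0 b0 z0] x0 by (cases "a < a0") (auto simp: x0_eq)
          moreover have "wall_system g (a1, b1, z1) (a, b, z) = 0"
            unfolding wall_system_def prod.case
            by (rule wsum_eq_0) (use b1 2 True in force)
          ultimately show ?case by (simp add: x)
        qed
        then show ?thesis by blast
      next
        case 3
        have "wall_system g (a0, b0, z0) (a, b, z) = wall_system g (a1, b1, z1) (a, b, z)" for a b z
          unfolding wall_system_def prod.case True 3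
          by (rule wsum_cong) (use z1 zne 3 True in blast)
        then have "\<forall>\<^sub>F (a, b, z) in nhds x1.
            wall_system g (a0, b0, z0) (a, b, z) = 0 + wall_system g (a1, b1, z1) (a, b, z)"
          by (intro always_eventually) auto
        then show ?thesis by (rule exI[of _ 0])
      qed
    qed
    then obtain c where "\<forall>\<^sub>F (a, b, z) in nhds x1.
        wall_system g (a0, b0, z0) (a, b, z) = c + wall_system g (a1, b1, z1) (a, b, z)" ..
    then have "\<forall>\<^sub>F y in nhds x1. y \<in> - link \<longrightarrow> wall_system g (a0, b0, z0) y = c + wall_system g x1 y"
      by (rule eventually_mono) (auto simp: x1_eq)
    then show "\<exists>c. \<forall>\<^sub>F y in nhds x1. y \<in> - link \<longrightarrow>
        wall_system g (a0, b0, z0) y = c + wall_system g x1 y" ..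
  qed
qed

section \<open>Products over columns and level planes\<close>

text \<open>The strands through the smallest value of \<open>\<beta>\<close> in \<open>Y\<close>
  come last in the product, so their column splits off on the right, and induction applies to the
  remaining values.\<close>

lemma wsum_act_grouped:
  fixes g :: "nat \<Rightarrow> 'g::monoid_add"
  assumes "\<And>b. b \<in> Y \<Longrightarrow> column g True a b
                        = column g False a b"
  shows "wsum g (\<lambda>i. act True i a \<and> \<beta> i a \<in> Y) N = wsum g (\<lambda>i. act False i a \<and> \<beta> i a \<in> Y) N"
  using assms
proof (induction "card ((\<lambda>i. \<beta> i a) ` {..<N} \<inter> Y)" arbitrary: Y rule: less_induct)
  case less
  let ?X = "(\<lambda>i. \<beta> i a) ` {..<N} \<inter> Y"
  show ?case
  proof (cases "?X = {}")
    case True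
    then have "wsum g (\<lambda>i. act s i a \<and> \<beta> i a \<in> Y) N = 0" for s
      by (intro wsum_eq_0) auto
    then show ?thesis by simp
  next
    case False
    define m where "m = Min ?X"
    have m: "m \<in> ?X" unfolding m_def by (rule Min_in[OF _ False]) simp
    have m_le: "m \<le> x" if "x \<in> ?X" for x unfolding m_def by (rule Min_le[OF _ that]) simp
    let ?Y = "Y - {m}"
    have split: "wsum g (\<lambda>i. act s i a \<and> \<beta> i a \<in> Y) N
        = wsum g (\<lambda>i. act s i a \<and> \<beta> i a \<in> ?Y) N + column g s a m" for s
    proof (rule wsum_split)
      fix i j assume ij: "i < N" "j < N" "act s i a \<and> \<beta> i a \<in> ?Y" "act s j a \<and> \<beta> j a = m"
      then have "\<beta> i a > m" using m_le[of "\<beta> i a"] by force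
      then show "i < j" using act_order ij by metis
    qed (use m in auto)
    have "?X - {m} \<subset> ?X" using m by blast
    moreover have "(\<lambda>i. \<beta> i a) ` {..<N} \<inter> ?Y = ?X - {m}" by blast
    ultimately have "card ((\<lambda>i. \<beta> i a) ` {..<N} \<inter> ?Y) < card ?X"
      by (metis finite_Int finite_imageI finite_lessThan psubset_card_mono)
    from less.hyps[OF this] less.prems m(1) show ?thesis
      unfolding split by auto
  qed
qed

text \<open>The row is locally constant: beside \<open>a0\<close> it equals one of the two rows at
  \<open>a0\<close>, which agree. At \<open>a1\<close> no strand is met.\<close>

lemma wsum_act_total:
  fixes g :: "nat \<Rightarrow> 'g::monoid_add"
  assumes "connected S" "open S"
    and "\<And>a. a \<in> S \<Longrightarrow> row g True a = row g False a"
    and "a1 \<in> S" "\<And>i s. i < N \<Longrightarrow> \<not> act s i a1" "a \<in> S"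
  shows "row g s a = 0"
proof -
  have "(\<lambda>a. row g False a) constant_on S"
  proof (rule locally_constant_imp_constant[OF assms(1)])
    fix a0 assume a0: "a0 \<in> S"
    have ev: "\<forall>\<^sub>F a in nhds a0. row g False a = row g False a0"
      using act_near[of a0]
    proof eventually_elim
      case (elim a)
      show ?case
      proof (cases "a = a0")
        case False
        then have "row g False a = wsum g (\<lambda>i. act (a < a0) i a0) N"
          using elim by (intro wsum_cong) auto
        then show ?thesis using assms(3)[OF a0] by (cases "a < a0") auto
      qed simp
    qed
    obtain U where U: "open U" "a0 \<in> U"
      "\<And>a. a \<in> U \<Longrightarrow> row g False a = row g False a0"
      using eventually_nhdsE[OF ev] by metis
    show "\<exists>T. openin (top_of_set S) T \<and> a0 \<in> T \<and>
        (\<forall>a\<in>T. row g False a = row g False a0)"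
    proof (intro exI[of _ "S \<inter> U"] conjI ballI)
      show "openin (top_of_set S) (S \<inter> U)" using U(1) by (rule openin_open_Int)
    qed (use a0 U(2) in simp, rule U(3), simp)
  qed
  moreover have "row g False a1 = 0" using assms(5) by (intro wsum_eq_0) auto
  ultimately have "row g False a = 0"
    using assms(4,6) unfolding constant_on_def by auto
  then show ?thesis using assms(3)[OF assms(6)] by (cases s) auto
qed

text \<open>If the relations on one side of \<open>a\<close> hold, the hypothesis \<open>total\<close> follows from there being no
  strands far away.\<close>

lemma stack_relation_redundant:
  fixes g :: "nat \<Rightarrow> 'g::group_add"
  assumes others: "\<And>b'. b' \<noteq> b \<Longrightarrow> column g True a b'
                        = column g False a b'"
    and total: "\<And>s. row g s a = 0"
  shows "column g True a b = column g False a b"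
proof -
  let ?W = "\<lambda>s Y. wsum g (\<lambda>i. act s i a \<and> \<beta> i a \<in> Y) N"
  have split: "row g s a
      = ?W s {b<..} + (column g s a b + ?W s {..<b})" for s
  proof -
    have "row g s a
        = ?W s {b<..} + wsum g (\<lambda>i. act s i a \<and> \<beta> i a \<le> b) N"
      by (rule wsum_split) (auto intro: act_order)
    also have "wsum g (\<lambda>i. act s i a \<and> \<beta> i a \<le> b) N
        = column g s a b + ?W s {..<b}"
      by (rule wsum_split) (auto intro: act_order)
    finally show ?thesis .
  qed
  have "?W True Y = ?W False Y" if "b \<notin> Y" for Y
  proof (rule wsum_act_grouped)
    fix b' assume "b' \<in> Y"
    then have "b' \<noteq> b" using that by blast
    then show "column g True a b' = column g False a b'"
      by (rule others)
  qed
  then have "?W True {b<..} = ?W False {b<..}" "?W True {..<b} = ?W False {..<b}"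
    by blast+
  then have "?W True {b<..} + (column g True a b + ?W True {..<b})
      = ?W True {b<..} + (column g False a b + ?W True {..<b})"
    using split[of True] split[of False] unfolding total by simp
  then show ?thesis by (simp only: add_left_cancel add_right_cancel)
qed

section \<open>The local system near infinity\<close>

definition box_bound :: "real \<Rightarrow> bool" where
  "box_bound m \<longleftrightarrow> (\<forall>(a, b, z)\<in>link. \<bar>a\<bar> < m \<and> \<bar>b\<bar> < m \<and> \<bar>z\<bar> < m)"

text \<open>Outside the box no wall is found at heights \<open>\<ge> - m\<close>, so a constant
  serves there; below \<open>- m\<close> every strand over the abscissa has its wall.\<close>

definition outer_section :: "(nat \<Rightarrow> 'g::monoid_add) \<Rightarrow> real \<Rightarrow> point \<Rightarrow> 'g" where
  "outer_section g m = (\<lambda>(a, b, z).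
     if z < - m then wsum g (\<lambda>i. act False i a \<and> \<beta> i a > b) N else 0)"

text \<open>The complement of a large box is simply connected, so the local system is trivial there:
  far below the link it suffices to develop it along the plane, where all walls are visible.\<close>

lemma outer_section_wall_system:
  fixes g :: "nat \<Rightarrow> 'g::group_add"
  assumes rel: "\<And>a b. column g True a b
                   = column g False a b"
    and m: "box_bound m" and out: "\<not> (\<bar>a1\<bar> \<le> m \<and> \<bar>b1\<bar> \<le> m \<and> \<bar>z1\<bar> \<le> m)"
  shows "\<exists>c. \<forall>\<^sub>F y in nhds (a1, b1, z1). outer_section g m y = c + wall_system g (a1, b1, z1) y"
proof -
  let ?n = "nhds (a1, b1, z1)"
  have bd: "\<bar>a\<bar> < m \<and> \<bar>\<beta> i a\<bar> < m \<and> \<bar>\<zeta> i a\<bar> < m" if "i < N" "act s i a" for i s a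
    using m act_link[OF that] unfolding box_bound_def by auto
  have grouped: "wsum g (\<lambda>i. act True i a \<and> \<beta> i a \<in> Y) N = wsum g (\<lambda>i. act False i a \<and> \<beta> i a \<in> Y) N"
    for a Y by (rule wsum_act_grouped) (rule rel)
  have total: "row g s a = 0" for s a
  proof (rule wsum_act_total[of UNIV])
    show "row g True a = row g False a" for a
      using grouped[of a UNIV] by simp
    show "\<not> act s i (\<bar>m\<bar> + 1)" if "i < N" for i s
      using bd[OF that, of s "\<bar>m\<bar> + 1"] by auto
  qed auto
  show ?thesis
  proof (cases "z1 < - m")
    case True
    have op: "open {x::point. snd (snd x) < - m}"
      by (intro open_Collect_less continuous_intros)
    have "\<forall>\<^sub>F x in ?n. snd (snd x) < - m"
      using eventually_nhds_in_open[OF op, of "(a1, b1, z1)"] True by simp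
    then have "\<forall>\<^sub>F y in ?n. outer_section g m y
        = wsum g (\<lambda>i. act True i a1 \<and> \<beta> i a1 \<in> {b1<..}) N + wall_system g (a1, b1, z1) y"
      using coords_near[of a1 b1 z1]
    proof eventually_elim
      case (elim x)
      obtain a b z where x: "x = (a, b, z)" by (metis prod_cases3)
      let ?s = "a < a1"
      have eq: "act False i a = act ?s i a1" if "i < N" for i
        using elim(2) that unfolding x prod.case by (cases "a = a1") auto
      have "outer_section g m (a, b, z) = wsum g (\<lambda>i. act ?s i a1 \<and> \<beta> i a > b) N"
        using elim(1) eq by (auto simp: outer_section_def x intro!: wsum_cong)
      also have "\<dots> = wsum g (\<lambda>i. act ?s i a1 \<and> \<beta> i a1 \<in> {b1<..}) N
          + wall_system g (a1, b1, z1) (a, b, z)"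
        unfolding wall_system_def prod.case
      proof (rule wsum_split)
        fix i assume i: "i < N"
        have "act ?s i a1 \<Longrightarrow> \<zeta> i a1 > z1" using bd[OF i, of ?s a1] True by auto
        moreover have "\<beta> i a1 < b1 \<longrightarrow> \<beta> i a < b" "\<beta> i a1 > b1 \<longrightarrow> \<beta> i a > b"
          using elim(2) i by (auto simp: x)
        ultimately show "(act ?s i a1 \<and> b < \<beta> i a) \<longleftrightarrow> (act ?s i a1 \<and> \<beta> i a1 \<in> {b1<..}) \<or>
            (act ?s i a1 \<and> \<beta> i a1 = b1 \<and> \<zeta> i a1 > z1 \<and> \<beta> i a > b)"
          by (cases "\<beta> i a1" b1 rule: linorder_cases) auto
      qed (auto intro: act_order)
      also have "wsum g (\<lambda>i. act ?s i a1 \<and> \<beta> i a1 \<in> {b1<..}) N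
          = wsum g (\<lambda>i. act True i a1 \<and> \<beta> i a1 \<in> {b1<..}) N"
        using grouped[of a1 "{b1<..}"] by (cases ?s) auto
      finally show ?case unfolding x .
    qed
    then show ?thesis by (rule exI)
  next
    case z1: False
    \<comment> \<open>The two formulas match across \<open>z = - m\<close> outside the box: the
      product is empty unless \<open>b < - m\<close>, and then it is the entire row, which is
      trivial.\<close>
    have far: "outer_section g m (a, b, z) = 0" if "\<bar>a\<bar> > m \<or> \<bar>b\<bar> > m" for a b z
    proof -
      have "wsum g (\<lambda>i. act False i a \<and> \<beta> i a > b) N = 0"
      proof (cases "b < - m \<and> \<not> \<bar>a\<bar> > m")
        case True
        have "wsum g (\<lambda>i. act False i a \<and> \<beta> i a > b) N = row g False a"
          using bd[of _ False a] True by (intro wsum_cong) force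
        then show ?thesis using total by simp
      next
        case False
        show ?thesis
        proof (rule wsum_eq_0)
          fix i assume "i < N" "act False i a \<and> \<beta> i a > b"
          then show "g i = 0" using bd[of i False a] False that by linarith
        qed
      qed
      then show ?thesis by (simp add: outer_section_def)
    qed
    have ws0: "wall_system g (a1, b1, z1) (a, b, z) = 0" for a b z
      unfolding wall_system_def prod.case
    proof (rule wsum_eq_0)
      fix i assume "i < N" "act (a < a1) i a1 \<and> \<beta> i a1 = b1 \<and> z1 < \<zeta> i a1 \<and> b < \<beta> i a"
      then show "g i = 0" using bd[of i "a < a1" a1] z1 out by linarith
    qed
    have "\<forall>\<^sub>F y in ?n. outer_section g m y = 0"
    proof (cases "\<bar>a1\<bar> > m \<or> \<bar>b1\<bar> > m")
      case True
      have op: "open {x::point. \<bar>fst x\<bar> > m}" "open {x::point. \<bar>fst (snd x)\<bar> > m}"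
        by (intro open_Collect_less continuous_intros)+
      have "\<forall>\<^sub>F x in ?n. \<bar>fst x\<bar> > m \<or> \<bar>fst (snd x)\<bar> > m"
        using eventually_nhds_in_open[OF open_Un[OF op], of "(a1, b1, z1)"] True by simp
      then show ?thesis by (rule eventually_mono) (use far in auto)
    next
      case False
      then have "z1 > - m" using z1 out by linarith
      moreover have "open {x::point. snd (snd x) > - m}"
        by (intro open_Collect_less continuous_intros)
      ultimately have "\<forall>\<^sub>F x in ?n. snd (snd x) > - m"
        using eventually_nhds_in_open[of "{x. snd (snd x) > - m}" "(a1, b1, z1)"] by simp
      then show ?thesis by (rule eventually_mono) (auto simp: outer_section_def)
    qed
    then have "\<forall>\<^sub>F y in ?n. outer_section g m y = 0 + wall_system g (a1, b1, z1) y"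
      by (rule eventually_mono) (use ws0 in auto)
    then show ?thesis by (rule exI)
  qed
qed

lemma strand_compact_connected:
  assumes "i < N"
  shows "compact (strand i)" "connected (strand i)"
proof -
  have "continuous_on {l i..r i} (\<lambda>a. (a, \<beta> i a, \<zeta> i a))"
    using cont_\<beta>[OF assms] cont_\<zeta>[OF assms]
    by (intro continuous_on_Pair continuous_on_id) (auto intro: continuous_on_subset)
  then show "compact (strand i)" "connected (strand i)"
    unfolding strand_def by (auto intro: compact_continuous_image connected_continuous_image)
qed

lemma compact_link: "compact link"
  unfolding link_def using strand_compact_connected by (intro compact_UN) auto

lemma ex_box_bound: "\<exists>m>0. box_bound m"
proof -
  obtain m where m: "m > 0" "\<And>x. x \<in> link \<Longrightarrow> norm x \<le> m"
    using compact_imp_bounded[OF compact_link] by (auto simp: bounded_pos)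
  have "box_bound (m + 1)"
    unfolding box_bound_def
  proof (clarify)
    fix a b z assume "(a, b, z) \<in> link"
    then have "norm (a, b, z) \<le> m" by (rule m(2))
    moreover have "\<bar>a\<bar> \<le> norm (a, b, z)" "norm (b, z) \<le> norm (a, b, z)" "\<bar>b\<bar> \<le> norm (b, z)" "\<bar>z\<bar> \<le> norm (b, z)"
      by (metis norm_fst_le norm_snd_le real_norm_def)+
    ultimately show "\<bar>a\<bar> < m + 1 \<and> \<bar>b\<bar> < m + 1 \<and> \<bar>z\<bar> < m + 1" by linarith
  qed
  then show ?thesis using m(1) by (intro exI[of _ "m + 1"]) auto
qed

section \<open>Loops around a strand\<close>

text \<open>These are the points off the link that lie in no wall; constants are sections along
  paths through them.\<close>

definition free_column :: "point set" where
  "free_column = {(a, b, z). \<forall>z'\<ge>z. (a, b, z') \<notin> link}"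

lemma free_column_link: "free_column \<subseteq> - link"
  by (auto simp: free_column_def)

lemma wall_system_free_column:
  assumes "x \<in> free_column"
  shows "wall_system g x y = 0"
proof -
  obtain a0 b0 z0 a b z where xy: "x = (a0, b0, z0)" "y = (a, b, z)" by (metis prod_cases3)
  show ?thesis
    unfolding xy wall_system_def prod.case
  proof (rule wsum_eq_0)
    fix i assume i: "i < N" "act (a < a0) i a0 \<and> \<beta> i a0 = b0 \<and> z0 < \<zeta> i a0 \<and> b < \<beta> i a"
    then have "(a0, b0, \<zeta> i a0) \<in> link" using act_link by blast
    then show "g i = 0" using assms i(2) by (force simp: xy free_column_def)
  qed
qed

lemma holonomy_free_column:
  assumes "path_image p \<subseteq> free_column"
  shows "holonomy (wall_system g) p = (0 :: 'g::group_add)"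
proof -
  have "section_along (wall_system g) {0..1} p (\<lambda>_. 0)"
    unfolding section_along_def
  proof
    fix t0 :: real assume "t0 \<in> {0..1}"
    then have "p t0 \<in> free_column" using assms by (auto simp: path_image_def)
    then show "\<exists>c. \<forall>\<^sub>F t in nhds t0. t \<in> {0..1} \<longrightarrow> 0 = c + wall_system g (p t0) (p t)"
      by (intro exI[of _ 0]) (simp add: wall_system_free_column)
  qed
  from holonomy_eq[OF this] show ?thesis by simp
qed

text \<open>A loop that comes down in front of strand \<open>i\<close>, passes below it and goes up behind it.\<close>

lemma meridian:
  fixes g :: "nat \<Rightarrow> 'g::group_add"
  assumes ls: "local_system (- link) (wall_system g)" and i: "i < N"
    and m: "box_bound m"
  obtains p where "p \<in> loops_at (- link) (0, 0, m)" "holonomy (wall_system g) p = g i"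
proof -
  define a where "a = (l i + r i) / 2"
  define b where "b = \<beta> i a"
  have a: "l i < a" "a < r i" using lr[OF i] by (auto simp: a_def)
  have act_j: "act False j a \<and> l j = l i \<and> r j = r i" if "j < N" "l j \<le> a" "a \<le> r j" for j
    using slab[OF that(1) i] a that(2,3) by (auto simp: act_def)
  have j_eq: "j = i" if "j < N" "l j \<le> a" "a \<le> r j" "\<beta> j a = b" for j
  proof (rule ccontr)
    assume "j \<noteq> i"
    then show False
      using order[of i j a] order[of j i a] act_j[OF that(1-3)] a i that(1,4) by (auto simp: b_def neq_iff)
  qed
  \<comment> \<open>Over \<open>(a, b)\<close> there is no strand but \<open>i\<close>, so every
    height below it avoids the link; \<open>1\<close> is arbitrary.\<close>
  define z where "z = \<zeta> i a - 1"
  define B where "B = (\<lambda>j. \<beta> j a) ` {..<N} - {b}"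
  have "finite B" by (simp add: B_def)
  then obtain d where d: "d > 0" "\<And>b'. b' \<in> B \<Longrightarrow> d \<le> dist b b'"
    using finite_set_avoid[of B b] by (auto simp: B_def)
  \<comment> \<open>Half the least distance keeps the segment from \<open>b + e\<close> to
    \<open>b - e\<close> away from the other strands over \<open>a\<close>.\<close>
  define e where "e = d / 2"
  have e: "e > 0" using d by (simp add: e_def)
  have col: "(a, b', z') \<notin> link" if "b' \<noteq> b" "\<bar>b' - b\<bar> \<le> e" for b' z'
  proof
    assume "(a, b', z') \<in> link"
    then obtain j where j: "j < N" "b' = \<beta> j a" by (auto simp: link_def strand_def)
    then have "b' \<in> B" using that(1) by (auto simp: B_def)
    from d(2)[OF this] that(2) d(1) show False by (simp add: dist_real_def e_def abs_minus_commute)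
  qed
  have below: "(a, b, z) \<notin> link"
    using j_eq by (force simp: link_def strand_def z_def)
  have up: "(a', b', z') \<in> free_column" if "z' \<ge> m" for a' b' z'
    using m that by (fastforce simp: free_column_def box_bound_def)
  let ?f = "wall_system g"
  let ?o = "(0, 0, m)" and ?P = "(a, b + e, m)" and ?Q = "(a, b + e, z)"
    and ?Q' = "(a, b - e, z)" and ?P' = "(a, b - e, m)"
  have seg_up: "path_image (linepath u v) \<subseteq> free_column"
    if "snd (snd u) = m" "snd (snd v) = m" for u v :: "point"
  proof -
    have "closed_segment u v \<subseteq> {x. snd (snd x) = m}"
      by (rule closed_segment_subset) (use that in \<open>auto simp: convex_def algebra_simps simp flip: distrib_right\<close>)
    then show ?thesis using up by fastforce
  qed
  have seg_col: "path_image (linepath (a, b', u) (a, b', v)) \<subseteq> free_column"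
    if "b' \<noteq> b" "\<bar>b' - b\<bar> \<le> e" for b' u v
  proof -
    have "closed_segment (a, b', u) (a, b', v) \<subseteq> {a} \<times> {b'} \<times> UNIV"
      by (rule closed_segment_subset) (auto simp: convex_Times)
    then show ?thesis using col[OF that] by (fastforce simp: free_column_def)
  qed
  have eb: "b + e \<noteq> b" "\<bar>b + e - b\<bar> \<le> e" "b - e \<noteq> b" "\<bar>b - e - b\<bar> \<le> e" using e by auto
  define q where "q = linepath ?Q ?Q'"
  have q: "q t = (a, b + e - 2 * e * t, z)" for t
    by (simp add: q_def linepath_def algebra_simps)
  have q_free: "q t \<in> free_column" if t: "t \<in> {0..1}" "t \<noteq> 1 / 2" for t
  proof -
    have "e * t \<le> e" "e * t \<ge> 0" using t e by auto
    then have "\<bar>b + e - 2 * e * t - b\<bar> \<le> e" by (simp add: algebra_simps abs_le_iff)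
    moreover have "b + e - 2 * e * t \<noteq> b" using t e by (simp add: field_simps)
    ultimately show ?thesis unfolding q free_column_def using col by blast
  qed
  have "q t \<notin> link" if "t \<in> {0..1}" for t
  proof (cases "t = 1 / 2")
    case True
    then show ?thesis using below by (simp add: q True)
  qed (use q_free[OF that] free_column_link in auto)
  then have q_link: "path_image q \<subseteq> - link" by (auto simp: path_image_def)
  have ws_i: "?f (a, b, z) (a, b', z) = (if b' < b then g i else 0)" for b'
  proof -
    have eq: "(act (a < a) j a \<and> \<beta> j a = b \<and> z < \<zeta> j a \<and> b' < \<beta> j a) = (j = i \<and> b' < b)" if "j < N" for j
      using j_eq[OF that] act_range[of False j a] a by (auto simp: act_def z_def b_def)
    show ?thesis
    proof (cases "b' < b")
      case True
      then have "?f (a, b, z) (a, b', z) = wsum g (\<lambda>j. j = i) N"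
        unfolding wall_system_def prod.case using eq by (intro wsum_cong) simp
      then show ?thesis using True wsum_single[OF i] by simp
    next
      case False
      then show ?thesis
        unfolding wall_system_def prod.case using eq by (simp del: less_irrefl) (intro wsum_eq_0, simp)
    qed
  qed
  \<comment> \<open>The germ at the crossing point serves for all of \<open>q\<close>: elsewhere on
    \<open>q\<close> the wall system vanishes, so there it suffices that this germ be locally
    constant along \<open>q\<close>.\<close>
  have "section_along ?f {0..1} q (\<lambda>t. ?f (a, b, z) (q t))"
    unfolding section_along_def
  proof
    fix t0 :: real assume t0: "t0 \<in> {0..1}"
    have fq: "?f (a, b, z) (q t) = (if t > 1 / 2 then g i else 0)" for t
      unfolding q ws_i using e by (simp add: field_simps)
    show "\<exists>c. \<forall>\<^sub>F t in nhds t0. t \<in> {0..1} \<longrightarrow> ?f (a, b, z) (q t) = c + ?f (q t0) (q t)"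
    proof (cases "t0 = 1 / 2")
      case True
      have "q t0 = (a, b, z)" by (simp add: q True)
      then show ?thesis by (intro exI[of _ 0]) simp
    next
      case False
      from q_free[OF t0 this] have 0: "?f (q t0) y = 0" for y by (rule wall_system_free_column)
      have "\<forall>\<^sub>F t in nhds t0. (t > 1 / 2) = (t0 > 1 / 2)"
        using False eventually_nhds_in_open[of "{1/2<..}" t0] eventually_nhds_in_open[of "{..<1/2}" t0]
        by (cases "t0 > 1 / 2") (auto elim!: eventually_mono)
      then have "\<forall>\<^sub>F t in nhds t0. t \<in> {0..1} \<longrightarrow>
          ?f (a, b, z) (q t) = (if t0 > 1 / 2 then g i else 0) + ?f (q t0) (q t)"
        by (rule eventually_mono) (simp add: 0 fq)
      then show ?thesis by (rule exI[of _ "if t0 > 1 / 2 then g i else 0"])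
    qed
  qed
  from holonomy_eq[OF this] have hq: "holonomy ?f q = g i"
    using e by (simp add: q ws_i)
  have free: "path_image (linepath ?o ?P) \<subseteq> free_column" "path_image (linepath ?P ?Q) \<subseteq> free_column"
    "path_image (linepath ?Q' ?P') \<subseteq> free_column" "path_image (linepath ?P' ?o) \<subseteq> free_column"
    using eb by (intro seg_up seg_col; simp)+
  note free_link = free[THEN subset_trans[OF _ free_column_link]]
  have q_ends: "path q" "pathstart q = ?Q" "pathfinish q = ?Q'" by (simp_all add: q_def)
  let ?p = "linepath ?o ?P +++ linepath ?P ?Q +++ q +++ linepath ?Q' ?P' +++ linepath ?P' ?o"
  have "holonomy ?f ?p = holonomy ?f (linepath ?o ?P) + (holonomy ?f (linepath ?P ?Q) +
      (holonomy ?f q + (holonomy ?f (linepath ?Q' ?P') + holonomy ?f (linepath ?P' ?o))))"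
    using free_link q_link q_ends
    by (simp add: holonomy_join[OF ls] path_image_join del: path_image_linepath)
  then have "holonomy ?f ?p = g i"
    using free[THEN holonomy_free_column[where g = g]] hq by simp
  moreover have "?p \<in> loops_at (- link) ?o"
    using free_link q_link q_ends by (simp add: loops_at_def path_image_join del: path_image_linepath)
  ultimately show ?thesis using that by blast
qed

end


section \<open>Dihedral colourings\<close>

text \<open>Elimination without fractions: equation \<open>j\<close> is used to eliminate the
  unknown \<open>p\<close>, and multiplying the other equations and unknowns by \<open>c j p\<close>
  keeps everything integral.\<close>

lemma int_homogeneous_solution:
  fixes c :: "'j \<Rightarrow> 'i \<Rightarrow> int"
  assumes "finite J" "finite I" "card J < card I"
  shows "\<exists>x. (\<exists>i\<in>I. x i \<noteq> 0) \<and> (\<forall>j\<in>J. (\<Sum>i\<in>I. c j i * x i) = 0)"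
  using assms
proof (induction J arbitrary: I c rule: finite_induct)
  case empty
  then have "I \<noteq> {}" by auto
  then show ?case by (intro exI[of _ "\<lambda>_. 1"]) auto
next
  case (insert j J)
  show ?case
  proof (cases "\<forall>i\<in>I. c j i = 0")
    case True
    then show ?thesis using insert.IH[of I c] insert.prems insert.hyps by auto
  next
    case False
    then obtain p where p: "p \<in> I" "c j p \<noteq> 0" by blast
    let ?I = "I - {p}"
    define c' where "c' k i = c j p * c k i - c k p * c j i" for k i
    have "card J < card ?I" using insert.prems insert.hyps p by simp
    with insert.IH[of ?I c'] insert.prems
    obtain x where x: "\<exists>i\<in>?I. x i \<noteq> 0" "\<forall>k\<in>J. (\<Sum>i\<in>?I. c' k i * x i) = 0" by auto
    define y where "y i = (if i = p then - (\<Sum>i\<in>?I. c j i * x i) else c j p * x i)" for i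
    have sum: "(\<Sum>i\<in>I. c k i * y i) = (\<Sum>i\<in>?I. c' k i * x i)" for k
    proof -
      have "(\<Sum>i\<in>I. c k i * y i) = c k p * y p + (\<Sum>i\<in>?I. c k i * y i)"
        using p insert.prems by (simp add: sum.remove)
      also have "(\<Sum>i\<in>?I. c k i * y i) = (\<Sum>i\<in>?I. c k i * (c j p * x i))"
        by (rule sum.cong) (auto simp: y_def)
      also have "c k p * y p = (\<Sum>i\<in>?I. - (c k p * (c j i * x i)))"
        by (simp add: y_def sum_negf sum_distrib_left)
      finally show ?thesis
        by (simp add: c'_def algebra_simps flip: sum.distrib)
    qed
    have "(\<Sum>i\<in>?I. c' j i * x i) = 0" by (simp add: c'_def algebra_simps)
    then have "\<forall>k\<in>insert j J. (\<Sum>i\<in>I. c k i * y i) = 0" using x(2) sum by auto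
    moreover have "\<exists>i\<in>I. y i \<noteq> 0" using x(1) p by (auto simp: y_def)
    ultimately show ?thesis by blast
  qed
qed

lemma int_homogeneous_primitive_solution:
  fixes c :: "'j \<Rightarrow> 'i \<Rightarrow> int"
  assumes "finite J" "finite I" "card J < card I"
  obtains x where "\<And>d. (\<And>i. i \<in> I \<Longrightarrow> d dvd x i) \<Longrightarrow> is_unit d"
    and "\<And>j. j \<in> J \<Longrightarrow> (\<Sum>i\<in>I. c j i * x i) = 0"
proof -
  obtain x where x: "\<exists>i\<in>I. x i \<noteq> 0" "\<And>j. j \<in> J \<Longrightarrow> (\<Sum>i\<in>I. c j i * x i) = 0"
    using int_homogeneous_solution[OF assms, of c] by blast
  define h where "h = Gcd (x ` I)"
  have h: "h \<noteq> 0" using x(1) by (auto simp: h_def Gcd_0_iff)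
  have dvd: "h dvd x i" if "i \<in> I" for i using that by (simp add: h_def)
  define y where "y i = x i div h" for i
  have xy: "x i = h * y i" if "i \<in> I" for i using dvd[OF that] by (simp add: y_def)
  have "is_unit d" if "\<And>i. i \<in> I \<Longrightarrow> d dvd y i" for d
  proof -
    have "h * d dvd h"
      unfolding h_def by (rule Gcd_greatest) (use that xy h_def in auto)
    then show ?thesis using h by simp
  qed
  moreover have "(\<Sum>i\<in>I. c j i * y i) = 0" if "j \<in> J" for j
  proof -
    have "h * (\<Sum>i\<in>I. c j i * y i) = (\<Sum>i\<in>I. c j i * x i)"
      unfolding sum_distrib_left by (rule sum.cong) (auto simp: xy)
    then show ?thesis using x(2)[OF that] h by simp
  qed
  ultimately show ?thesis using that by blast
qed

text \<open>Each reflection to the left of factor \<open>i\<close> in a product of affine maps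
  negates the shift of that factor.\<close>

definition word_sign :: "(nat \<Rightarrow> bool) \<Rightarrow> (nat \<Rightarrow> bool) \<Rightarrow> nat \<Rightarrow> int" where
  "word_sign s P i = (- 1) ^ card {j. j < i \<and> P j \<and> s j}"

lemma word_sign_square [simp]: "word_sign s P i * word_sign s P i = 1"
  by (simp add: word_sign_def flip: power_add)

lemma wsum_Aff:
  "wsum (\<lambda>i. Aff (s i) (t i)) P n
     = Aff (odd (card {j. j < n \<and> P j \<and> s j})) (\<Sum>i | i < n \<and> P i. word_sign s P i * t i)"
proof (induction n)
  case 0
  then show ?case by (simp add: zero_aff_def)
next
  case (Suc n)
  have set: "{i. i < Suc n \<and> Q i} = (if Q n then insert n {i. i < n \<and> Q i} else {i. i < n \<and> Q i})" for Q
    by (auto simp: less_Suc_eq)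
  show ?case
    using Suc set[of P] set[of "\<lambda>j. P j \<and> s j"]
    by (auto simp: plus_aff_def zero_aff_def word_sign_def)
qed

context strand_diagram
begin

section \<open>Closed chains of strands\<close>

definition endpt :: "bool \<Rightarrow> nat \<Rightarrow> point" where
  "endpt s i = (let a = if s then r i else l i in (a, \<beta> i a, \<zeta> i a))"

definition inc :: "point \<Rightarrow> nat set" where
  "inc v = {i. i < N \<and> (\<exists>s. endpt s i = v)}"

text \<open>Strands run from left to right, but the circle may traverse them either way, hence the
  equation between unordered pairs of ends.\<close>

definition cyclic_chain :: "nat set \<Rightarrow> point set \<Rightarrow> bool" where
  "cyclic_chain E V \<longleftrightarrow> E \<noteq> {} \<and> E \<subseteq> {..<N} \<and> (\<forall>i<N. \<forall>s. endpt s i \<in> V \<longrightarrow> i \<in> E) \<and>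
     (\<exists>m e w. bij_betw e {..<m} E \<and> bij_betw w {..<m} V \<and>
        (\<forall>j<m. {endpt False (e j), endpt True (e j)} = {w j, w (Suc j mod m)}))"

lemma finite_inc: "finite (inc v)"
  by (simp add: inc_def)

lemma endpt_neq: "i < N \<Longrightarrow> endpt False i \<noteq> endpt True i"
  using lr[of i] by (auto simp: endpt_def Let_def)

lemma cyclic_chainE:
  assumes "cyclic_chain E V"
  obtains m e w where "m > 0" "bij_betw e {..<m} E" "bij_betw w {..<m} V"
    "\<And>j. j < m \<Longrightarrow> {endpt False (e j), endpt True (e j)} = {w j, w (Suc j mod m)}"
    "\<And>j. j < m \<Longrightarrow> inc (w (Suc j mod m)) = {e j, e (Suc j mod m)}"
    "\<And>j. j < m \<Longrightarrow> e j \<noteq> e (Suc j mod m)"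
proof -
  from assms obtain m e w where E: "E \<noteq> {}" "E \<subseteq> {..<N}"
    and cl: "\<And>i s. i < N \<Longrightarrow> endpt s i \<in> V \<Longrightarrow> i \<in> E"
    and e: "bij_betw e {..<m} E" and w: "bij_betw w {..<m} V"
    and ew: "\<And>j. j < m \<Longrightarrow> {endpt False (e j), endpt True (e j)} = {w j, w (Suc j mod m)}"
    unfolding cyclic_chain_def by metis
  have m: "m > 0" using E(1) e by (cases m) (auto simp: bij_betw_def)
  have S: "Suc j mod m < m" for j using m by simp
  have eN: "e j < N" if "j < m" for j using e E(2) that by (auto simp: bij_betw_def)
  have w_eq: "w i = w j \<longleftrightarrow> i = j" if "i < m" "j < m" for i j
    using w that by (auto simp: bij_betw_def inj_on_def)
  have e_eq: "e i = e j \<longleftrightarrow> i = j" if "i < m" "j < m" for i j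
    using e that by (auto simp: bij_betw_def inj_on_def)
  have "w j \<noteq> w (Suc j mod m)" if "j < m" for j
    using ew[OF that] endpt_neq[OF eN[OF that]] by auto
  then have ne: "e j \<noteq> e (Suc j mod m)" if "j < m" for j
    using e_eq[OF that S] w_eq[OF that S] that by metis
  have Suc_inj: "i = j" if "Suc i mod m = Suc j mod m" "i < m" "j < m" for i j
    using that by (auto simp: mod_Suc split: if_splits)
  have "inc (w (Suc j mod m)) = {e j, e (Suc j mod m)}" if j: "j < m" for j
  proof (intro equalityI subsetI)
    fix i assume "i \<in> inc (w (Suc j mod m))"
    then obtain s where i: "i < N" "endpt s i = w (Suc j mod m)" by (auto simp: inc_def)
    moreover have "w (Suc j mod m) \<in> V" using w S by (auto simp: bij_betw_def)
    ultimately have "i \<in> E" using cl by metis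
    then obtain k where k: "k < m" "i = e k" using e by (auto simp: bij_betw_def)
    have "endpt s i \<in> {w k, w (Suc k mod m)}"
      using ew[OF k(1)] k(2) by (cases s) auto
    then have "k = Suc j mod m \<or> k = j"
      using i(2) w_eq S k j Suc_inj by (metis empty_iff insert_iff)
    then show "i \<in> {e j, e (Suc j mod m)}" using k by auto
  next
    fix i assume "i \<in> {e j, e (Suc j mod m)}"
    then have "\<exists>k<m. i = e k \<and> w (Suc j mod m) \<in> {w k, w (Suc k mod m)}"
      using j S[of j] by (elim insertE emptyE) blast+
    then obtain k where k: "k < m" "i = e k" "w (Suc j mod m) \<in> {w k, w (Suc k mod m)}"
      by blast
    then have "w (Suc j mod m) \<in> {endpt False i, endpt True i}" using ew by simp
    then show "i \<in> inc (w (Suc j mod m))" using eN k by (auto simp: inc_def)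
  qed
  with that m e w ew ne show ?thesis by blast
qed

lemma cyclic_chain_card:
  assumes "cyclic_chain E V"
  shows "card V = card E" "finite E" "finite V"
    and "v \<in> V \<Longrightarrow> card (inc v) = 2" "v \<in> V \<Longrightarrow> inc v \<subseteq> E"
    and "i \<in> E \<Longrightarrow> endpt s i \<in> V"
proof -
  obtain m e w where m: "m > 0" and e: "bij_betw e {..<m} E" and w: "bij_betw w {..<m} V"
    and ew: "\<And>j. j < m \<Longrightarrow> {endpt False (e j), endpt True (e j)} = {w j, w (Suc j mod m)}"
    and inc: "\<And>j. j < m \<Longrightarrow> inc (w (Suc j mod m)) = {e j, e (Suc j mod m)}"
    and ne: "\<And>j. j < m \<Longrightarrow> e j \<noteq> e (Suc j mod m)"
    using cyclic_chainE[OF assms] by metis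
  show "card V = card E" "finite E" "finite V"
    using bij_betw_same_card[OF e] bij_betw_same_card[OF w] bij_betw_finite[OF e] bij_betw_finite[OF w] by auto
  { assume "v \<in> V"
    then obtain k where k: "k < m" "v = w k" using w by (auto simp: bij_betw_def)
    define j where "j = (if k = 0 then m - 1 else k - 1)"
    have j: "j < m" "Suc j mod m = k" using k m by (auto simp: j_def)
    then have eq: "inc v = {e j, e k}" "e j \<noteq> e k" using inc[of j] ne[of j] k by auto
    then show "card (inc v) = 2" by simp
    show "inc v \<subseteq> E" using eq e j k by (auto simp: bij_betw_def) }
  { assume "i \<in> E"
    then obtain j where j: "j < m" "i = e j" using e by (auto simp: bij_betw_def)
    have "endpt s i \<in> {w j, w (Suc j mod m)}" using ew[OF j(1)] j(2) by (cases s) auto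
    then show "endpt s i \<in> V" using w j m by (auto simp: bij_betw_def) }
qed

section \<open>Signs of the translations and their monodromy\<close>

text \<open>Unlike in \<open>stack\<close>, height \<open>z\<close> itself is included, so that the
  relation can be stated at a vertex and contain the strands ending there.\<close>

definition above :: "bool \<Rightarrow> real \<Rightarrow> real \<Rightarrow> real \<Rightarrow> nat \<Rightarrow> bool" where
  "above s a b z i \<longleftrightarrow> act s i a \<and> \<beta> i a = b \<and> \<zeta> i a \<ge> z"

abbreviation above_relation :: "(nat \<Rightarrow> 'g::monoid_add) \<Rightarrow> real \<Rightarrow> real \<Rightarrow> real \<Rightarrow> bool" where
  "above_relation g a b z \<equiv> wsum g (above True a b z) N = wsum g (above False a b z) N"

text \<open>The sign with which the translation part of strand \<open>i\<close> enters the relation at its left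
  (right) end for \<open>s = False\<close> (\<open>s = True\<close>): the parity of the strands of \<open>X\<close> that precede it in the stack.\<close>

definition end_sign :: "nat set \<Rightarrow> bool \<Rightarrow> nat \<Rightarrow> int" where
  "end_sign X s i = word_sign (\<lambda>j. j \<in> X) ((\<lambda>(a, b, z). above s a b z) (endpt s i)) i"

lemma end_sign_Un: "X \<inter> Y = {} \<Longrightarrow> end_sign (X \<union> Y) s i = end_sign X s i * end_sign Y s i"
proof -
  assume "X \<inter> Y = {}"
  let ?P = "(\<lambda>(a, b, z). above s a b z) (endpt s i)"
  have "{j. j < i \<and> ?P j \<and> j \<in> X \<union> Y} = {j. j < i \<and> ?P j \<and> j \<in> X} \<union> {j. j < i \<and> ?P j \<and> j \<in> Y}"
    by auto
  moreover have "{j. j < i \<and> ?P j \<and> j \<in> X} \<inter> {j. j < i \<and> ?P j \<and> j \<in> Y} = {}"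
    using \<open>X \<inter> Y = {}\<close> by auto
  ultimately show ?thesis
    by (simp add: end_sign_def word_sign_def card_Un_disjoint power_add)
qed

text \<open>The sign a translation acquires when carried once around \<open>E\<close>. At a simple
  crossing where \<open>E\<close> passes under \<open>X\<close>, exactly one of the two ends
  contributes \<open>- 1\<close>, so this is the parity of the linking number.\<close>

definition monodromy :: "nat set \<Rightarrow> nat set \<Rightarrow> int" where
  "monodromy E X = (\<Prod>i\<in>E. end_sign X False i * end_sign X True i)"

lemma monodromy_Un: "X \<inter> Y = {} \<Longrightarrow> monodromy E (X \<union> Y) = monodromy E X * monodromy E Y"
  by (simp add: monodromy_def end_sign_Un flip: prod.distrib) (intro prod.cong, auto)

lemma monodromy_cases: "monodromy E X = 1 \<or> monodromy E X = - 1"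
proof -
  have "monodromy E X * monodromy E X = 1"
    unfolding monodromy_def prod.distrib[symmetric]
    by (rule prod.neutral) (simp add: end_sign_def mult.assoc mult.left_commute[of "word_sign _ _ _"])
  then show ?thesis by (metis power2_eq_square power2_eq_1_iff)
qed

text \<open>The coefficient of strand \<open>i\<close> in left side minus right side of the relation
  at \<open>v\<close>: a strand whose right end is \<open>v\<close> lies to the left of it.\<close>

definition vertex_sign :: "nat set \<Rightarrow> point \<Rightarrow> nat \<Rightarrow> int" where
  "vertex_sign X v i = (if v = endpt True i then end_sign X True i else - end_sign X False i)"

lemma prod_cyclic_shift:
  fixes f :: "nat \<Rightarrow> 'a::comm_monoid_mult"
  assumes "m > 0"
  shows "(\<Prod>j<m. f (Suc j mod m)) = (\<Prod>j<m. f j)"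
proof -
  obtain n where m: "m = Suc n" using assms by (cases m) auto
  have "(\<Prod>j<n. f (Suc j mod m)) = (\<Prod>j<n. f (Suc j))"
    by (rule prod.cong) (auto simp: m)
  then show ?thesis
    unfolding m prod.lessThan_Suc_shift[of f] by (simp add: mult.commute)
qed

text \<open>The equation at a vertex determines the sign of one of its two strands from the other.
  The signs close up if the product of these ratios over all vertices is \<open>1\<close>; regrouped
  by strands instead of vertices, that product is the monodromy.\<close>

lemma translation_pattern:
  assumes cyc: "cyclic_chain E V" and mono: "monodromy E X = 1"
  obtains u where "\<And>i. i \<in> E \<Longrightarrow> u i = 1 \<or> u i = - 1"
    and "\<And>v. v \<in> V \<Longrightarrow> (\<Sum>i\<in>inc v. vertex_sign X v i * u i) = 0"
proof -
  obtain m e w where m: "m > 0" and e: "bij_betw e {..<m} E" and w: "bij_betw w {..<m} V"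
    and ew: "\<And>j. j < m \<Longrightarrow> {endpt False (e j), endpt True (e j)} = {w j, w (Suc j mod m)}"
    and inc: "\<And>j. j < m \<Longrightarrow> inc (w (Suc j mod m)) = {e j, e (Suc j mod m)}"
    and ne: "\<And>j. j < m \<Longrightarrow> e j \<noteq> e (Suc j mod m)"
    using cyclic_chainE[OF cyc] by metis
  have eN: "e j < N" if "j < m" for j
    using e cyc that by (auto simp: bij_betw_def cyclic_chain_def)
  let ?\<sigma> = "vertex_sign X"
  have sq: "?\<sigma> v i * ?\<sigma> v i = 1" for v i by (simp add: vertex_sign_def end_sign_def)
  \<comment> \<open>The ratio of the signs of consecutive strands forced by their common vertex;
    each vertex sign is its own inverse.\<close>
  define \<rho> where "\<rho> j = - (?\<sigma> (w (Suc j mod m)) (e j) * ?\<sigma> (w (Suc j mod m)) (e (Suc j mod m)))" for j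
  define U where "U j = (\<Prod>k<j. \<rho> k)" for j
  have \<rho>: "\<rho> j = 1 \<or> \<rho> j = - 1" for j
  proof -
    have "\<rho> j * \<rho> j = 1"
      by (simp add: \<rho>_def algebra_simps) (metis mult.assoc mult.left_commute sq mult_1_right)
    then show ?thesis by (metis power2_eq_square power2_eq_1_iff)
  qed
  have U: "U j = 1 \<or> U j = - 1" for j
  proof (induction j)
    case (Suc j)
    then show ?case using \<rho>[of j] by (auto simp: U_def)
  qed (simp add: U_def)
  have "U m = (\<Prod>j<m. - (?\<sigma> (w (Suc j mod m)) (e j))) * (\<Prod>j<m. ?\<sigma> (w (Suc j mod m)) (e (Suc j mod m)))"
    by (simp add: U_def \<rho>_def prod.distrib[symmetric])
  also have "\<dots> = (\<Prod>j<m. - (?\<sigma> (w (Suc j mod m)) (e j)) * ?\<sigma> (w j) (e j))"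
    unfolding prod_cyclic_shift[OF m, of "\<lambda>j. ?\<sigma> (w j) (e j)"] by (simp add: prod.distrib[symmetric])
  also have "\<dots> = (\<Prod>j<m. end_sign X False (e j) * end_sign X True (e j))"
  proof (rule prod.cong)
    fix j assume "j \<in> {..<m}"
    then have j: "j < m" by simp
    note neq = endpt_neq[OF eN[OF j]]
    from ew[OF j] consider
      "w j = endpt False (e j)" "w (Suc j mod m) = endpt True (e j)" |
      "w j = endpt True (e j)" "w (Suc j mod m) = endpt False (e j)"
      using neq by (auto simp: doubleton_eq_iff)
    then show "- (?\<sigma> (w (Suc j mod m)) (e j)) * ?\<sigma> (w j) (e j) = end_sign X False (e j) * end_sign X True (e j)"
      by cases (use neq in \<open>auto simp: vertex_sign_def\<close>)
  qed simp
  also have "\<dots> = monodromy E X"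
    unfolding monodromy_def by (rule prod.reindex_bij_betw[OF e])
  finally have Um: "U m = 1" using mono by simp
  have USuc: "U (Suc j mod m) = \<rho> j * U j" if "j < m" for j
  proof (cases "Suc j = m")
    case True
    then have "U (Suc j) = 1" using Um by simp
    then have "U j * \<rho> j = 1" by (simp add: U_def)
    then show ?thesis using True by (simp add: U_def mult.commute)
  next
    case False
    then show ?thesis using that by (simp add: U_def mult.commute)
  qed
  define u where "u i = U (inv_into {..<m} e i)" for i
  have u: "u (e j) = U j" if "j < m" for j
    using e that by (simp add: u_def bij_betw_def)
  show ?thesis
  proof
    show "u i = 1 \<or> u i = - 1" for i unfolding u_def by (rule U)
    fix v assume "v \<in> V"
    then obtain k where k: "k < m" "v = w k" using w by (auto simp: bij_betw_def)
    define j where "j = (if k = 0 then m - 1 else k - 1)"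
    have j: "j < m" "Suc j mod m = k" using k m by (auto simp: j_def)
    have "(\<Sum>i\<in>inc v. ?\<sigma> v i * u i) = ?\<sigma> v (e j) * U j + ?\<sigma> v (e k) * U k"
      using inc[OF j(1)] ne[OF j(1)] j k u by simp
    also have "U k = - (?\<sigma> v (e j) * ?\<sigma> v (e k)) * U j"
      using USuc[OF j(1)] j k by (simp add: \<rho>_def)
    also have "?\<sigma> v (e j) * U j + ?\<sigma> v (e k) * (- (?\<sigma> v (e j) * ?\<sigma> v (e k)) * U j)
        = ?\<sigma> v (e j) * U j * (1 - ?\<sigma> v (e k) * ?\<sigma> v (e k))"
      by (simp add: algebra_simps)
    finally show "(\<Sum>i\<in>inc v. ?\<sigma> v i * u i) = 0" by (simp add: sq)
  qed
qed

text \<open>An end without other strands above or below it serves as the vertex with the redundant relation.\<close>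

definition clean :: bool where
  "clean \<longleftrightarrow> (\<forall>i<N. \<exists>s a b z. endpt s i = (a, b, z) \<and>
     (\<forall>j<N. \<forall>s. act s j a \<longrightarrow> \<beta> j a = b \<longrightarrow> \<zeta> j a = z))"

section \<open>Flips and shifts in the relations\<close>

definition level :: "real \<Rightarrow> bool" where
  "level a \<longleftrightarrow> (\<exists>i<N. l i = a \<or> r i = a)"

lemma act_not_level: "\<not> level a \<Longrightarrow> i < N \<Longrightarrow> act s i a = act s' i a"
  by (cases s; cases s') (force simp: level_def act_def)+

text \<open>By the slab condition no strand passes over the end of another in its interior, so a
  strand reaching a level ends there.\<close>

lemma act_level:
  assumes "level a" "i < N"
  shows "act s i a \<longleftrightarrow> a = (if s then r i else l i)"
proof
  assume act: "act s i a"
  obtain j where "j < N" "l j = a \<or> r j = a" using assms(1) by (auto simp: level_def)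
  then show "a = (if s then r i else l i)"
    using slab[OF assms(2), of j] lr[of j] act by (auto simp: act_def split: if_splits)
qed (use lr[OF assms(2)] in \<open>auto simp: act_def\<close>)

lemma at_level:
  assumes "level a" "i < N"
  shows "act s i a \<and> \<beta> i a = b \<and> \<zeta> i a = z \<longleftrightarrow> endpt s i = (a, b, z)"
  unfolding act_level[OF assms] by (auto simp: endpt_def Let_def)

definition stack_sum :: "nat set \<Rightarrow> (nat \<Rightarrow> int) \<Rightarrow> (nat \<Rightarrow> bool) \<Rightarrow> int" where
  "stack_sum X t P = (\<Sum>i | i < N \<and> P i. word_sign (\<lambda>i. i \<in> X) P i * t i)"

lemma stack_sum_cong:
  assumes "\<And>i. i < N \<Longrightarrow> P i = Q i"
  shows "stack_sum X t P = stack_sum X t Q"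
  unfolding stack_sum_def
proof (rule sum.cong)
  show "{i. i < N \<and> P i} = {i. i < N \<and> Q i}" using assms by auto
  fix i assume "i \<in> {i. i < N \<and> Q i}"
  then have "{j. j < i \<and> P j \<and> j \<in> X} = {j. j < i \<and> Q j \<and> j \<in> X}" using assms by auto
  then show "word_sign (\<lambda>i. i \<in> X) P i * t i = word_sign (\<lambda>i. i \<in> X) Q i * t i" by (simp add: word_sign_def)
qed

definition balance :: "nat set \<Rightarrow> (nat \<Rightarrow> int) \<Rightarrow> real \<Rightarrow> real \<Rightarrow> real \<Rightarrow> int" where
  "balance X t a b z = stack_sum X t (above True a b z) - stack_sum X t (above False a b z)"

text \<open>No reflection ends at this vertex, so its strands leave the signs in the rest of the
  stack unchanged, and their own contributions cancel by \<open>zero\<close>.\<close>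

lemma balance_step:
  assumes lev: "level a" and X: "inc (a, b, z) \<inter> X = {}"
    and zero: "(\<Sum>i\<in>inc (a, b, z). vertex_sign X (a, b, z) i * t i) = 0"
  shows "balance X t a b z
    = stack_sum X t (\<lambda>i. act True i a \<and> \<beta> i a = b \<and> \<zeta> i a > z)
      - stack_sum X t (\<lambda>i. act False i a \<and> \<beta> i a = b \<and> \<zeta> i a > z)"
proof -
  let ?v = "(a, b, z)"
  let ?gt = "\<lambda>s i. act s i a \<and> \<beta> i a = b \<and> \<zeta> i a > z"
  let ?w = "word_sign (\<lambda>i. i \<in> X)"
  have at: "act s i a \<and> \<beta> i a = b \<and> \<zeta> i a = z \<longleftrightarrow> endpt s i = ?v" if "i < N" for i s
    using at_level[OF lev that] .
  have sgn: "?w (above s a b z) i = ?w (?gt s) i" if "i < N" for s i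
  proof -
    have "{j. j < i \<and> above s a b z j \<and> j \<in> X} = {j. j < i \<and> ?gt s j \<and> j \<in> X}"
    proof (rule Collect_cong, rule conj_cong[OF HOL.refl])
      fix j assume j: "j < i"
      have "j \<in> inc (a, b, z)" if "endpt s j = (a, b, z)"
        using that j \<open>i < N\<close> by (auto simp: inc_def)
      then have "j \<in> X \<Longrightarrow> \<not> (act s j a \<and> \<beta> j a = b \<and> \<zeta> j a = z)"
        using at[of j s] X j \<open>i < N\<close> by auto
      then show "(above s a b z j \<and> j \<in> X) = (?gt s j \<and> j \<in> X)"
        by (auto simp: above_def)
    qed
    then show ?thesis by (simp add: word_sign_def)
  qed
  have split: "stack_sum X t (above s a b z)
      = stack_sum X t (?gt s) + (\<Sum>i | i < N \<and> endpt s i = ?v. end_sign X s i * t i)" for s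
  proof -
    have "above s a b z i \<longleftrightarrow> ?gt s i \<or> endpt s i = ?v" if "i < N" for i
      unfolding at[OF that, of s, symmetric] above_def by auto
    then have "{i. i < N \<and> above s a b z i} = {i. i < N \<and> ?gt s i} \<union> {i. i < N \<and> endpt s i = ?v}"
      by blast
    moreover have "{i. i < N \<and> ?gt s i} \<inter> {i. i < N \<and> endpt s i = ?v} = {}"
      using at[of _ s] by auto
    ultimately have "stack_sum X t (above s a b z)
      = (\<Sum>i | i < N \<and> ?gt s i. ?w (above s a b z) i * t i)
        + (\<Sum>i | i < N \<and> endpt s i = ?v. ?w (above s a b z) i * t i)"
      by (simp add: stack_sum_def sum.union_disjoint)
    also have "(\<Sum>i | i < N \<and> ?gt s i. ?w (above s a b z) i * t i) = stack_sum X t (?gt s)"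
      unfolding stack_sum_def by (rule sum.cong) (use sgn in auto)
    also have "(\<Sum>i | i < N \<and> endpt s i = ?v. ?w (above s a b z) i * t i)
        = (\<Sum>i | i < N \<and> endpt s i = ?v. end_sign X s i * t i)"
      by (rule sum.cong) (auto simp: end_sign_def)
    finally show ?thesis .
  qed
  have "inc ?v = {i. i < N \<and> endpt True i = ?v} \<union> {i. i < N \<and> endpt False i = ?v}"
    by (auto simp: inc_def) (metis (full_types))
  moreover have "{i. i < N \<and> endpt True i = ?v} \<inter> {i. i < N \<and> endpt False i = ?v} = {}"
    using endpt_neq by (auto simp: set_eq_iff) metis
  ultimately have "(\<Sum>i\<in>inc ?v. vertex_sign X ?v i * t i)
      = (\<Sum>i | i < N \<and> endpt True i = ?v. vertex_sign X ?v i * t i)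
        + (\<Sum>i | i < N \<and> endpt False i = ?v. vertex_sign X ?v i * t i)"
    by (simp add: sum.union_disjoint)
  also have "(\<Sum>i | i < N \<and> endpt True i = ?v. vertex_sign X ?v i * t i)
      = (\<Sum>i | i < N \<and> endpt True i = ?v. end_sign X True i * t i)"
    by (rule sum.cong) (auto simp: vertex_sign_def)
  also have "(\<Sum>i | i < N \<and> endpt False i = ?v. vertex_sign X ?v i * t i)
      = (\<Sum>i | i < N \<and> endpt False i = ?v. - (end_sign X False i * t i))"
    by (rule sum.cong) (use endpt_neq in \<open>force simp: vertex_sign_def\<close>)+
  finally show ?thesis
    using zero unfolding balance_def split by (simp add: sum_negf)
qed

text \<open>Descent from the top of the column: between successive heights nothing changes, and
  \<open>balance_step\<close> passes every vertex outside \<open>VX\<close>. This reduces the system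
  to one equation for each vertex in \<open>VX\<close>.\<close>

lemma balance_eq_0:
  assumes "\<And>z. (a, b, z) \<in> VX \<Longrightarrow> balance X t a b z = 0"
    and off: "\<And>v. v \<notin> VX \<Longrightarrow> inc v \<inter> X = {} \<and> (\<Sum>i\<in>inc v. vertex_sign X v i * t i) = 0"
  shows "balance X t a b z = 0"
proof (cases "level a")
  case False
  have "stack_sum X t (above True a b z) = stack_sum X t (above False a b z)"
    by (rule stack_sum_cong) (use act_not_level[OF False] in \<open>auto simp: above_def\<close>)
  then show ?thesis by (simp add: balance_def)
next
  case lev: True
  define H where "H = (\<lambda>i. \<zeta> i a) ` {i. i < N \<and> (\<exists>s. act s i a) \<and> \<beta> i a = b}"
  have finH: "finite H" by (simp add: H_def)
  let ?gt = "\<lambda>z s i. act s i a \<and> \<beta> i a = b \<and> \<zeta> i a > z"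
  have next_height: "stack_sum X t (?gt z True) - stack_sum X t (?gt z False) = 0"
    if IH: "\<And>h. h \<in> H \<Longrightarrow> h > z \<Longrightarrow> balance X t a b h = 0" for z
  proof (cases "{h\<in>H. h > z} = {}")
    case True
    have "stack_sum X t (?gt z s) = stack_sum X t (\<lambda>_. False)" for s
      by (rule stack_sum_cong) (use True in \<open>auto simp: H_def\<close>)
    then show ?thesis by simp
  next
    case False
    define h where "h = Min {h\<in>H. h > z}"
    have h: "h \<in> H" "h > z" using Min_in[OF _ False] finH by (auto simp: h_def)
    have h_le: "h \<le> k" if "k \<in> H" "k > z" for k using that finH by (auto simp: h_def intro: Min_le)
    have "stack_sum X t (?gt z s) = stack_sum X t (above s a b h)" for s
    proof (rule stack_sum_cong)
      fix i assume "i < N"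
      then show "?gt z s i = above s a b h i"
        using h(2) h_le[of "\<zeta> i a"] by (auto simp: above_def H_def)
    qed
    then show ?thesis using IH[OF h] by (simp add: balance_def)
  qed
  have inH: "balance X t a b h = 0" if "h \<in> H" for h
    using that
  proof (induction "card {k\<in>H. k > h}" arbitrary: h rule: less_induct)
    case less
    show ?case
    proof (cases "(a, b, h) \<in> VX")
      case False
      have "balance X t a b h
          = stack_sum X t (?gt h True) - stack_sum X t (?gt h False)"
        using off[OF False] by (intro balance_step[OF lev]) auto
      also have "\<dots> = 0"
      proof (rule next_height)
        fix k assume k: "k \<in> H" "k > h"
        then have "{j\<in>H. j > k} \<subset> {j\<in>H. j > h}" by auto
        then have "card {j\<in>H. j > k} < card {j\<in>H. j > h}"
          using finH by (intro psubset_card_mono) auto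
        then show "balance X t a b k = 0" by (rule less.hyps[OF _ k(1)])
      qed
      finally show ?thesis .
    qed (rule assms(1))
  qed
  show ?thesis
  proof (cases "z \<in> H")
    case True
    then show ?thesis by (rule inH)
  next
    case False
    have "stack_sum X t (above s a b z) = stack_sum X t (?gt z s)" for s
      by (rule stack_sum_cong) (use False in \<open>force simp: above_def H_def less_le\<close>)
    then show ?thesis using next_height inH by (simp add: balance_def)
  qed
qed

text \<open>At a level, each strand counted ends at a vertex of the column, on exactly one of the
  two sides. The vertices contribute an even total, so the two counts have equal parity. Away from
  levels both sides consist of the same strands.\<close>

lemma even_stack:
  assumes ev: "\<And>v. even (card (inc v \<inter> X))"
  shows "odd (card {j. j < N \<and> above True a b z j \<and> j \<in> X})
       = odd (card {j. j < N \<and> above False a b z j \<and> j \<in> X})"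
proof (cases "level a")
  case False
  have "{j. j < N \<and> above True a b z j \<and> j \<in> X} = {j. j < N \<and> above False a b z j \<and> j \<in> X}"
    using act_not_level[OF False] by (auto simp: above_def)
  then show ?thesis by simp
next
  case lev: True
  let ?U = "\<lambda>s. {j. j < N \<and> above s a b z j \<and> j \<in> X}"
  define Z where "Z = {h \<in> (\<lambda>i. \<zeta> i a) ` {..<N}. h \<ge> z}"
  have ab: "above s a b z j \<longleftrightarrow> (\<exists>h\<in>Z. endpt s j = (a, b, h))" if "j < N" for j s
    unfolding above_def Z_def using at_level[OF lev that, of s b] that
    by (metis (mono_tags, lifting) imageI lessThan_iff mem_Collect_eq)
  have disj: "?U True \<inter> ?U False = {}"
  proof -
    have False if "j < N" "above True a b z j" "above False a b z j" for j
      using that lr[of j] act_level[OF lev that(1), of True] act_level[OF lev that(1), of False]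
      by (simp add: above_def)
    then show ?thesis by auto
  qed
  have un: "?U True \<union> ?U False = (\<Union>h\<in>Z. inc (a, b, h) \<inter> X)"
    using ab by (auto simp: inc_def) (metis (full_types))+
  have "card (\<Union>h\<in>Z. inc (a, b, h) \<inter> X) = (\<Sum>h\<in>Z. card (inc (a, b, h) \<inter> X))"
  proof (rule card_UN_disjoint)
    show "\<forall>h\<in>Z. \<forall>k\<in>Z. h \<noteq> k \<longrightarrow> (inc (a, b, h) \<inter> X) \<inter> (inc (a, b, k) \<inter> X) = {}"
    proof (intro ballI impI)
      fix h k :: real assume "h \<noteq> k"
      have False if "j < N" "endpt s j = (a, b, h)" "endpt s' j = (a, b, k)" for j s s'
      proof -
        have "fst (endpt s j) = fst (endpt s' j)" using that by simp
        then have "s = s'" using lr[OF that(1)] by (auto simp: endpt_def Let_def split: if_splits)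
        then show False using that \<open>h \<noteq> k\<close> by simp
      qed
      then show "(inc (a, b, h) \<inter> X) \<inter> (inc (a, b, k) \<inter> X) = {}" by (auto simp: inc_def)
    qed
  qed (auto simp: Z_def finite_inc)
  also have "even \<dots>" using ev by (intro dvd_sum) auto
  finally have "even (card (?U True \<union> ?U False))" unfolding un .
  moreover have "card (?U True \<union> ?U False) = card (?U True) + card (?U False)"
    by (rule card_Un_disjoint[OF _ _ disj]) auto
  ultimately show ?thesis by simp
qed

text \<open>The flips of both products agree by parity, which leaves the shifts.\<close>

lemma above_relation_iff:
  assumes "\<And>v. even (card (inc v \<inter> X))"
  shows "above_relation (\<lambda>i. Aff (i \<in> X) (t i)) a b z
     \<longleftrightarrow> balance X t a b z = 0"
  using even_stack[OF assms, of a b z] by (simp add: wsum_Aff balance_def stack_sum_def)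

lemma ex_low: "\<exists>z. \<forall>i<N. \<zeta> i a > z"
proof -
  have "bdd_below ((\<lambda>i. \<zeta> i a) ` {..<N})" by (intro bdd_below_finite) auto
  then obtain m where "\<And>i. i < N \<Longrightarrow> m \<le> \<zeta> i a" unfolding bdd_below_def by auto
  then show ?thesis by (intro exI[of _ "m - 1"]) force
qed

lemma full_relation:
  assumes "\<And>z. above_relation g a b z"
  shows "column g True a b = column g False a b"
proof -
  obtain z where z: "\<And>i. i < N \<Longrightarrow> \<zeta> i a > z" using ex_low by blast
  have "wsum g (above s a b z) N = column g s a b" for s
    by (rule wsum_cong) (use z in \<open>auto simp: above_def intro: less_imp_le\<close>)
  then show ?thesis using assms[of z] by metis
qed

lemma stack_relation:
  assumes "\<And>z. above_relation g a b z" "(a, b, z) \<notin> link"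
  shows "stack g True a b z = stack g False a b z"
proof -
  have "stack g s a b z = wsum g (above s a b z) N" for s
    unfolding stack_def
  proof (rule wsum_cong)
    fix i assume "i < N"
    then show "(act s i a \<and> \<beta> i a = b \<and> z < \<zeta> i a) = above s a b z i"
      using act_link[of i s a] assms(2) by (auto simp: above_def less_le)
  qed
  then show ?thesis using assms(1)[of z] by metis
qed

text \<open>\<open>X\<close> are the strands coloured by reflections, \<open>E\<close> those coloured by translations. There is one
  unknown for every strand of \<open>X\<close> and one more for \<open>E\<close>, but the relation at the vertex \<open>v0\<close> is
  implied by the others; it is replaced by the normalization that \<open>i0\<close> has colour \<open>x \<mapsto> - x\<close>.\<close>

lemma dihedral_colouring_aux:
  assumes X: "X \<subseteq> {..<N}" "card VX = card X" "finite VX"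
    and incX: "\<And>v. v \<in> VX \<Longrightarrow> inc v \<subseteq> X \<and> card (inc v) = 2"
    and endX: "\<And>i s. i \<in> X \<Longrightarrow> endpt s i \<in> VX"
    and i0: "i0 \<in> X" and clean: "endpt s0 i0 = (a0, b0, z0)"
      "\<And>j s. j < N \<Longrightarrow> act s j a0 \<Longrightarrow> \<beta> j a0 = b0 \<Longrightarrow> \<zeta> j a0 = z0"
    and E: "cyclic_chain E V" "E \<inter> X = {}" and mono: "monodromy E X = 1"
  obtains t where
    "\<And>a b z. above_relation (\<lambda>i. Aff (i \<in> X) (t i)) a b z"
    "t i0 = 0" "\<And>d. (\<And>i. i < N \<Longrightarrow> d dvd t i) \<Longrightarrow> is_unit d"
proof -
  obtain u where u: "\<And>i. i \<in> E \<Longrightarrow> u i = 1 \<or> u i = - 1"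
    and uV: "\<And>v. v \<in> V \<Longrightarrow> (\<Sum>i\<in>inc v. vertex_sign X v i * u i) = 0"
    using translation_pattern[OF E(1) mono] by metis
  have EN: "E \<subseteq> {..<N}" "E \<noteq> {}" using E(1) by (auto simp: cyclic_chain_def)
  have finX: "finite X" using X(1) finite_subset by auto
  have finE: "finite E" using EN(1) finite_subset by auto
  let ?v0 = "(a0, b0, z0)"
  have v0: "?v0 \<in> VX" using endX[OF i0, of s0] clean(1) by simp
  have offX: "inc v \<inter> X = {}" if "v \<notin> VX" for v
    using endX that by (auto simp: inc_def)
  have ev: "even (card (inc v \<inter> X))" for v
  proof (cases "v \<in> VX")
    case True
    then have "inc v \<inter> X = inc v" using incX by blast
    then show ?thesis using incX[OF True] by simp
  qed (simp add: offX)
  \<comment> \<open>Index \<open>N\<close> belongs to no strand and carries the common translation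
    length; the pattern \<open>u\<close> supplies its sign on each strand of
    \<open>E\<close>.\<close>
  define T where "T x i = (if i \<in> X then x i else if i \<in> E then x N * u i else 0)" for x :: "nat \<Rightarrow> int" and i
  let ?w = "\<lambda>s v i. (case v of (a, b, z) \<Rightarrow>
      if above s a b z i then word_sign (\<lambda>i. i \<in> X) (above s a b z) i else 0)"
  define \<kappa> where "\<kappa> v i = ?w True v i - ?w False v i" for v i
  have stack_sum_eq: "stack_sum X t (above s a b z) = (\<Sum>i<N. ?w s (a, b, z) i * t i)" for s t a b z
    unfolding stack_sum_def by (rule sum.mono_neutral_cong_left) auto
  have balance_eq: "balance X t a b z = (\<Sum>i<N. \<kappa> (a, b, z) i * t i)" for t a b z
    by (simp add: balance_def stack_sum_eq \<kappa>_def sum_subtractf algebra_simps del: prod.case)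
  \<comment> \<open>The row of \<open>v0\<close> is replaced by the equation
    \<open>x i0 = 0\<close>.\<close>
  define c where "c v i = (if v = ?v0 then (if i = i0 then 1 else 0)
      else if i = N then (\<Sum>k\<in>E. \<kappa> v k * u k) else \<kappa> v i)" for v i
  have NX: "N \<notin> X" using X(1) by auto
  have lin: "(\<Sum>i\<in>insert N X. c (a, b, z) i * x i) = balance X (T x) a b z" if "(a, b, z) \<noteq> ?v0" for a b z x
  proof -
    let ?v = "(a, b, z)"
    have "balance X (T x) a b z = (\<Sum>i\<in>X \<union> E. \<kappa> ?v i * T x i)"
      unfolding balance_eq by (rule sum.mono_neutral_right) (use X(1) EN in \<open>auto simp: T_def\<close>)
    also have "\<dots> = (\<Sum>i\<in>X. \<kappa> ?v i * T x i) + (\<Sum>i\<in>E. \<kappa> ?v i * T x i)"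
      using finX finE E(2) by (intro sum.union_disjoint) auto
    also have "(\<Sum>i\<in>X. \<kappa> ?v i * T x i) = (\<Sum>i\<in>X. c ?v i * x i)"
      by (rule sum.cong) (use that NX in \<open>auto simp: T_def c_def\<close>)
    also have "(\<Sum>i\<in>E. \<kappa> ?v i * T x i) = (\<Sum>i\<in>E. \<kappa> ?v i * u i) * x N"
      unfolding sum_distrib_right by (rule sum.cong) (use E(2) in \<open>auto simp: T_def\<close>)
    also have "\<dots> = c ?v N * x N"
    proof -
      have "c ?v N = (\<Sum>i\<in>E. \<kappa> ?v i * u i)" unfolding c_def using that by (simp only: if_False if_True HOL.refl)
      then show ?thesis by simp
    qed
    finally have "balance X (T x) a b z = (\<Sum>i\<in>X. c ?v i * x i) + c ?v N * x N" .
    moreover have "(\<Sum>i\<in>insert N X. c ?v i * x i) = c ?v N * x N + (\<Sum>i\<in>X. c ?v i * x i)"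
      using finX NX by (rule sum.insert)
    ultimately show ?thesis by simp
  qed
  \<comment> \<open>\<open>VX\<close> has as many elements as \<open>X\<close>, so the unknown at
    \<open>N\<close> is the surplus one.\<close>
  obtain x where gcd: "\<And>d. (\<And>i. i \<in> insert N X \<Longrightarrow> d dvd x i) \<Longrightarrow> is_unit d"
    and x: "\<And>v. v \<in> VX \<Longrightarrow> (\<Sum>i\<in>insert N X. c v i * x i) = 0"
    by (rule int_homogeneous_primitive_solution[of VX "insert N X" c]) (use X finX NX in auto)
  define t where "t = T x"
  let ?g = "\<lambda>i. Aff (i \<in> X) (t i)"
  have off: "inc v \<inter> X = {} \<and> (\<Sum>i\<in>inc v. vertex_sign X v i * t i) = 0" if v: "v \<notin> VX" for v
  proof -
    have "(\<Sum>i\<in>inc v. vertex_sign X v i * t i) = 0"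
    proof (cases "v \<in> V")
      case True
      have "inc v \<subseteq> E" by (rule cyclic_chain_card(5)[OF E(1) True])
      then have "(\<Sum>i\<in>inc v. vertex_sign X v i * t i) = (\<Sum>i\<in>inc v. vertex_sign X v i * u i) * x N"
        unfolding sum_distrib_right using E(2) by (intro sum.cong) (auto simp: t_def T_def)
      then show ?thesis using uV[OF True] by simp
    next
      case False
      then have "inc v \<inter> E = {}" using cyclic_chain_card(6)[OF E(1)] by (auto simp: inc_def)
      then show ?thesis using offX[OF v] by (intro sum.neutral) (auto simp: t_def T_def)
    qed
    then show ?thesis using offX[OF v] by blast
  qed
  \<comment> \<open>Away from the column of \<open>v0\<close> all vertices have their true equation
    among those solved.\<close>
  have rel: "above_relation ?g a b z" if "(a, b) \<noteq> (a0, b0)" for a b z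
    unfolding above_relation_iff[OF ev]
  proof (rule balance_eq_0[OF _ off])
    fix h assume "(a, b, h) \<in> VX"
    then show "balance X t a b h = 0" using x[of "(a, b, h)"] lin[of a b h x] that by (auto simp: t_def)
  qed
  have grouped: "row ?g True a = row ?g False a" if "a \<noteq> a0" for a
    using wsum_act_grouped[of UNIV ?g a] full_relation[of ?g a] rel that by simp
  obtain m where m: "m > 0" "box_bound m" using ex_box_bound by blast
  have no_act: "\<not> act s i a" if "i < N" "\<bar>a\<bar> \<ge> m" for s i a
    using m(2) act_link[OF that(1)] that(2) by (fastforce simp: box_bound_def)
  \<comment> \<open>On either side of \<open>a0\<close> all relations hold, so the row keeps the
    trivial value it has beyond the link. The rows at \<open>a0\<close> itself then follow from
    neighbouring abscissae.\<close>
  have total: "row ?g s a = 0" if "a \<noteq> a0" for s a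
  proof (cases "a < a0")
    case True
    show ?thesis
      by (rule wsum_act_total[of "{..<a0}" ?g "- (\<bar>m\<bar> + \<bar>a0\<bar> + 1)"])
         (use True grouped no_act in auto)
  next
    case False
    show ?thesis
      by (rule wsum_act_total[of "{a0<..}" ?g "\<bar>m\<bar> + \<bar>a0\<bar> + 1"])
         (use False that grouped no_act in auto)
  qed
  have total0: "row ?g s a0 = 0" for s
  proof -
    obtain U where U: "open U" "a0 \<in> U"
      "\<And>a. a \<in> U \<Longrightarrow> \<forall>i<N. \<forall>s. a \<noteq> a0 \<longrightarrow> act s i a = act (a < a0) i a0"
      using eventually_nhdsE[OF act_near[of a0]] by metis
    obtain e where e: "e > 0" "ball a0 e \<subseteq> U" using U(1,2) open_contains_ball by blast
    define a where "a = (if s then a0 - e / 2 else a0 + e / 2)"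
    have a: "a \<in> U" "a \<noteq> a0" "(a < a0) = s" using e by (auto simp: a_def dist_real_def subset_iff)
    have "row ?g s a0 = row ?g s a"
      by (rule wsum_cong) (use U(3)[OF a(1)] a in simp)
    then show ?thesis using total[OF a(2)] by simp
  qed
  have "column ?g True a0 b0 = column ?g False a0 b0"
    by (rule stack_relation_redundant[OF _ total0]) (use full_relation rel in blast)
  \<comment> \<open>By cleanness every strand of this column is at height \<open>z0\<close>, so the
    relation of the whole column is the one missing at \<open>v0\<close>.\<close>
  moreover have "column ?g s a0 b0 = wsum ?g (above s a0 b0 z0) N" for s
    by (rule wsum_cong) (use clean(2) in \<open>auto simp: above_def\<close>)
  ultimately have bal0: "balance X t a0 b0 z0 = 0"
    unfolding above_relation_iff[OF ev, symmetric] by simp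
  show ?thesis
  proof
    fix a b z
    show "above_relation ?g a b z"
      unfolding above_relation_iff[OF ev]
    proof (rule balance_eq_0[OF _ off])
      fix h assume "(a, b, h) \<in> VX"
      then show "balance X t a b h = 0"
        using x[of "(a, b, h)"] lin[of a b h x] bal0 by (cases "(a, b, h) = ?v0") (auto simp: t_def)
    qed
  next
    have "(\<Sum>i\<in>insert N X. c ?v0 i * x i) = (\<Sum>i\<in>insert N X. if i = i0 then x i else 0)"
      by (rule sum.cong) (auto simp: c_def)
    also have "\<dots> = x i0" using finX i0 by (simp add: sum.delta)
    finally show "t i0 = 0" using x[OF v0] i0 by (simp add: t_def T_def)
  next
    fix d assume d: "\<And>i. i < N \<Longrightarrow> d dvd t i"
    obtain k where k: "k \<in> E" using EN by blast
    show "is_unit d"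
    proof (rule gcd)
      fix i assume "i \<in> insert N X"
      moreover have "d dvd x N"
      proof -
        have "k < N" "k \<notin> X" using k EN(1) E(2) by blast+
        then have "d dvd x N * u k" using d[of k] k by (simp add: t_def T_def)
        then show ?thesis using u[OF k] by auto
      qed
      moreover have "d dvd x i" if "i \<in> X" using d[of i] that X(1) by (auto simp: t_def T_def)
      ultimately show "d dvd x i" by blast
    qed
  qed
qed

text \<open>If neither \<open>E1\<close> nor \<open>E2\<close> has monodromy \<open>1\<close> along
  \<open>E3\<close>, both have \<open>- 1\<close> and their union has the product \<open>1\<close>.
  For the union, \<open>V1 \<inter> V2 = {}\<close> keeps the numbers of vertices and strands
  equal.\<close>

lemma dihedral_colouring:
  assumes cyc: "cyclic_chain E1 V1" "cyclic_chain E2 V2" "cyclic_chain E3 V3"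
    and disj: "E1 \<inter> E2 = {}" "E1 \<inter> E3 = {}" "E2 \<inter> E3 = {}" "V1 \<inter> V2 = {}"
    and clean: "clean"
  shows "\<exists>s t i0. (\<forall>a b z. above_relation (\<lambda>i. Aff (s i) (t i)) a b z) \<and>
      i0 < N \<and> s i0 \<and> t i0 = 0 \<and> (\<forall>d. (\<forall>i<N. d dvd t i) \<longrightarrow> is_unit d)"
proof -
  note c1 = cyclic_chain_card[OF cyc(1)] and c2 = cyclic_chain_card[OF cyc(2)]
  have EN: "E1 \<subseteq> {..<N}" "E2 \<subseteq> {..<N}" "E1 \<noteq> {}" "E2 \<noteq> {}" using cyc by (auto simp: cyclic_chain_def)
  have "\<exists>X VX. X \<subseteq> {..<N} \<and> X \<noteq> {} \<and> card VX = card X \<and> finite VX \<and>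
      (\<forall>v\<in>VX. inc v \<subseteq> X \<and> card (inc v) = 2) \<and> (\<forall>i\<in>X. \<forall>s. endpt s i \<in> VX) \<and>
      E3 \<inter> X = {} \<and> monodromy E3 X = 1"
  proof -
    consider "monodromy E3 E1 = 1" | "monodromy E3 E2 = 1" | "monodromy E3 (E1 \<union> E2) = 1"
      using monodromy_cases[of E3 E1] monodromy_cases[of E3 E2] monodromy_Un[OF disj(1), of E3] by auto
    then show ?thesis
    proof cases
      case 1
      then show ?thesis using EN c1 disj by (intro exI[of _ E1] exI[of _ V1]) blast
    next
      case 2
      then show ?thesis using EN c2 disj by (intro exI[of _ E2] exI[of _ V2]) blast
    next
      case 3
      have "card (V1 \<union> V2) = card (E1 \<union> E2)"
        using c1 c2 disj by (simp add: card_Un_disjoint)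
      moreover have "\<forall>v\<in>V1 \<union> V2. inc v \<subseteq> E1 \<union> E2 \<and> card (inc v) = 2"
        using c1(4,5) c2(4,5) by (metis UnE le_supI1 le_supI2)
      moreover have "\<forall>i\<in>E1 \<union> E2. \<forall>s. endpt s i \<in> V1 \<union> V2" using c1(6) c2(6) by blast
      ultimately show ?thesis
        using 3 EN c1(3) c2(3) disj(2,3)
        by (intro exI[of _ "E1 \<union> E2"] exI[of _ "V1 \<union> V2"]) (simp add: Int_Un_distrib Int_commute)
    qed
  qed
  then obtain X VX where X: "X \<subseteq> {..<N}" "X \<noteq> {}" "card VX = card X" "finite VX"
      "\<forall>v\<in>VX. inc v \<subseteq> X \<and> card (inc v) = 2" "\<forall>i\<in>X. \<forall>s. endpt s i \<in> VX"
      "E3 \<inter> X = {}" "monodromy E3 X = 1"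
    by (elim exE conjE) (rule that)
  obtain i0 where i0: "i0 \<in> X" using X(2) by blast
  then have "i0 < N" using X(1) by auto
  from clean[unfolded clean_def, rule_format, OF this] obtain s0 a0 b0 z0 where cl: "endpt s0 i0 = (a0, b0, z0)"
    "\<And>j s. j < N \<Longrightarrow> act s j a0 \<Longrightarrow> \<beta> j a0 = b0 \<Longrightarrow> \<zeta> j a0 = z0"
    by blast
  obtain t where t:
    "\<And>a b z. above_relation (\<lambda>i. Aff (i \<in> X) (t i)) a b z"
    "t i0 = 0" "\<And>d. (\<And>i. i < N \<Longrightarrow> d dvd t i) \<Longrightarrow> is_unit d"
    by (rule dihedral_colouring_aux[OF X(1,3,4) X(5)[rule_format] X(6)[rule_format] i0 cl cyc(3) X(7,8)]) blast+
  show ?thesis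
    by (intro exI[of _ "\<lambda>i. i \<in> X"] exI[of _ t] exI[of _ i0]) (use t i0 \<open>i0 < N\<close> in auto)
qed

end


section \<open>Circles as cyclic chains of strands\<close>

lemma simple_closed_path_circle:
  fixes C :: "'a::topological_space set"
  assumes "C homeomorphic sphere (0::real^2) 1"
  obtains \<gamma> where "simple_path \<gamma>" "path_image \<gamma> = C" "pathfinish \<gamma> = pathstart \<gamma>"
proof -
  define q where "q t = cis (2 * pi * t)" for t
  have q_img: "path_image q = sphere 0 1"
  proof (intro equalityI subsetI)
    fix z :: complex assume "z \<in> sphere 0 1"
    then have "z = exp (\<i> * of_real (Arg2pi z))" using Arg2pi_eq[of z] by simp
    then have "z = q (Arg2pi z / (2 * pi))" by (simp add: q_def cis_conv_exp)
    moreover have "Arg2pi z / (2 * pi) \<in> {0..1}"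
      using Arg2pi_ge_0[of z] Arg2pi_lt_2pi[of z] by (simp add: divide_le_eq)
    ultimately show "z \<in> path_image q" unfolding path_image_def by blast
  qed (auto simp: path_image_def q_def)
  have "path q" unfolding path_def q_def by (intro continuous_intros)
  moreover have "loop_free q"
    unfolding loop_free_def
  proof (intro ballI impI)
    fix x y :: real assume xy: "x \<in> {0..1}" "y \<in> {0..1}" "q x = q y"
    then have "sin (2 * pi * x) = sin (2 * pi * y) \<and> cos (2 * pi * x) = cos (2 * pi * y)"
      by (simp add: q_def complex_eq_iff)
    then obtain n :: int where "2 * pi * x = 2 * pi * y + 2 * pi * n"
      unfolding sin_cos_eq_iff by blast
    then have "2 * pi * (x - y - n) = 0" by (simp add: algebra_simps)
    then have n: "x = y + n" by simp
    then have "real_of_int n \<le> 1" "real_of_int n \<ge> - 1" using xy by auto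
    then have "n = 0 \<or> n = 1 \<or> n = - 1" by linarith
    then show "x = y \<or> x = 0 \<and> y = 1 \<or> x = 1 \<and> y = 0" using n xy by auto
  qed
  ultimately have q: "simple_path q" by (simp add: simple_path_def)
  have "sphere (0::real^2) 1 homeomorphic sphere (0::complex) 1"
    by (rule homeomorphic_spheres_gen) auto
  then have "sphere (0::complex) 1 homeomorphic C"
    using assms homeomorphic_trans homeomorphic_sym by blast
  then obtain h k where h: "homeomorphism (sphere (0::complex) 1) C h k" unfolding homeomorphic_def by blast
  show ?thesis
  proof
    show "simple_path (h \<circ> q)"
      by (rule simple_path_continuous_image[OF q])
         (use h in \<open>auto simp: q_img homeomorphism_def intro: inj_on_inverseI\<close>)
    show "path_image (h \<circ> q) = C" using h by (simp add: path_image_compose q_img homeomorphism_def)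
    show "pathfinish (h \<circ> q) = pathstart (h \<circ> q)"
      by (simp add: pathfinish_def pathstart_def q_def)
  qed
qed

lemma finite_real_enum:
  fixes T :: "real set"
  assumes "finite T" "0 \<in> T" "1 \<in> T" "T \<subseteq> {0..1}"
  shows "\<exists>(m::nat) \<tau>. \<tau> 0 = 0 \<and> \<tau> m = 1 \<and> (\<forall>i j. i < j \<longrightarrow> j \<le> m \<longrightarrow> \<tau> i < \<tau> j) \<and>
    T = \<tau> ` {..m} \<and> m > 0"
proof -
  define xs where "xs = sorted_list_of_set T"
  have xs: "set xs = T" "sorted xs" "distinct xs" using assms(1) by (auto simp: xs_def)
  have strict: "xs ! i < xs ! j" if "i < j" "j < length xs" for i j
    using sorted_nth_mono[OF xs(2), of i j] nth_eq_iff_index_eq[OF xs(3), of i j] that by force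
  have len: "length xs > 0" using assms(2) xs(1) by auto
  define m where "m = length xs - 1"
  have im: "T = (\<lambda>i. xs ! i) ` {..m}"
    using xs(1) len by (force simp: m_def set_conv_nth)
  have le: "xs ! 0 \<le> x \<and> x \<le> xs ! m" if x: "x \<in> T" for x
  proof -
    obtain i where i: "i \<le> m" "x = xs ! i" using x unfolding im by auto
    have "i < length xs" using i(1) len unfolding m_def by linarith
    then show ?thesis
      using i sorted_nth_mono[OF xs(2), of 0 i] sorted_nth_mono[OF xs(2), of i m] len
      by (simp add: m_def)
  qed
  have mem: "xs ! 0 \<in> T" "xs ! m \<in> T" using im by auto
  have ends: "xs ! 0 = 0" "xs ! m = 1"
    using le[OF assms(2)] le[OF assms(3)] mem assms(4) by force+
  have "m > 0" using ends by (cases m) auto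
  then show ?thesis
    using ends strict im len by (intro exI[of _ m] exI[of _ "\<lambda>i. xs ! i"]) (auto simp: m_def)
qed

context strand_diagram
begin

lemma endpt_in_strand: "i < N \<Longrightarrow> endpt s i \<in> strand i"
  using lr[of i] by (auto simp: strand_def endpt_def Let_def)

lemma strand_end_or_interior:
  assumes "i < N" "x \<in> strand i" "\<not> (l i < fst x \<and> fst x < r i)"
  shows "\<exists>s. x = endpt s i"
proof -
  obtain a where a: "a \<in> {l i..r i}" "x = (a, \<beta> i a, \<zeta> i a)" using assms(2) by (auto simp: strand_def)
  then have "a = l i \<or> a = r i" using assms(3) by auto
  then show ?thesis
  proof
    assume "a = l i"
    then show ?thesis using a by (intro exI[of _ False]) (simp add: endpt_def Let_def)
  next
    assume "a = r i"
    then show ?thesis using a by (intro exI[of _ True]) (simp add: endpt_def Let_def)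
  qed
qed

lemma strand_inter:
  assumes "i < N" "j < N" "x \<in> strand i" "x \<in> strand j" "i \<noteq> j"
  shows "\<exists>s. x = endpt s i"
proof (rule strand_end_or_interior[OF assms(1,3)], rule notI)
  assume int: "l i < fst x \<and> fst x < r i"
  have "\<beta> i (fst x) = \<beta> j (fst x)" "l j \<le> fst x" "fst x \<le> r j"
    using assms(3,4) by (auto simp: strand_def)
  then show False
    using slab[OF assms(1,2)] int order[of i j "fst x"] order[of j i "fst x"] assms(1,2,5)
    by (auto simp: neq_iff)
qed

lemma endpt_on_strand:
  assumes "i < N" "j < N" "endpt s i \<in> strand j"
  shows "\<exists>s'. endpt s i = endpt s' j"
  using strand_inter[OF assms(2,1,3) endpt_in_strand[OF assms(1)]] assms
  by (cases "i = j") auto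

lemma strand_fst_inject: "x \<in> strand i \<Longrightarrow> y \<in> strand i \<Longrightarrow> fst x = fst y \<Longrightarrow> x = y"
  by (auto simp: strand_def)

text \<open>A closed parametrization starting at a vertex is cut at the finitely many parameters of
  vertices. Between two cuts it stays on one strand, because strands meet only at ends, and runs
  over it from end to end; the order of traversal is the chain.\<close>

lemma cyclic_chain_component:
  assumes C: "C \<in> components link" and circ: "C homeomorphic sphere (0::real^2) 1"
  shows "cyclic_chain {i. i < N \<and> strand i \<subseteq> C} {endpt s i | s i. i < N \<and> strand i \<subseteq> C}"
proof -
  define E where "E = {i. i < N \<and> strand i \<subseteq> C}"
  define V where "V = {endpt s i | s i. i < N \<and> strand i \<subseteq> C}"
  have sub: "strand i \<subseteq> C" if "i < N" "x \<in> strand i" "x \<in> C" for i x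
    using components_maximal[OF C strand_compact_connected(2)[OF that(1)]] that by (auto simp: link_def)
  have C_link: "C \<subseteq> link" using C in_components_subset by blast
  have ex_strand: "\<exists>i\<in>E. x \<in> strand i" if x: "x \<in> C" for x
  proof -
    obtain i where "i < N" "x \<in> strand i" using x C_link unfolding link_def by blast
    then have "i \<in> E" using sub[of i x] x by (simp add: E_def)
    then show ?thesis using \<open>x \<in> strand i\<close> by blast
  qed
  have "C \<noteq> {}" using C in_components_nonempty by blast
  then have E_ne: "E \<noteq> {}" using ex_strand by blast
  have finE: "finite E" by (simp add: E_def)
  have "V \<subseteq> endpt True ` E \<union> endpt False ` E"
  proof
    fix v assume "v \<in> V"
    then obtain s i where "v = endpt s i" "i \<in> E" by (auto simp: V_def E_def)
    then show "v \<in> endpt True ` E \<union> endpt False ` E" by (cases s) auto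
  qed
  then have finV: "finite V" using finE finite_subset by blast
  have VC: "V \<subseteq> C" using endpt_in_strand by (auto simp: V_def)
  have cl: "i \<in> E" if "i < N" "endpt s i \<in> V" for i s
    using sub[OF that(1) endpt_in_strand[OF that(1)]] VC that by (auto simp: E_def)
  have V_strand: "\<exists>s. v = endpt s i" if v: "v \<in> V" "v \<in> strand i" "i < N" for v i
  proof -
    obtain s k where "v = endpt s k" "k < N" using v(1) by (auto simp: V_def)
    then show ?thesis using endpt_on_strand[OF _ v(3), of k s] v(2) by simp
  qed
  have E_inter: "i = k" if "i \<in> E" "k \<in> E" "x \<in> strand i" "x \<in> strand k" "x \<notin> V" for i k x
    using strand_inter[of i k x] that by (auto simp: E_def V_def)
  obtain \<gamma>0 where \<gamma>0: "simple_path \<gamma>0" "path_image \<gamma>0 = C" "pathfinish \<gamma>0 = pathstart \<gamma>0"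
    by (rule simple_closed_path_circle[OF circ])
  obtain i0 where "i0 \<in> E" using E_ne by blast
  then have v0: "endpt True i0 \<in> V" by (auto simp: E_def V_def)
  then have "endpt True i0 \<in> path_image \<gamma>0" using VC \<gamma>0(2) by blast
  then obtain c where c: "c \<in> {0..1}" "\<gamma>0 c = endpt True i0"
    unfolding path_image_def by (metis imageE)
  define \<gamma> where "\<gamma> = shiftpath c \<gamma>0"
  have \<gamma>: "simple_path \<gamma>" "path_image \<gamma> = C" "\<gamma> 0 = endpt True i0" "\<gamma> 1 = \<gamma> 0"
    using \<gamma>0 c simple_path_shiftpath[of \<gamma>0 c] path_image_shiftpath[of c \<gamma>0]
      pathstart_shiftpath[of c \<gamma>0] pathfinish_shiftpath[of c \<gamma>0]
    by (auto simp: \<gamma>_def pathstart_def pathfinish_def)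
  have cont: "continuous_on {0..1} \<gamma>" using \<gamma>(1) by (simp add: simple_path_def path_def)
  have inj: "x = y \<or> x = 0 \<and> y = 1 \<or> x = 1 \<and> y = 0"
    if "x \<in> {0..1}" "y \<in> {0..1}" "\<gamma> x = \<gamma> y" for x y
    using \<gamma>(1) that by (auto simp: simple_path_def loop_free_def)
  have \<gamma>C: "\<gamma> t \<in> C" if "t \<in> {0..1}" for t using \<gamma>(2) that by (auto simp: path_image_def)
  have onto: "\<exists>t\<in>{0..<1}. \<gamma> t = x" if x: "x \<in> C" for x
  proof -
    have "x \<in> \<gamma> ` {0..1}" using x \<gamma>(2) by (simp add: path_image_def)
    then obtain t where t: "t \<in> {0..1}" "x = \<gamma> t" by auto
    show ?thesis
    proof (cases "t = 1")
      case True
      then show ?thesis using t \<gamma>(4) by (intro bexI[of _ 0]) auto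
    qed (use t in auto)
  qed
  define T where "T = {t \<in> {0..1}. \<gamma> t \<in> V}"
  have "inj_on \<gamma> {0..<1}" using inj by (fastforce simp: inj_on_def)
  then have "finite (\<gamma> -` V \<inter> {0..<1})" using finV by (simp add: finite_vimage_IntI)
  then have "finite (insert 1 (\<gamma> -` V \<inter> {0..<1}))" by simp
  then have finT: "finite T" by (rule finite_subset[rotated]) (auto simp: T_def)
  have T01: "0 \<in> T" "1 \<in> T" "T \<subseteq> {0..1}" using \<gamma> v0 by (auto simp: T_def)
  from finite_real_enum[OF finT T01] obtain m :: nat and \<tau> where \<tau>: "\<tau> 0 = 0" "\<tau> m = 1"
    "\<forall>i j. i < j \<longrightarrow> j \<le> m \<longrightarrow> \<tau> i < \<tau> j" "T = \<tau> ` {..m}" "m > 0"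
    by (elim exE conjE)
  note \<tau> = \<tau>(1,2) \<tau>(3)[rule_format] \<tau>(4,5)
  have \<tau>_le: "\<tau> i \<le> \<tau> j" if "i \<le> j" "j \<le> m" for i j
    using \<tau>(3)[of i j] that by (cases "i = j") auto
  have \<tau>01: "\<tau> i \<in> {0..1}" if "i \<le> m" for i using that T01(3) \<tau>(4) by auto
  have gap: "\<gamma> t \<notin> V" if "j < m" "\<tau> j < t" "t < \<tau> (Suc j)" for j t
  proof
    assume "\<gamma> t \<in> V"
    moreover have "t \<in> {0..1}" using \<tau>01[of j] \<tau>01[of "Suc j"] that by auto
    ultimately have "t \<in> \<tau> ` {..m}" using \<tau>(4) by (auto simp: T_def)
    then obtain k where k: "k \<le> m" "t = \<tau> k" by auto
    then show False
      using \<tau>_le[of k j] \<tau>_le[of "Suc j" k] that by (cases "k \<le> j") auto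
  qed
  have arc: "\<exists>i\<in>E. {endpt False i, endpt True i} = {\<gamma> (\<tau> j), \<gamma> (\<tau> (Suc j))} \<and> \<gamma> ` {\<tau> j..\<tau> (Suc j)} = strand i"
    if j: "j < m" for j
  proof -
    let ?p = "\<tau> j" and ?q = "\<tau> (Suc j)"
    have pq: "?p < ?q" "0 \<le> ?p" "?q \<le> 1" using \<tau>(3)[of j "Suc j"] \<tau>01[of j] \<tau>01[of "Suc j"] j by auto
    define h where "h = (?p + ?q) / 2"
    have h: "?p < h" "h < ?q" using pq by (auto simp: h_def)
    obtain i where i: "i \<in> E" "\<gamma> h \<in> strand i" using ex_strand[of "\<gamma> h"] \<gamma>C[of h] h pq by auto
    then have iN: "i < N" by (simp add: E_def)
    let ?J = "{?p<..<?q}"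
    have contJ: "continuous_on ?J \<gamma>" by (rule continuous_on_subset[OF cont]) (use pq in auto)
    define B where "B = (\<Union>k\<in>E - {i}. strand k)"
    have "closed (strand i)" using strand_compact_connected(1) iN compact_imp_closed by blast
    moreover have "closed B"
      unfolding B_def using finE strand_compact_connected(1) by (intro closed_UN) (auto simp: E_def compact_imp_closed)
    ultimately have cls: "closedin (top_of_set ?J) (?J \<inter> \<gamma> -` strand i)" "closedin (top_of_set ?J) (?J \<inter> \<gamma> -` B)"
      using contJ by (auto intro: continuous_closedin_preimage)
    have cover: "?J \<subseteq> (?J \<inter> \<gamma> -` strand i) \<union> (?J \<inter> \<gamma> -` B)"
    proof
      fix t assume t: "t \<in> ?J"
      then obtain k where "k \<in> E" "\<gamma> t \<in> strand k" using ex_strand[of "\<gamma> t"] \<gamma>C[of t] pq by auto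
      then show "t \<in> (?J \<inter> \<gamma> -` strand i) \<union> (?J \<inter> \<gamma> -` B)"
        using t by (cases "k = i") (auto simp: B_def)
    qed
    moreover have "(?J \<inter> \<gamma> -` strand i) \<inter> (?J \<inter> \<gamma> -` B) = {}"
    proof -
      have False if t: "t \<in> ?J" "\<gamma> t \<in> strand i" "k \<in> E - {i}" "\<gamma> t \<in> strand k" for t k
        using E_inter[OF i(1), of k "\<gamma> t"] gap[OF j, of t] t by auto
      then show ?thesis unfolding B_def by blast
    qed
    moreover have "?J \<inter> \<gamma> -` strand i \<noteq> {}" using h i(2) by auto
    ultimately have "?J \<inter> \<gamma> -` B = {}"
      using connected_closedin[of ?J] connected_Ioo[of ?p ?q] cls by metis
    then have J: "\<gamma> t \<in> strand i" if "t \<in> ?J" for t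
      using cover that by blast
    have "closure ?J \<subseteq> {t \<in> {?p..?q}. \<gamma> t \<in> strand i}"
    proof (rule closure_minimal)
      show "?J \<subseteq> {t \<in> {?p..?q}. \<gamma> t \<in> strand i}" using J by auto
      have "closed ({?p..?q} \<inter> \<gamma> -` strand i)"
        by (rule continuous_closed_preimage[OF continuous_on_subset[OF cont]])
           (use pq \<open>closed (strand i)\<close> in auto)
      then show "closed {t \<in> {?p..?q}. \<gamma> t \<in> strand i}" by (simp add: Int_def vimage_def)
    qed
    then have K: "\<gamma> t \<in> strand i" if "t \<in> {?p..?q}" for t using that pq by (auto simp: closure_greaterThanLessThan)
    have "\<gamma> ?p \<in> V" "\<gamma> ?q \<in> V" using \<tau>(4) j by (auto simp: T_def)
    then obtain s s' where ss: "\<gamma> ?p = endpt s i" "\<gamma> ?q = endpt s' i"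
      using V_strand[of "\<gamma> ?p" i] V_strand[of "\<gamma> ?q" i] K[of ?p] K[of ?q] pq iN by auto
    let ?\<alpha> = "\<lambda>t. fst (\<gamma> t)"
    have cont\<alpha>: "continuous_on {x..y} ?\<alpha>" if "0 \<le> x" "y \<le> 1" for x y
      by (rule continuous_on_fst, rule continuous_on_subset[OF cont]) (use that in auto)
    have \<alpha>_inj: "x = y" if "x \<in> ?J" "y \<in> ?J" "?\<alpha> x = ?\<alpha> y" for x y
    proof -
      have "\<gamma> x = \<gamma> y" using strand_fst_inject[of "\<gamma> x" i "\<gamma> y"] J that by auto
      then show ?thesis using inj[of x y] that pq by auto
    qed
    \<comment> \<open>A return to the same end would make the abscissa take the value halfway
      between those at \<open>h\<close> and at the end both before and after \<open>h\<close>, but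
      along a strand it determines the point.\<close>
    have "s \<noteq> s'"
    proof
      assume "s = s'"
      then have eq: "?\<alpha> ?p = ?\<alpha> ?q" using ss by simp
      have ne: "?\<alpha> h \<noteq> ?\<alpha> ?p"
      proof
        assume "?\<alpha> h = ?\<alpha> ?p"
        then have "\<gamma> h = \<gamma> ?p" using strand_fst_inject[of "\<gamma> h" i "\<gamma> ?p"] K[of h] K[of ?p] h by auto
        then show False using gap[OF j h] \<open>\<gamma> ?p \<in> V\<close> by simp
      qed
      define y where "y = (?\<alpha> h + ?\<alpha> ?p) / 2"
      have "\<exists>x. ?p \<le> x \<and> x \<le> h \<and> ?\<alpha> x = y"
        using IVT'[of ?\<alpha> ?p y h] IVT2'[of ?\<alpha> h y ?p] cont\<alpha>[of ?p h] h pq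
        by (cases "?\<alpha> ?p \<le> ?\<alpha> h") (auto simp: y_def)
      then obtain x1 where x1: "?p \<le> x1" "x1 \<le> h" "?\<alpha> x1 = y" by blast
      have "\<exists>x. h \<le> x \<and> x \<le> ?q \<and> ?\<alpha> x = y"
        using IVT'[of ?\<alpha> h y ?q] IVT2'[of ?\<alpha> ?q y h] cont\<alpha>[of h ?q] h pq eq
        by (cases "?\<alpha> ?p \<le> ?\<alpha> h") (auto simp: y_def)
      then obtain x2 where x2: "h \<le> x2" "x2 \<le> ?q" "?\<alpha> x2 = y" by blast
      have "y \<noteq> ?\<alpha> h" "y \<noteq> ?\<alpha> ?p" using ne by (auto simp: y_def field_simps)
      then have "x1 \<in> ?J" "x2 \<in> ?J" "x1 < h" "h < x2" using x1 x2 h eq by (auto simp: less_le)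
      then show False using \<alpha>_inj[of x1 x2] x1 x2 by simp
    qed
    then have ends: "{endpt False i, endpt True i} = {\<gamma> ?p, \<gamma> ?q}"
      using ss by (cases s; cases s') auto
    have "strand i \<subseteq> \<gamma> ` {?p..?q}"
    proof
      fix x assume x: "x \<in> strand i"
      then have fx: "l i \<le> fst x" "fst x \<le> r i" by (auto simp: strand_def)
      have "{?\<alpha> ?p, ?\<alpha> ?q} = {l i, r i}"
        using \<open>s \<noteq> s'\<close> unfolding ss by (cases s; cases s') (auto simp: endpt_def Let_def)
      then have "\<exists>t. ?p \<le> t \<and> t \<le> ?q \<and> ?\<alpha> t = fst x"
        using IVT'[of ?\<alpha> ?p "fst x" ?q] IVT2'[of ?\<alpha> ?q "fst x" ?p] cont\<alpha>[of ?p ?q] pq fx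
        by (auto simp: doubleton_eq_iff)
      then obtain t where t: "t \<in> {?p..?q}" "?\<alpha> t = fst x" by auto
      then have "\<gamma> t = x" using strand_fst_inject[OF K[OF t(1)] x] by simp
      then show "x \<in> \<gamma> ` {?p..?q}" using t(1) by blast
    qed
    then have "\<gamma> ` {?p..?q} = strand i" using K by auto
    with i(1) ends show ?thesis by blast
  qed
  then obtain e where e: "\<And>j. j < m \<Longrightarrow> e j \<in> E"
    "\<And>j. j < m \<Longrightarrow> {endpt False (e j), endpt True (e j)} = {\<gamma> (\<tau> j), \<gamma> (\<tau> (Suc j))}"
    "\<And>j. j < m \<Longrightarrow> \<gamma> ` {\<tau> j..\<tau> (Suc j)} = strand (e j)"
    by metis
  define w where "w j = \<gamma> (\<tau> j)" for j
  have \<tau>lt1: "\<tau> j < 1" if "j < m" for j using \<tau>(2) \<tau>(3)[of j m] that by auto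
  have find: "\<exists>j<m. \<tau> j \<le> t \<and> t < \<tau> (Suc j)" if "t \<in> {0..<1}" for t
  proof -
    define k where "k = (LEAST k. t < \<tau> k)"
    have tm: "t < \<tau> m" using that \<tau>(2) by simp
    have k: "t < \<tau> k" "k \<le> m" using LeastI[of "\<lambda>k. t < \<tau> k", OF tm] Least_le[of "\<lambda>k. t < \<tau> k", OF tm] by (auto simp: k_def)
    have "k \<noteq> 0" using k(1) \<tau>(1) that by (cases k) auto
    then obtain j where j: "k = Suc j" by (cases k) auto
    then have "\<not> t < \<tau> j" using not_less_Least[of j "\<lambda>k. t < \<tau> k"] by (simp add: k_def)
    then show ?thesis using j k by (intro exI[of _ j]) auto
  qed
  have "bij_betw e {..<m} E"
    unfolding bij_betw_def
  proof
    show "inj_on e {..<m}"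
    proof (rule inj_onI)
      fix j k assume jk: "j \<in> {..<m}" "k \<in> {..<m}" "e j = e k"
      let ?h = "(\<tau> j + \<tau> (Suc j)) / 2"
      have h: "\<tau> j < ?h" "?h < \<tau> (Suc j)" using \<tau>(3)[of j "Suc j"] jk by auto
      have "\<gamma> ?h \<in> \<gamma> ` {\<tau> j..\<tau> (Suc j)}" using h by auto
      then have "\<gamma> ?h \<in> \<gamma> ` {\<tau> k..\<tau> (Suc k)}" using e(3)[of j] e(3)[of k] jk by simp
      then obtain t where t: "t \<in> {\<tau> k..\<tau> (Suc k)}" "\<gamma> ?h = \<gamma> t" by auto
      have "0 \<le> \<tau> j" "\<tau> (Suc j) \<le> 1" "0 \<le> \<tau> k" "\<tau> (Suc k) \<le> 1"
        using \<tau>01[of j] \<tau>01[of "Suc j"] \<tau>01[of k] \<tau>01[of "Suc k"] jk by auto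
      then have "t = ?h" using inj[of ?h t] t h by auto
      then have "\<tau> j < \<tau> (Suc k)" "\<tau> k < \<tau> (Suc j)" using t h by auto
      then show "j = k"
        using \<tau>_le[of "Suc k" j] \<tau>_le[of "Suc j" k] jk by (metis Suc_leI lessThan_iff less_imp_le_nat not_less not_less_iff_gr_or_eq)
    qed
    show "e ` {..<m} = E"
    proof (intro equalityI subsetI)
      fix i assume i: "i \<in> E"
      then have iN: "i < N" "strand i \<subseteq> C" by (auto simp: E_def)
      define a where "a = (l i + r i) / 2"
      have a: "l i < a" "a < r i" using lr[OF iN(1)] by (auto simp: a_def)
      let ?x = "(a, \<beta> i a, \<zeta> i a)"
      have x: "?x \<in> strand i" using a by (auto simp: strand_def)
      have xV: "?x \<notin> V"
      proof
        assume "?x \<in> V"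
        then obtain s where "?x = endpt s i" using V_strand x iN by blast
        then show False using a by (auto simp: endpt_def Let_def split: if_splits)
      qed
      obtain t where t: "t \<in> {0..<1}" "\<gamma> t = ?x" using onto x iN(2) by blast
      obtain j where j: "j < m" "\<tau> j \<le> t" "t < \<tau> (Suc j)" using find t(1) by blast
      have "\<gamma> t \<in> \<gamma> ` {\<tau> j..\<tau> (Suc j)}" using j by auto
      then have "?x \<in> strand (e j)" using e(3)[OF j(1)] t(2) by simp
      then have "i = e j" using E_inter[OF i e(1)[OF j(1)] x] xV by blast
      then show "i \<in> e ` {..<m}" using j(1) by auto
    qed (use e in auto)
  qed
  moreover have "bij_betw w {..<m} V"
    unfolding bij_betw_def
  proof
    show "inj_on w {..<m}"
    proof (rule inj_onI)
      fix j k assume jk: "j \<in> {..<m}" "k \<in> {..<m}" "w j = w k"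
      then have "\<tau> j = \<tau> k"
        using inj[of "\<tau> j" "\<tau> k"] \<tau>01[of j] \<tau>01[of k] \<tau>lt1[of j] \<tau>lt1[of k] by (auto simp: w_def)
      then show "j = k" using \<tau>(3)[of j k] \<tau>(3)[of k j] jk by (cases j k rule: linorder_cases) auto
    qed
    show "w ` {..<m} = V"
    proof (intro equalityI subsetI)
      fix v assume v: "v \<in> V"
      then obtain t where t: "t \<in> {0..<1}" "\<gamma> t = v" using onto VC by blast
      then have "t \<in> T" using v by (auto simp: T_def)
      then obtain j where j: "j \<le> m" "t = \<tau> j" using \<tau>(4) by auto
      then have "j < m" using t \<tau>(2) by (cases "j = m") auto
      then show "v \<in> w ` {..<m}" using j t by (auto simp: w_def)
    qed (use \<tau>(4) in \<open>auto simp: w_def T_def\<close>)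
  qed
  moreover have "{endpt False (e j), endpt True (e j)} = {w j, w (Suc j mod m)}" if "j < m" for j
  proof -
    have "w (Suc j mod m) = \<gamma> (\<tau> (Suc j))"
      using that \<gamma>(4) \<tau>(1,2) by (cases "Suc j = m") (auto simp: w_def)
    then show ?thesis using e(2)[OF that] by (simp add: w_def)
  qed
  ultimately have "\<exists>m e w. bij_betw e {..<m} E \<and> bij_betw w {..<m} V \<and>
        (\<forall>j<m. {endpt False (e j), endpt True (e j)} = {w j, w (Suc j mod m)})" by blast
  then have "cyclic_chain E V"
    using E_ne cl by (auto simp: cyclic_chain_def E_def)
  then show ?thesis by (simp add: E_def V_def)
qed

end


section \<open>Polygons in general position\<close>

text \<open>The tuple holds the interval of abscissae, then intercept and slope of the projection,
  then intercept and slope of the height.\<close>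

definition line_strand :: "real \<times> real \<times> real \<times> real \<times> real \<times> real \<Rightarrow> point set" where
  "line_strand = (\<lambda>(x, y, c, d, p, q). (\<lambda>a. (a, c + d * a, p + q * a)) ` {x..y})"

definition consecutive :: "real set \<Rightarrow> real \<Rightarrow> real \<Rightarrow> bool" where
  "consecutive A x y \<longleftrightarrow> x \<in> A \<and> y \<in> A \<and> x < y \<and> (\<forall>t\<in>A. t \<le> x \<or> y \<le> t)"

lemma ex_consecutive:
  assumes "finite A" "lo \<in> A" "hi \<in> A" "lo < hi" "lo \<le> a" "a \<le> hi"
  obtains x y where "consecutive A x y" "lo \<le> x" "x \<le> a" "a \<le> y" "y \<le> hi"
proof -
  define x where "x = (if a = hi then Max {t\<in>A. t < hi} else Max {t\<in>A. t \<le> a})"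
  have x: "x \<in> A \<and> x < hi \<and> x \<le> a \<and> lo \<le> x \<and> (\<forall>t\<in>A. t < hi \<longrightarrow> t \<le> a \<longrightarrow> t \<le> x)"
  proof (cases "a = hi")
    case True
    have ne: "{t\<in>A. t < hi} \<noteq> {}" using assms by auto
    have fin: "finite {t\<in>A. t < hi}" using assms(1) by simp
    show ?thesis using Max_in[OF fin ne] Max_ge[OF fin] True assms by (auto simp: x_def)
  next
    case False
    have ne: "{t\<in>A. t \<le> a} \<noteq> {}" using assms by auto
    have fin: "finite {t\<in>A. t \<le> a}" using assms(1) by simp
    show ?thesis using Max_in[OF fin ne] Max_ge[OF fin] False assms by (auto simp: x_def)
  qed
  define y where "y = Min {t\<in>A. x < t}"
  have ne: "{t\<in>A. x < t} \<noteq> {}" using x assms(3) by auto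
  have fin: "finite {t\<in>A. x < t}" using assms(1) by simp
  have y: "y \<in> A" "x < y" and y_le: "\<And>t. t \<in> A \<Longrightarrow> x < t \<Longrightarrow> y \<le> t"
    using Min_in[OF fin ne] Min_le[OF fin] by (auto simp: y_def)
  have "y \<le> hi" using y_le assms(3) x by blast
  moreover have "a \<le> y"
  proof (rule ccontr)
    assume "\<not> a \<le> y"
    then have "y \<le> x" using x y assms(6) by auto
    then show False using y by simp
  qed
  moreover have "consecutive A x y" unfolding consecutive_def using x y y_le by force
  ultimately show ?thesis using that x by blast
qed

lemma affine_nonzero_sign:
  fixes c d :: real
  assumes "\<And>a. x < a \<Longrightarrow> a < y \<Longrightarrow> c + d * a \<noteq> 0" "x < m" "m < y" "c + d * m > 0" "x < a" "a < y"
  shows "c + d * a > 0"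
proof (rule ccontr)
  assume neg: "\<not> c + d * a > 0"
  have cont: "continuous_on S (\<lambda>a. c + d * a)" for S by (intro continuous_intros)
  have "\<exists>t. x < t \<and> t < y \<and> c + d * t = 0"
  proof (cases "a \<le> m")
    case True
    obtain t where "a \<le> t" "t \<le> m" "c + d * t = 0"
      using IVT'[of "\<lambda>a. c + d * a" a 0 m] neg assms(4) True cont by auto
    then show ?thesis using assms by (intro exI[of _ t]) auto
  next
    case False
    obtain t where "m \<le> t" "t \<le> a" "c + d * t = 0"
      using IVT2'[of "\<lambda>a. c + d * a" a 0 m] neg assms(4) False cont by auto
    then show ?thesis using assms by (intro exI[of _ t]) auto
  qed
  then show False using assms(1) by blast
qed

text \<open>Segments are cut at all end abscissae and at all crossings of projected lines. By
  \<open>inj\<close> no two different lines have the same projection, so inside a slab the remaining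
  projections are disjoint.\<close>

lemma lines_strand_diagram:
  fixes Q :: "(real \<times> real \<times> real \<times> real \<times> real \<times> real) set"
  assumes fin: "finite Q" and lt: "\<And>lo hi c d p q. (lo, hi, c, d, p, q) \<in> Q \<Longrightarrow> lo < hi"
    and inj: "\<And>lo hi c d p q lo' hi' p' q'. (lo, hi, c, d, p, q) \<in> Q \<Longrightarrow> (lo', hi', c, d, p', q') \<in> Q
        \<Longrightarrow> p = p' \<and> q = q'"
  obtains N l r \<beta> \<zeta> where "strand_diagram N l r \<beta> \<zeta>"
    "strand_diagram.link N l r \<beta> \<zeta> = \<Union> (line_strand ` Q)"
    "strand_diagram.clean N l r \<beta> \<zeta>"
proof -
  define lines where "lines = (\<lambda>(lo, hi, c, d, p, q). (c, d)) ` Q"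
  \<comment> \<open>For parallel lines division by zero yields \<open>0\<close>, a harmless extra
    cut.\<close>
  define A0 where "A0 = fst ` Q \<union> (fst \<circ> snd) ` Q \<union>
      (\<lambda>((c, d), (c', d')). (c' - c) / (d - d')) ` (lines \<times> lines)"
  \<comment> \<open>With the midpoints added, two consecutive cuts are never both in
    \<open>A0\<close>. The end outside \<open>A0\<close> lies over no crossing, which gives
    \<open>clean\<close>.\<close>
  define A where "A = A0 \<union> (\<lambda>(x, y). (x + y) / 2) ` (A0 \<times> A0)"
  have finA0: "finite A0" using fin by (simp add: A0_def lines_def)
  then have finA: "finite A" by (simp add: A_def)
  have cross: "c = c' \<and> d = d'"
    if "a \<notin> A0" "c + d * a = c' + d' * a" "(c, d) \<in> lines" "(c', d') \<in> lines" for a c d c' d'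
  proof -
    have "d = d'"
    proof (rule ccontr)
      assume "d \<noteq> d'"
      then have "a = (c' - c) / (d - d')" using that(2) by (simp add: field_simps)
      moreover have "(c' - c) / (d - d') \<in> (\<lambda>((c, d), (c', d')). (c' - c) / (d - d')) ` (lines \<times> lines)"
        using that(3,4) by (intro image_eqI[of _ _ "((c, d), (c', d'))"]) auto
      ultimately show False using that(1) by (auto simp: A0_def)
    qed
    then show ?thesis using that(2) by simp
  qed
  define SS where "SS = {(x, y, c, d, p, q) | x y c d p q lo hi.
      consecutive A x y \<and> (lo, hi, c, d, p, q) \<in> Q \<and> lo \<le> x \<and> y \<le> hi}"
  have "SS \<subseteq> A \<times> A \<times> (snd \<circ> snd) ` Q"
    by (force simp: SS_def consecutive_def)
  then have finSS: "finite SS" using finA fin by (meson finite_SigmaI finite_imageI finite_subset)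
  \<comment> \<open>Negated, so that sorting puts larger projections first. Lines do not cross
    within a slab, so comparing at its midpoint decides the whole slab.\<close>
  define key where "key = (\<lambda>(x, y, c, d, p :: real, q :: real). - (c + d * ((x + y) / 2 :: real)))"
  obtain ys where ys: "set ys = SS" "distinct ys" using finite_distinct_list[OF finSS] by blast
  define es where "es = sort_key key ys"
  have es: "set es = SS" "distinct es" "sorted (map key es)" using ys by (simp_all add: es_def)
  define N where "N = length es"
  define l where "l i = fst (es ! i)" for i
  define r where "r i = fst (snd (es ! i))" for i
  define c where "c i = fst (snd (snd (es ! i)))" for i
  define d where "d i = fst (snd (snd (snd (es ! i))))" for i
  define p where "p i = fst (snd (snd (snd (snd (es ! i)))))" for i
  define q where "q i = snd (snd (snd (snd (snd (es ! i)))))" for i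
  define \<beta> where "\<beta> i a = c i + d i * a" for i a
  define \<zeta> where "\<zeta> i a = p i + q i * a" for i a
  have nth: "es ! i = (l i, r i, c i, d i, p i, q i)" for i
    by (simp add: l_def r_def c_def d_def p_def q_def)
  have mem: "\<exists>lo hi. consecutive A (l i) (r i) \<and> (lo, hi, c i, d i, p i, q i) \<in> Q \<and> lo \<le> l i \<and> r i \<le> hi"
    if "i < N" for i
  proof -
    have "es ! i \<in> SS" using es(1) that by (auto simp: N_def)
    then show ?thesis unfolding nth SS_def by blast
  qed
  have cons: "consecutive A (l i) (r i)" if "i < N" for i using mem[OF that] by blast
  have line: "(c i, d i) \<in> lines" if i: "i < N" for i
  proof -
    obtain lo hi where "(lo, hi, c i, d i, p i, q i) \<in> Q" using mem[OF i] by blast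
    then show ?thesis unfolding lines_def by (rule rev_image_eqI) simp
  qed
  have same_line: "p i = p j \<and> q i = q j" if "i < N" "j < N" "c i = c j" "d i = d j" for i j
    using mem[OF that(1)] mem[OF that(2)] inj that(3,4) by metis
  have dia: "strand_diagram N l r \<beta> \<zeta>"
  proof
    show "l i < r i" if "i < N" for i using cons[OF that] by (simp add: consecutive_def)
    show "continuous_on UNIV (\<beta> i)" "continuous_on UNIV (\<zeta> i)" for i
      unfolding \<beta>_def \<zeta>_def by (intro continuous_intros)+
    show "l i = l j \<and> r i = r j \<or> r i \<le> l j \<or> r j \<le> l i" if "i < N" "j < N" for i j
      using cons[OF that(1)] cons[OF that(2)] unfolding consecutive_def by (metis order.antisym leD linear)
    fix i j a assume ij: "i < j" "j < N" "l i = l j" "l i < a" "a < r i"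
    then have iN: "i < N" by simp
    have rr: "r i = r j"
      using cons[OF iN] cons[OF ij(2)] ij(3) unfolding consecutive_def by (metis order.antisym leD)
    have ne: "\<not> (c i = c j \<and> d i = d j)"
    proof
      assume "c i = c j \<and> d i = d j"
      then have "es ! i = es ! j" using same_line[OF iN ij(2)] ij(3) rr by (simp add: nth)
      then show False using es(2) ij iN by (simp add: nth_eq_iff_index_eq N_def)
    qed
    have nz: "(c i - c j) + (d i - d j) * t \<noteq> 0" if "l i < t" "t < r i" for t
    proof
      assume "(c i - c j) + (d i - d j) * t = 0"
      then have "c i + d i * t = c j + d j * t" by (simp add: algebra_simps)
      moreover have "t \<notin> A" using cons[OF iN] that by (auto simp: consecutive_def)
      then have "t \<notin> A0" by (auto simp: A_def)
      ultimately show False using cross[of t] line[OF iN] line[OF ij(2)] ne by blast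
    qed
    define m where "m = (l i + r i) / 2"
    have m: "l i < m" "m < r i" using ij by (auto simp: m_def)
    have "key (es ! i) \<le> key (es ! j)"
      using sorted_nth_mono[OF es(3), of i j] ij iN by (simp add: N_def)
    then have "c j + d j * m \<le> c i + d i * m" by (simp add: nth key_def ij(3) rr m_def)
    then have "(c i - c j) + (d i - d j) * m \<ge> 0" by (simp add: algebra_simps)
    then have "(c i - c j) + (d i - d j) * m > 0" using nz[OF m] by linarith
    from affine_nonzero_sign[OF nz m this ij(4,5)]
    show "\<beta> i a > \<beta> j a" by (simp add: \<beta>_def algebra_simps)
  qed
  interpret strand_diagram N l r \<beta> \<zeta> by (rule dia)
  have "link = \<Union> (line_strand ` Q)"
  proof (intro equalityI subsetI)
    fix x assume "x \<in> link"
    then obtain i a where i: "i < N" "a \<in> {l i..r i}" "x = (a, \<beta> i a, \<zeta> i a)" by (auto simp: link_def strand_def)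
    obtain lo hi where Q: "(lo, hi, c i, d i, p i, q i) \<in> Q" "lo \<le> l i" "r i \<le> hi" using mem[OF i(1)] by blast
    have "x \<in> line_strand (lo, hi, c i, d i, p i, q i)"
      using i Q by (auto simp: line_strand_def \<beta>_def \<zeta>_def)
    then show "x \<in> \<Union> (line_strand ` Q)" using Q(1) by blast
  next
    fix x assume "x \<in> \<Union> (line_strand ` Q)"
    then obtain lo hi c' d' p' q' a where Q: "(lo, hi, c', d', p', q') \<in> Q"
      and a: "lo \<le> a" "a \<le> hi" "x = (a, c' + d' * a, p' + q' * a)"
      by (auto simp: line_strand_def)
    have "lo \<in> A" "hi \<in> A" using Q by (force simp: A_def A0_def)+
    from ex_consecutive[OF finA this lt[OF Q] a(1,2)]
    obtain u v where uv: "consecutive A u v" "lo \<le> u" "u \<le> a" "a \<le> v" "v \<le> hi" by blast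
    then have "(u, v, c', d', p', q') \<in> SS" using Q by (auto simp: SS_def)
    then obtain i where i: "i < N" "es ! i = (u, v, c', d', p', q')"
      using es(1) by (metis in_set_conv_nth N_def)
    then have "x \<in> strand i" using a(3) uv by (auto simp: nth strand_def \<beta>_def \<zeta>_def)
    then show "x \<in> link" using i(1) by (auto simp: link_def)
  qed
  moreover have "\<exists>s a b z. endpt s i = (a, b, z) \<and> (\<forall>j<N. \<forall>s. act s j a \<longrightarrow> \<beta> j a = b \<longrightarrow> \<zeta> j a = z)"
    if i: "i < N" for i
  proof -
    have "\<not> (l i \<in> A0 \<and> r i \<in> A0)"
    proof
      assume "l i \<in> A0 \<and> r i \<in> A0"
      then have "(\<lambda>(x, y). (x + y) / 2) (l i, r i) \<in> A" unfolding A_def by (intro UnI2 imageI) simp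
      then have "(l i + r i) / 2 \<le> l i \<or> r i \<le> (l i + r i) / 2" "l i < r i"
        using cons[OF i] unfolding consecutive_def prod.case by blast+
      then show False by auto
    qed
    moreover have "fst (endpt False i) = l i" "fst (endpt True i) = r i" by (simp_all add: endpt_def Let_def)
    ultimately obtain s where s: "fst (endpt s i) \<notin> A0" by metis
    obtain a b z where abz: "endpt s i = (a, b, z)" by (metis prod_cases3)
    then have b: "b = \<beta> i a" "z = \<zeta> i a" "a \<notin> A0" using s by (auto simp: endpt_def Let_def)
    have "\<zeta> j a = z" if j: "j < N" "\<beta> j a = b" for j
    proof -
      have "c j = c i \<and> d j = d i" using cross[OF b(3) _ line[OF j(1)] line[OF i]] j(2) b(1) by (simp add: \<beta>_def)
      then show ?thesis using same_line[OF j(1) i] b(2) by (simp add: \<zeta>_def)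
    qed
    with abz show ?thesis by blast
  qed
  ultimately show ?thesis using that[OF dia] by (simp add: clean_def)
qed

section \<open>Generic coordinates\<close>

lemma finite_linear_roots: "u \<noteq> 0 \<or> v \<noteq> 0 \<Longrightarrow> finite {t::real. u + t * v = 0}"
  using poly_roots_finite[of "[:u, v:]"] by auto

text \<open>The functionals \<open>(1, s, s^2)\<close> trace the moment curve; on a fixed nonzero
  \<open>w\<close> they give a nonzero polynomial in \<open>s\<close>, which has finitely many
  roots.\<close>

lemma generic_direction:
  fixes D :: "(real^3) set"
  assumes "finite D" "0 \<notin> D"
  obtains s where "\<And>w. w \<in> D \<Longrightarrow> w $ 1 + s * w $ 2 + s\<^sup>2 * w $ 3 \<noteq> 0"
proof -
  have "finite {s. w $ 1 + s * w $ 2 + s\<^sup>2 * w $ 3 = 0}" if "w \<in> D" for w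
  proof -
    have "w \<noteq> 0" using assms(2) that by auto
    then have "[:w $ 1, w $ 2, w $ 3:] \<noteq> 0" by (auto simp: vec_eq_iff forall_3)
    from poly_roots_finite[OF this] show ?thesis
      by (simp add: algebra_simps power2_eq_square)
  qed
  then have "finite (\<Union>w\<in>D. {s. w $ 1 + s * w $ 2 + s\<^sup>2 * w $ 3 = 0})" using assms(1) by simp
  then obtain s where "s \<notin> (\<Union>w\<in>D. {s. w $ 1 + s * w $ 2 + s\<^sup>2 * w $ 3 = 0})"
    using ex_new_if_finite[OF infinite_UNIV_char_0] by blast
  then show ?thesis using that by blast
qed

text \<open>Two lines with different height data acquire the same projection for at most one
  \<open>\<rho>\<close>.\<close>

lemma generic_shear:
  fixes Q :: "(real \<times> real \<times> real \<times> real) set"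
  assumes "finite Q"
  obtains \<rho> where "\<And>c d p q c' d' p' q'. (c, d, p, q) \<in> Q \<Longrightarrow> (c', d', p', q') \<in> Q
      \<Longrightarrow> c + \<rho> * p = c' + \<rho> * p' \<Longrightarrow> d + \<rho> * q = d' + \<rho> * q' \<Longrightarrow> p = p' \<and> q = q'"
proof -
  let ?B = "\<lambda>((c, d, p, q), (c', d', p', q')). if p = p' \<and> q = q' then {}
      else {\<rho>::real. (c - c') + \<rho> * (p - p') = 0 \<and> (d - d') + \<rho> * (q - q') = 0}"
  have "finite (?B x)" for x
  proof -
    obtain c d p q c' d' p' q' where x: "x = ((c, d, p, q), (c', d', p', q'))" by (metis prod.exhaust)
    show ?thesis
    proof (cases "p = p'")
      case True
      have "finite {\<rho>::real. (d - d') + \<rho> * (q - q') = 0}" if "q \<noteq> q'"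
        by (rule finite_linear_roots) (use that in simp)
      then show ?thesis unfolding x using True by (cases "q = q'") (auto elim: finite_subset[rotated])
    next
      case False
      then have "finite {\<rho>::real. (c - c') + \<rho> * (p - p') = 0}" by (intro finite_linear_roots) simp
      then have "finite {\<rho>::real. (c - c') + \<rho> * (p - p') = 0 \<and> (d - d') + \<rho> * (q - q') = 0}"
        by (rule finite_subset[rotated]) auto
      then show ?thesis unfolding x using False by simp
    qed
  qed
  then have "finite (\<Union>x\<in>Q \<times> Q. ?B x)" using assms by blast
  then obtain \<rho> where \<rho>: "\<rho> \<notin> (\<Union>x\<in>Q \<times> Q. ?B x)"
    using ex_new_if_finite[OF infinite_UNIV_char_0] by blast
  show ?thesis
  proof
    fix c d p q c' d' p' q'
    assume Q: "(c, d, p, q) \<in> Q" "(c', d', p', q') \<in> Q"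
      and eq: "c + \<rho> * p = c' + \<rho> * p'" "d + \<rho> * q = d' + \<rho> * q'"
    show "p = p' \<and> q = q'"
    proof (rule ccontr)
      assume "\<not> (p = p' \<and> q = q')"
      then have "\<rho> \<in> ?B ((c, d, p, q), (c', d', p', q'))" using eq by (auto simp: algebra_simps)
      then show False using \<rho> Q by blast
    qed
  qed
qed

text \<open>The coordinate change is linear. Its first coordinate \<open>\<alpha>\<close> is
  injective on every segment, which makes segments graphs; the shear by \<open>\<rho>\<close> keeps
  different lines from having the same projection.\<close>

lemma segments_strand_diagram:
  fixes D :: "((real^3) \<times> (real^3)) set"
  assumes fin: "finite D" and ne: "\<And>u v. (u, v) \<in> D \<Longrightarrow> u \<noteq> v"
  obtains T T' N l r \<beta> \<zeta> where
    "homeomorphism (UNIV :: (real^3) set) (UNIV :: point set) T T'"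
    "strand_diagram N l r \<beta> \<zeta>"
    "strand_diagram.link N l r \<beta> \<zeta> = T ` (\<Union>(u, v)\<in>D. closed_segment u v)"
    "strand_diagram.clean N l r \<beta> \<zeta>"
proof -
  have "finite ((\<lambda>(u, v). v - u) ` D)" "0 \<notin> (\<lambda>(u, v). v - u) ` D" using fin by (auto dest: ne)
  from generic_direction[OF this] obtain s where
    s: "\<And>w. w \<in> (\<lambda>(u, v). v - u) ` D \<Longrightarrow> w $ 1 + s * w $ 2 + s\<^sup>2 * w $ 3 \<noteq> 0" by metis
  define \<alpha> where "\<alpha> x = x $ 1 + s * x $ 2 + s\<^sup>2 * x $ 3" for x :: "real^3"
  have \<alpha>_ne: "\<alpha> v - \<alpha> u \<noteq> 0" if "(u, v) \<in> D" for u v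
    using s[of "v - u"] that by (force simp: \<alpha>_def algebra_simps)
  have \<alpha>_lin: "\<alpha> ((1 - t) *\<^sub>R u + t *\<^sub>R v) = (1 - t) * \<alpha> u + t * \<alpha> v" for t u v
    by (simp add: \<alpha>_def algebra_simps)
  \<comment> \<open>Slope and intercept of coordinate \<open>k\<close> along the segment as an
    affine function of \<open>\<alpha>\<close>.\<close>
  define sl where "sl k = (\<lambda>(u, v). (v $ k - u $ k) / (\<alpha> v - \<alpha> u))" for k :: 3
  define ic where "ic k = (\<lambda>(u, v). u $ k - sl k (u, v) * \<alpha> u)" for k :: 3
  define lns where "lns = (\<lambda>e. (ic 2 e, sl 2 e, ic 3 e, sl 3 e)) ` D"
  have "finite lns" using fin by (simp add: lns_def)
  from generic_shear[OF this] obtain \<rho> where \<rho>: "\<And>c d p q c' d' p' q'. (c, d, p, q) \<in> lns \<Longrightarrow> (c', d', p', q') \<in> lns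
      \<Longrightarrow> c + \<rho> * p = c' + \<rho> * p' \<Longrightarrow> d + \<rho> * q = d' + \<rho> * q' \<Longrightarrow> p = p' \<and> q = q'" by metis
  define qq where "qq e = (min (\<alpha> (fst e)) (\<alpha> (snd e)), max (\<alpha> (fst e)) (\<alpha> (snd e)),
      ic 2 e + \<rho> * ic 3 e, sl 2 e + \<rho> * sl 3 e, ic 3 e, sl 3 e)" for e
  define T where "T x = (\<alpha> x, x $ 2 + \<rho> * x $ 3, x $ 3)" for x :: "real^3"
  define T' where "T' y = (\<chi> k::3. if k = 1 then fst y - s * (fst (snd y) - \<rho> * snd (snd y)) - s\<^sup>2 * snd (snd y)
      else if k = 2 then fst (snd y) - \<rho> * snd (snd y) else snd (snd y))" for y :: "point"
  have T'T: "T' (T x) = x" for x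
    by (simp add: vec_eq_iff forall_3 T'_def T_def \<alpha>_def)
  have TT': "T (T' y) = y" for y
    by (simp add: T'_def T_def \<alpha>_def prod_eq_iff)
  have contT: "continuous_on UNIV T"
    unfolding T_def \<alpha>_def by (intro continuous_intros)
  have contT': "continuous_on UNIV T'"
    unfolding T'_def
  proof (rule continuous_on_vec_lambda)
    fix k :: 3
    show "continuous_on UNIV (\<lambda>y::point. if k = 1 then fst y - s * (fst (snd y) - \<rho> * snd (snd y)) - s\<^sup>2 * snd (snd y)
      else if k = 2 then fst (snd y) - \<rho> * snd (snd y) else snd (snd y))"
      by (cases "k = 1"; cases "k = 2") (auto intro!: continuous_intros)
  qed
  have homeo: "homeomorphism UNIV UNIV T T'"
    using contT contT' T'T TT' by (intro homeomorphismI) auto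
  have seg: "line_strand (qq (u, v)) = T ` closed_segment u v" if uv: "(u, v) \<in> D" for u v
  proof -
    let ?\<delta> = "\<alpha> v - \<alpha> u"
    have d: "?\<delta> \<noteq> 0" using \<alpha>_ne[OF uv] .
    have coord: "x $ k = ic k (u, v) + sl k (u, v) * \<alpha> x" if "x = (1 - t) *\<^sub>R u + t *\<^sub>R v" for x t k
    proof -
      have "sl k (u, v) * (\<alpha> x - \<alpha> u) = (v $ k - u $ k) / ?\<delta> * (t * ?\<delta>)"
        unfolding that \<alpha>_lin by (simp add: sl_def algebra_simps)
      also have "\<dots> = t * (v $ k - u $ k)" using d by simp
      finally show ?thesis by (simp add: that ic_def algebra_simps)
    qed
    have Tx: "T x = (\<alpha> x, ic 2 (u, v) + \<rho> * ic 3 (u, v) + (sl 2 (u, v) + \<rho> * sl 3 (u, v)) * \<alpha> x,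
        ic 3 (u, v) + sl 3 (u, v) * \<alpha> x)" if "x = (1 - t) *\<^sub>R u + t *\<^sub>R v" for x t
      unfolding T_def coord[OF that, of 2] coord[OF that, of 3] by (simp add: algebra_simps)
    have img: "\<alpha> ` closed_segment u v = {min (\<alpha> u) (\<alpha> v)..max (\<alpha> u) (\<alpha> v)}"
    proof -
      have "\<alpha> ` closed_segment u v = closed_segment (\<alpha> u) (\<alpha> v)"
        unfolding closed_segment_image_interval image_image \<alpha>_lin by simp
      then show ?thesis by (simp add: closed_segment_eq_real_ivl)
    qed
    show ?thesis
    proof (intro equalityI subsetI)
      fix y assume "y \<in> line_strand (qq (u, v))"
      then obtain a where a: "a \<in> {min (\<alpha> u) (\<alpha> v)..max (\<alpha> u) (\<alpha> v)}"
        and y: "y = (a, ic 2 (u, v) + \<rho> * ic 3 (u, v) + (sl 2 (u, v) + \<rho> * sl 3 (u, v)) * a, ic 3 (u, v) + sl 3 (u, v) * a)"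
        by (auto simp: line_strand_def qq_def)
      then obtain x where x: "x \<in> closed_segment u v" "a = \<alpha> x" using img by (metis imageE)
      then obtain t where "x = (1 - t) *\<^sub>R u + t *\<^sub>R v" by (auto simp: in_segment)
      then have "y = T x" using Tx x(2) y by simp
      then show "y \<in> T ` closed_segment u v" using x(1) by blast
    next
      fix y assume "y \<in> T ` closed_segment u v"
      then obtain x where x: "x \<in> closed_segment u v" "y = T x" by blast
      then obtain t where t: "x = (1 - t) *\<^sub>R u + t *\<^sub>R v" by (auto simp: in_segment)
      have "\<alpha> x \<in> {min (\<alpha> u) (\<alpha> v)..max (\<alpha> u) (\<alpha> v)}" using img x(1) by blast
      then show "y \<in> line_strand (qq (u, v))"
        unfolding x(2) Tx[OF t] line_strand_def qq_def by auto
    qed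
  qed
  have "finite (qq ` D)" using fin by simp
  moreover have "lo < hi" if "(lo, hi, c, d, p, q) \<in> qq ` D" for lo hi c d p q
    using that \<alpha>_ne by (force simp: qq_def)
  moreover have "p = p' \<and> q = q'"
    if e: "(lo, hi, c, d, p, q) \<in> qq ` D" "(lo', hi', c, d, p', q') \<in> qq ` D" for lo hi c d p q lo' hi' p' q'
  proof -
    obtain e e' where "e \<in> D" "e' \<in> D" "(lo, hi, c, d, p, q) = qq e" "(lo', hi', c, d, p', q') = qq e'"
      using e by blast
    then show ?thesis
      using \<rho>[of "ic 2 e" "sl 2 e" "ic 3 e" "sl 3 e" "ic 2 e'" "sl 2 e'" "ic 3 e'" "sl 3 e'"]
      by (auto simp: qq_def lns_def)
  qed
  ultimately obtain N l r \<beta> \<zeta> where dia: "strand_diagram N l r \<beta> \<zeta>"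
    "strand_diagram.link N l r \<beta> \<zeta> = \<Union> (line_strand ` qq ` D)"
    "strand_diagram.clean N l r \<beta> \<zeta>"
    by (rule lines_strand_diagram) blast+
  have "\<Union> (line_strand ` qq ` D) = T ` (\<Union>(u, v)\<in>D. closed_segment u v)"
    using seg by (auto simp: image_UN)
  with that[OF homeo dia(1)] dia(2,3) show ?thesis by simp
qed


section \<open>The link group\<close>

lemma homeomorphism_components:
  assumes h: "homeomorphism S T f g" and C: "C \<in> components S"
  shows "f ` C \<in> components T"
  unfolding in_components_maximal
proof (intro conjI allI impI)
  have C': "C \<noteq> {}" "C \<subseteq> S" "connected C" using C by (auto simp: in_components_maximal)
  have fg: "\<And>x. x \<in> S \<Longrightarrow> g (f x) = x" "\<And>y. y \<in> T \<Longrightarrow> f (g y) = y" "f ` S = T" "g ` T = S"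
    "continuous_on S f" "continuous_on T g"
    using h by (auto simp: homeomorphism_def)
  show "f ` C \<noteq> {}" using C' by simp
  show "f ` C \<subseteq> T" using C' fg by blast
  show "connected (f ` C)" using C' fg by (meson connected_continuous_image continuous_on_subset)
  fix D assume D: "D \<noteq> {} \<and> f ` C \<subseteq> D \<and> D \<subseteq> T \<and> connected D"
  have "connected (g ` D)" using D fg by (meson connected_continuous_image continuous_on_subset)
  moreover have "g ` D \<subseteq> S" using D fg by blast
  moreover have "C \<subseteq> g ` D"
  proof
    fix x assume x: "x \<in> C"
    then have "g (f x) \<in> g ` D" using D by blast
    moreover have "g (f x) = x" using fg(1) x C' by blast
    ultimately show "x \<in> g ` D" by simp
  qed
  moreover have "g ` D \<noteq> {}" using D by simp
  ultimately have "g ` D = C" using C[unfolded in_components_maximal] by simp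
  moreover have "f ` g ` D = D"
  proof -
    have "f ` g ` D = (\<lambda>y. y) ` D" unfolding image_image by (rule image_cong) (use D fg(2) in auto)
    then show ?thesis by simp
  qed
  ultimately show "D = f ` C" by simp
qed

lemma circle_not_singleton: "\<not> {x} homeomorphic sphere (0::real^2) 1"
proof
  assume "{x} homeomorphic sphere (0::real^2) 1"
  then obtain f g where "homeomorphism {x} (sphere (0::real^2) 1) f g" unfolding homeomorphic_def by blast
  then have "sphere (0::real^2) 1 = {f x}" by (auto simp: homeomorphism_def)
  moreover have "axis 1 1 \<in> sphere (0::real^2) 1" "- axis 1 1 \<in> sphere (0::real^2) 1" by simp_all
  ultimately have "axis 1 1 = f x" "- axis 1 1 = f x" by blast+
  then have "(axis 1 1 :: real^2) = - axis 1 1" by metis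
  then have "(axis 1 1 :: real^2) $ 1 = (- axis 1 1 :: real^2) $ 1" by (rule arg_cong[of _ _ "\<lambda>v. v $ 1"])
  then show False by simp
qed

text \<open>Degenerate segments are superfluous, since no component is a point.\<close>

lemma polygonal_nondegenerate:
  fixes P :: "'a::euclidean_space set"
  assumes "polygonal P" and comp: "\<And>x. {x} \<notin> components P"
  obtains D where "finite D" "\<And>u v. (u, v) \<in> D \<Longrightarrow> u \<noteq> v" "P = (\<Union>(u, v)\<in>D. closed_segment u v)"
proof -
  obtain E where E: "finite E" "\<forall>e\<in>E. \<exists>a b. e = closed_segment a b" "P = \<Union> E"
    using assms(1) unfolding polygonal_def by blast
  then obtain u v where uv: "\<And>e. e \<in> E \<Longrightarrow> e = closed_segment (u e) (v e)" by metis
  define D where "D = {(u e, v e) | e. e \<in> E \<and> u e \<noteq> v e}"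
  have "D \<subseteq> (\<lambda>e. (u e, v e)) ` E" by (auto simp: D_def)
  then have finD: "finite D" using E(1) finite_subset by blast
  let ?U = "\<Union>(u, v)\<in>D. closed_segment u v"
  have "P \<subseteq> ?U"
  proof
    fix x assume "x \<in> P"
    show "x \<in> ?U"
    proof (rule ccontr)
      assume out: "x \<notin> ?U"
      let ?F = "{e\<in>E. x \<notin> e}"
      have cl: "closed (\<Union> ?F)"
        using E by (intro closed_Union) auto
      have PF: "P \<subseteq> {x} \<union> \<Union> ?F"
      proof
        fix y assume "y \<in> P"
        then obtain e where e: "e \<in> E" "y \<in> e" using E(3) by blast
        show "y \<in> {x} \<union> \<Union> ?F"
        proof (cases "x \<in> e")
          case True
          then have "u e = v e" using out uv[OF e(1)] e(1) by (force simp: D_def)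
          then have "e = {v e}" using uv[OF e(1)] by simp
          then show ?thesis using True e(2) by (metis UnI1 singletonD)
        qed (use e in auto)
      qed
      \<comment> \<open>All segments containing \<open>x\<close> are degenerate, and the others form
        a closed set that misses \<open>x\<close>; so \<open>x\<close> is isolated in
        \<open>P\<close> and its component is a point.\<close>
      define K where "K = connected_component_set P x"
      have K: "connected K" "K \<subseteq> P" "x \<in> K"
        using \<open>x \<in> P\<close> by (auto simp: K_def connected_component_subset[THEN subsetD])
      have "K \<inter> \<Union> ?F = {}"
      proof (rule ccontr)
        assume "K \<inter> \<Union> ?F \<noteq> {}"
        moreover have "K \<subseteq> {x} \<union> \<Union> ?F" "{x} \<inter> \<Union> ?F \<inter> K = {}" "{x} \<inter> K \<noteq> {}" using K PF by auto
        ultimately show False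
          using K(1) cl closed_singleton[of x] unfolding connected_closed by (metis Int_commute)
      qed
      then have "K = {x}" using K PF by blast
      then have "{x} \<in> components P" using componentsI[OF \<open>x \<in> P\<close>] by (simp add: K_def)
      then show False using comp by blast
    qed
  qed
  moreover have "?U \<subseteq> P"
    using uv E(3) by (fastforce simp: D_def)
  ultimately have "P = ?U" by blast
  moreover have "u' \<noteq> v'" if "(u', v') \<in> D" for u' v' using that by (auto simp: D_def)
  ultimately show ?thesis using that[OF finD] by blast
qed

context strand_diagram
begin

text \<open>A small change of \<open>b\<close> reaches a vertical line that misses the link; along
  it one gets to the plane at height \<open>m\<close>, which misses the link as well.\<close>

lemma path_component_link_complement:
  assumes x: "x \<notin> link" and m: "box_bound m"
  shows "path_component (- link) x (0, 0, m)"
proof -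
  obtain a b z where x_eq: "x = (a, b, z)" by (metis prod_cases3)
  have "open (- link)" using compact_link compact_imp_closed by blast
  then obtain e where e: "e > 0" "ball x e \<subseteq> - link" using x open_contains_ball by blast
  have "infinite ({b<..<b + e} - (\<lambda>i. \<beta> i a) ` {..<N})"
    using e(1) by (intro Diff_infinite_finite) (auto simp: infinite_Ioo)
  then obtain b' where "b' \<in> {b<..<b + e} - (\<lambda>i. \<beta> i a) ` {..<N}"
    using infinite_imp_nonempty by blast
  then have b': "b < b'" "b' < b + e" "\<And>i. i < N \<Longrightarrow> b' \<noteq> \<beta> i a" by auto
  let ?y = "(a, b', z)" and ?y' = "(a, b', m)"
  have col: "(a, b', z') \<notin> link" for z' using b'(3) by (auto simp: link_def strand_def)
  have "?y \<in> ball x e" using b' by (simp add: x_eq dist_prod_def dist_real_def)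
  then have "closed_segment x ?y \<subseteq> ball x e"
    using e(1) by (intro closed_segment_subset) auto
  then have 1: "path_component (- link) x ?y" using e(2) by (intro path_component_linepath) blast
  have "closed_segment ?y ?y' \<subseteq> {a} \<times> {b'} \<times> UNIV"
    by (rule closed_segment_subset) (auto simp: convex_Times)
  then have 2: "path_component (- link) ?y ?y'" using col by (intro path_component_linepath) auto
  have "closed_segment ?y' (0, 0, m) \<subseteq> {x. snd (snd x) = m}"
    by (rule closed_segment_subset) (auto simp: convex_def algebra_simps simp flip: distrib_right)
  moreover have "{x. snd (snd x) = m} \<subseteq> - link" using m by (auto simp: box_bound_def)
  ultimately have 3: "path_component (- link) ?y' (0, 0, m)" by (intro path_component_linepath) blast
  show ?thesis using 1 2 3 path_component_trans by blast
qed

end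

section \<open>Passage to the 3-sphere\<close>

text \<open>The section \<open>k\<close> defined near infinity becomes the germ at \<open>p\<close>.
  Its value at \<open>p\<close> is immaterial, since comparison with the germ at any other point
  takes place on a neighbourhood avoiding \<open>p\<close>.\<close>

lemma local_system_one_point_extension:
  fixes X S :: "'a::t1_space set" and H :: "'a \<Rightarrow> 'b::t2_space" and f :: "'b \<Rightarrow> 'b \<Rightarrow> 'g::group_add"
  assumes H: "continuous_on (S - {p}) H" and X: "X \<subseteq> S" "H ` (X - {p}) \<subseteq> Y"
    and ls: "local_system Y f"
    and out: "\<forall>\<^sub>F x in nhds p. x \<in> X - {p} \<longrightarrow> (\<exists>c. \<forall>\<^sub>F y in nhds (H x). k y = c + f (H x) y)"
  shows "local_system X (\<lambda>x y. if x = p then (if y = p then 0 else k (H y)) else f (H x) (H y))"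
    (is "local_system X ?f")
  unfolding local_system_def
proof
  fix x0 assume x0: "x0 \<in> X"
  have ne: "\<forall>\<^sub>F y in nhds x. y \<noteq> p" if "x \<noteq> p" for x
    using eventually_nhds_in_open[of "- {p}" x] that by (simp add: open_Compl)
  have pull: "\<forall>\<^sub>F y in nhds x. y \<in> X \<longrightarrow> P (H y) \<and> y \<noteq> p"
    if "x \<in> X" "x \<noteq> p" "\<forall>\<^sub>F y in nhds (H x). P y" for P x
  proof -
    have "x \<in> S - {p}" using that X by blast
    from continuous_on_eventually_nhds[OF H this that(3)] ne[OF that(2)]
    show ?thesis by eventually_elim (use X in blast)
  qed
  show "\<forall>\<^sub>F x1 in nhds x0. x1 \<in> X \<longrightarrow> (\<exists>c. \<forall>\<^sub>F y in nhds x1. y \<in> X \<longrightarrow> ?f x0 y = c + ?f x1 y)"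
  proof (cases "x0 = p")
    case True
    show ?thesis unfolding True using out
    proof (rule eventually_mono, intro impI)
      fix x1 assume *: "x1 \<in> X - {p} \<longrightarrow> (\<exists>c. \<forall>\<^sub>F y in nhds (H x1). k y = c + f (H x1) y)" "x1 \<in> X"
      show "\<exists>c. \<forall>\<^sub>F y in nhds x1. y \<in> X \<longrightarrow> ?f p y = c + ?f x1 y"
      proof (cases "x1 = p")
        case True
        then show ?thesis by (intro exI[of _ 0]) simp
      next
        case False
        then obtain c where c: "\<forall>\<^sub>F y in nhds (H x1). k y = c + f (H x1) y" using * by blast
        have "\<forall>\<^sub>F y in nhds x1. y \<in> X \<longrightarrow> ?f p y = c + ?f x1 y"
          using pull[OF *(2) False c] by (rule eventually_mono) (use False in auto)
        then show ?thesis by (rule exI)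
      qed
    qed
  next
    case False
    have Hx0: "H x0 \<in> Y" using X(2) x0 False by blast
    have "\<forall>\<^sub>F u in nhds (H x0). u \<in> Y \<longrightarrow> (\<exists>c. \<forall>\<^sub>F y in nhds u. y \<in> Y \<longrightarrow> f (H x0) y = c + f u y)"
      using ls[unfolded local_system_def] Hx0 by (rule bspec)
    from pull[OF x0 False this] show ?thesis
    proof (rule eventually_mono, intro impI)
      fix x1 assume *: "x1 \<in> X \<longrightarrow> (H x1 \<in> Y \<longrightarrow> (\<exists>c. \<forall>\<^sub>F y in nhds (H x1). y \<in> Y \<longrightarrow> f (H x0) y = c + f (H x1) y)) \<and> x1 \<noteq> p"
        and x1: "x1 \<in> X"
      then have "x1 \<noteq> p" "H x1 \<in> Y" using X(2) by blast+
      with * x1 obtain c where c: "\<forall>\<^sub>F y in nhds (H x1). y \<in> Y \<longrightarrow> f (H x0) y = c + f (H x1) y" by blast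
      have "\<forall>\<^sub>F y in nhds x1. y \<in> X \<longrightarrow> ?f x0 y = c + ?f x1 y"
        using pull[OF x1 \<open>x1 \<noteq> p\<close> c]
      proof (rule eventually_mono, intro impI)
        fix y assume "y \<in> X \<longrightarrow> (H y \<in> Y \<longrightarrow> f (H x0) (H y) = c + f (H x1) (H y)) \<and> y \<noteq> p" "y \<in> X"
        moreover from this have "H y \<in> Y" using X(2) by blast
        ultimately show "?f x0 y = c + ?f x1 y" using False \<open>x1 \<noteq> p\<close> by simp
      qed
      then show "\<exists>c. \<forall>\<^sub>F y in nhds x1. y \<in> X \<longrightarrow> ?f x0 y = c + ?f x1 y" by (rule exI)
    qed
  qed
qed

text \<open>The complement is open in a locally path connected sphere, and by connectedness of the
  sphere no relatively open set is a single point. This will lead out of the point at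
  infinity.\<close>

lemma sphere_complement_path_component:
  fixes L :: "'a::euclidean_space set"
  assumes "closed L" "x \<in> sphere 0 1 - L" "2 \<le> DIM('a)"
  obtains y where "y \<noteq> x" "path_component (sphere 0 1 - L) x y"
proof -
  let ?S = "sphere (0::'a) 1" and ?X = "sphere (0::'a) 1 - L"
  have X: "openin (top_of_set ?S) ?X"
    using openin_open_Int[of "- L" ?S] assms(1) by (simp add: Diff_eq open_Compl)
  obtain u v where uv: "openin (top_of_set ?S) u" "path_connected v" "x \<in> u" "u \<subseteq> v" "v \<subseteq> ?X"
    using locally_path_connected_sphere[of "0::'a" 1, unfolded locally_def, rule_format, of ?X x] X assms(2)
    by blast
  have "u \<noteq> {x}"
  proof
    assume "u = {x}"
    moreover have "connected ?S" using assms(3) by (rule connected_sphere)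
    moreover have "closedin (top_of_set ?S) {x}" using assms(2) by (intro closed_subset) auto
    ultimately have "?S = {x}" using uv(1) unfolding connected_clopen by blast
    moreover have "- x \<in> ?S" using assms(2) by simp
    ultimately have "- x = x" by blast
    then have "x + x = 0" by (metis add.right_inverse)
    then have "x = 0" by (simp flip: scaleR_2)
    then show False using assms(2) by simp
  qed
  then obtain y where y: "y \<in> u" "y \<noteq> x" using uv(3) by blast
  have "path_component v x y" using uv y unfolding path_connected_component by blast
  then show ?thesis using that[OF y(2)] path_component_of_subset[OF uv(5)] by blast
qed

theorem theorem1p3:
  fixes L :: "(real^4) set" and x :: "real^4" and n :: nat
  assumes "is_link L"
    and "card (components L) \<ge> 3"
    and "x \<in> three_sphere - L"
    and "n \<ge> 3"
  shows "\<exists>f. f \<in> epi (link_group L x) (dihedral_group n)"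
proof -
  let ?X = "three_sphere - L"
  have L: "L \<subseteq> three_sphere" and circ: "\<And>C. C \<in> components L \<Longrightarrow> C homeomorphic sphere (0::real^2) 1"
    and "tame L" using assms(1) by (auto simp: is_link_def)
  then obtain p h h' where p: "p \<in> ?X"
    and h: "homeomorphism (three_sphere - {p}) (UNIV :: (real^3) set) h h'" and poly: "polygonal (h ` L)"
    unfolding tame_def by blast
  have Lp: "L \<subseteq> three_sphere - {p}" using L p by blast
  have hL: "homeomorphism L (h ` L) h h'" by (rule homeomorphism_of_subsets[OF h Lp]) auto
  have no_point: "{y} \<notin> components (h ` L)" for y
  proof
    assume "{y} \<in> components (h ` L)"
    from homeomorphism_components[OF homeomorphism_symD[OF hL] this]
    have "{h' y} \<in> components L" by simp
    then show False using circ circle_not_singleton by blast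
  qed
  obtain D where D: "finite D" "\<And>u v. (u, v) \<in> D \<Longrightarrow> u \<noteq> v" "h ` L = (\<Union>(u, v)\<in>D. closed_segment u v)"
    by (rule polygonal_nondegenerate[OF poly no_point]) blast
  obtain T T' N l r \<beta> \<zeta> where T: "homeomorphism (UNIV :: (real^3) set) (UNIV :: point set) T T'"
    and dia: "strand_diagram N l r \<beta> \<zeta>"
    and link: "strand_diagram.link N l r \<beta> \<zeta> = T ` (\<Union>(u, v)\<in>D. closed_segment u v)"
    and clean: "strand_diagram.clean N l r \<beta> \<zeta>"
    by (rule segments_strand_diagram[OF D(1,2)]) blast+
  interpret strand_diagram N l r \<beta> \<zeta> by (rule dia)
  define H where "H = T \<circ> h"
  define K where "K = h' \<circ> T'"
  have H: "homeomorphism (three_sphere - {p}) UNIV H K"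
    unfolding H_def K_def by (rule homeomorphism_compose[OF h T])
  have HK: "\<And>y. H (K y) = y" "\<And>y. K y \<in> three_sphere - {p}" "\<And>x. x \<in> three_sphere - {p} \<Longrightarrow> K (H x) = x"
    "continuous_on (three_sphere - {p}) H" "continuous_on UNIV K"
    using H unfolding homeomorphism_def by blast+
  have link_H: "link = H ` L" unfolding H_def link D(3)[symmetric] by (rule image_comp)
  have H_link: "H y \<in> link \<longleftrightarrow> y \<in> L" if "y \<in> three_sphere - {p}" for y
  proof
    assume "H y \<in> link"
    then obtain u where u: "u \<in> L" "H y = H u" unfolding link_H by blast
    have "y = K (H u)" using HK(3)[OF that] u(2) by simp
    also have "\<dots> = u" using HK(3) Lp u(1) by blast
    finally show "y \<in> L" using u(1) by simp
  qed (auto simp: link_H)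
  have HLh: "homeomorphism L link H K" by (rule homeomorphism_of_subsets[OF H Lp]) (auto simp: link_H)

  obtain Cs where Cs: "Cs \<subseteq> components L" "card Cs = 3"
    using obtain_subset_with_card_n[OF assms(2)] by metis
  then obtain C1 C2 C3 where "Cs = {C1, C2, C3}" and ne: "C1 \<noteq> C2" "C1 \<noteq> C3" "C2 \<noteq> C3"
    by (auto simp: card_3_iff)
  then have C: "C1 \<in> components L" "C2 \<in> components L" "C3 \<in> components L" using Cs(1) by auto
  define E where "E C = {i. i < N \<and> strand i \<subseteq> H ` C}" for C
  define V where "V C = {endpt s i | s i. i < N \<and> strand i \<subseteq> H ` C}" for C
  have cyc: "cyclic_chain (E C) (V C)" if C: "C \<in> components L" for C
    unfolding E_def V_def
  proof (rule cyclic_chain_component)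
    show "H ` C \<in> components link" by (rule homeomorphism_components[OF HLh C])
    have "homeomorphism C (H ` C) H K"
      by (rule homeomorphism_of_subsets[OF HLh in_components_subset[OF C] subset_refl HOL.refl])
    then have "H ` C homeomorphic C" unfolding homeomorphic_def using homeomorphism_symD by blast
    then show "H ` C homeomorphic sphere (0::real^2) 1" using circ[OF C] homeomorphic_trans by blast
  qed
  have Hdisj: "H ` C \<inter> H ` C' = {}" if "C \<in> components L" "C' \<in> components L" "C \<noteq> C'" for C C'
  proof -
    have "C \<inter> C' = {}" using components_nonoverlap[OF that(1,2)] that(3) by blast
    moreover have "inj_on H L" using HLh unfolding homeomorphism_def by (metis inj_on_def)
    ultimately show ?thesis
      using in_components_subset[OF that(1)] in_components_subset[OF that(2)] inj_on_image_Int[of H L C C'] by simp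
  qed
  have disj: "E C \<inter> E C' = {} \<and> V C \<inter> V C' = {}" if "C \<in> components L" "C' \<in> components L" "C \<noteq> C'" for C C'
  proof -
    have VH: "v \<in> H ` C" if "v \<in> V C" for v C using that endpt_in_strand by (auto simp: V_def)
    have EV: "endpt True i \<in> V C" if "i \<in> E C" for i C using that by (auto simp: V_def E_def)
    have "V C \<inter> V C' = {}" using Hdisj[OF that] VH unfolding disjoint_iff by metis
    moreover have "E C \<inter> E C' = {}" using calculation EV unfolding disjoint_iff by metis
    ultimately show ?thesis by blast
  qed
  have dd: "E C1 \<inter> E C2 = {}" "E C1 \<inter> E C3 = {}" "E C2 \<inter> E C3 = {}" "V C1 \<inter> V C2 = {}"
    using disj[OF C(1,2) ne(1)] disj[OF C(1,3) ne(2)] disj[OF C(2,3) ne(3)] by auto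
  from dihedral_colouring[OF cyc[OF C(1)] cyc[OF C(2)] cyc[OF C(3)] dd clean]
  obtain s t i0 where
    rel: "\<And>a b z. above_relation (\<lambda>i. Aff (s i) (t i)) a b z"
    and i0: "i0 < N" "s i0" "t i0 = 0" and gcd: "\<And>d. (\<And>i. i < N \<Longrightarrow> d dvd t i) \<Longrightarrow> is_unit d"
    by blast
  define g where "g i = Aff (s i) (t i)" for i
  have ls: "local_system (- link) (wall_system g)"
    by (rule local_system_wall_system, rule stack_relation) (use rel in \<open>auto simp: g_def[abs_def]\<close>)
  have full: "column g True a b = column g False a b" for a b
    by (rule full_relation) (use rel in \<open>auto simp: g_def[abs_def]\<close>)
  obtain m where m: "m > 0" "box_bound m" using ex_box_bound by blast
  \<comment> \<open>The wall system is pulled back by \<open>H\<close>. Near \<open>p\<close> the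
    map \<open>H\<close> leaves the box, so the section outside the box can serve as germ at
    \<open>p\<close>.\<close>
  define F where "F = (\<lambda>x y. if x = p then (if y = p then 0 else outer_section g m (H y)) else wall_system g (H x) (H y))"
  have lsF: "local_system ?X F"
    unfolding F_def
  proof (rule local_system_one_point_extension[OF HK(4) _ _ ls])
    show "H ` (?X - {p}) \<subseteq> - link" using H_link by auto
    let ?B = "{- m..m} \<times> {- m..m} \<times> {- m..m}"
    have "compact (K ` ?B)"
      by (intro compact_continuous_image compact_Times continuous_on_subset[OF HK(5)]) auto
    then have "open (- K ` ?B)" using compact_imp_closed by blast
    moreover have "p \<in> - K ` ?B" using HK(2) by auto
    ultimately have "\<forall>\<^sub>F y in nhds p. y \<in> - K ` ?B" by (rule eventually_nhds_in_open)
    then show "\<forall>\<^sub>F y in nhds p. y \<in> ?X - {p} \<longrightarrow>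
        (\<exists>c. \<forall>\<^sub>F u in nhds (H y). outer_section g m u = c + wall_system g (H y) u)"
    proof (rule eventually_mono, intro impI)
      fix y assume y: "y \<in> - K ` ?B" "y \<in> ?X - {p}"
      obtain a b z where abz: "H y = (a, b, z)" by (metis prod_cases3)
      have "K (a, b, z) = y" using HK(3)[of y] y(2) abz by simp
      then have "(a, b, z) \<notin> ?B" using y(1) by blast
      then have "\<not> (\<bar>a\<bar> \<le> m \<and> \<bar>b\<bar> \<le> m \<and> \<bar>z\<bar> \<le> m)" by (simp add: abs_le_iff) linarith
      from outer_section_wall_system[OF full m(2) this]
      show "\<exists>c. \<forall>\<^sub>F u in nhds (H y). outer_section g m u = c + wall_system g (H y) u" unfolding abz .
    qed
  qed auto
  have KX: "K ` (- link) \<subseteq> ?X" using HK(1,2) H_link by (metis ComplD DiffD1 DiffI image_subsetI)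
  have hol_K: "holonomy F (K \<circ> q) = holonomy (wall_system g) q \<and> path (K \<circ> q) \<and> path_image (K \<circ> q) \<subseteq> ?X"
    if q: "path q" "path_image q \<subseteq> - link" for q
  proof -
    obtain S where S: "section_along (wall_system g) {0..1} q S" by (rule section_along_path[OF ls q])
    have "F (K u) (K v) = wall_system g u v" for u v using HK(1,2) by (simp add: F_def)
    then have "section_along F {0..1} (K \<circ> q) S" using S by (simp add: section_along_def)
    moreover have "path (K \<circ> q)" by (rule path_continuous_image[OF q(1) continuous_on_subset[OF HK(5)]]) simp
    moreover have "path_image (K \<circ> q) \<subseteq> ?X" unfolding path_image_compose using q(2) KX by blast
    ultimately show ?thesis using holonomy_eq[OF S] by (simp add: holonomy_eq)
  qed
  define y0 where "y0 = K (0, 0, m)"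
  define G where "G = {holonomy F q | q. q \<in> loops_at ?X y0}"
  \<comment> \<open>Meridians realize all colours: strand \<open>i0\<close> gives
    \<open>x \<mapsto> - x\<close>, and the shifts \<open>t i\<close> have no common divisor but
    units.\<close>
  have "G = UNIV"
  proof (rule aff_subgroup_eq_UNIV[of G "{..<N}" t])
    fix u v assume "u \<in> G" "v \<in> G"
    then obtain q q' where q: "q \<in> loops_at ?X y0" "q' \<in> loops_at ?X y0" "u = holonomy F q" "v = holonomy F q'"
      by (auto simp: G_def)
    then have "holonomy F (q +++ q') = u + v"
      using holonomy_join[OF lsF, of q q'] by (simp add: loops_at_def)
    moreover have "q +++ q' \<in> loops_at ?X y0" using q by (simp add: loops_at_def path_image_join)
    ultimately show "u + v \<in> G" unfolding G_def by (metis (mono_tags, lifting) mem_Collect_eq)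
  next
    fix u assume "u \<in> G"
    then obtain q where q: "q \<in> loops_at ?X y0" "u = holonomy F q" by (auto simp: G_def)
    then have "holonomy F (reversepath q) = - u"
      using holonomy_reversepath[OF lsF, of q] by (simp add: loops_at_def)
    moreover have "reversepath q \<in> loops_at ?X y0" using q by (simp add: loops_at_def)
    ultimately show "- u \<in> G" unfolding G_def by (metis (mono_tags, lifting) mem_Collect_eq)
  next
    have gG: "g i \<in> G" if i: "i < N" for i
    proof -
      obtain q where q: "q \<in> loops_at (- link) (0, 0, m)" "holonomy (wall_system g) q = g i"
        by (rule meridian[OF ls i m(2)])
      then have "holonomy F (K \<circ> q) = g i" "K \<circ> q \<in> loops_at ?X y0"
        using hol_K[of q] by (auto simp: loops_at_def y0_def pathstart_def pathfinish_def)
      then show ?thesis unfolding G_def by (metis (mono_tags, lifting) mem_Collect_eq)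
    qed
    show "Aff True 0 \<in> G" using gG[OF i0(1)] i0 by (simp add: g_def)
    fix i assume "i \<in> {..<N}"
    then show "Aff True (t i) \<in> G \<or> Aff False (t i) \<in> G" using gG[of i] by (cases "s i") (auto simp: g_def)
  qed (use gcd in auto)
  have conn: "path_component ?X y y0" if y: "y \<in> ?X" "y \<noteq> p" for y
  proof -
    have "path_component (- link) (H y) (0, 0, m)"
      by (rule path_component_link_complement[OF _ m(2)]) (use H_link y in auto)
    then obtain q where q: "path q" "path_image q \<subseteq> - link" "pathstart q = H y" "pathfinish q = (0, 0, m)"
      unfolding path_component_def by blast
    then show ?thesis
      unfolding path_component_def using hol_K[of q] HK(3)[of y] y
      by (intro exI[of _ "K \<circ> q"]) (auto simp: y0_def pathstart_def pathfinish_def)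
  qed
  have "closed L"
  proof -
    have "L = K ` link" using homeomorphism_symD[OF HLh] by (simp add: homeomorphism_def)
    then show ?thesis
      using compact_continuous_image[OF continuous_on_subset[OF HK(5) subset_UNIV] compact_link] compact_imp_closed by simp
  qed
  \<comment> \<open>This covers a base point equal to \<open>p\<close>, where \<open>H\<close>
    provides no path.\<close>
  then obtain y where "y \<noteq> p" "path_component ?X p y"
    using sphere_complement_path_component[OF _ p] by auto
  then have "path_component ?X p y0"
    using conn[of y] path_component_mem(2) path_component_trans by blast
  then have "path_component ?X x y0" using conn[of x] assms(3) by (cases "x = p") auto
  then obtain \<alpha> where \<alpha>: "path \<alpha>" "path_image \<alpha> \<subseteq> ?X" "pathstart \<alpha> = x" "pathfinish \<alpha> = y0"
    unfolding path_component_def by blast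
  have "\<exists>q\<in>loops_at ?X x. holonomy F q = u" for u
  proof -
    \<comment> \<open>Transport along \<open>\<alpha>\<close> conjugates holonomies, so the loop at
      \<open>y0\<close> is chosen with the conjugate of \<open>u\<close>.\<close>
    have "- holonomy F \<alpha> + u + holonomy F \<alpha> \<in> G" using \<open>G = UNIV\<close> by simp
    then obtain q where q: "q \<in> loops_at ?X y0" "holonomy F q = - holonomy F \<alpha> + u + holonomy F \<alpha>"
      by (auto simp: G_def)
    let ?q = "\<alpha> +++ q +++ reversepath \<alpha>"
    have "holonomy F ?q = holonomy F \<alpha> + (holonomy F q + - holonomy F \<alpha>)"
      using \<alpha> q(1) by (simp add: loops_at_def path_image_join holonomy_join[OF lsF] holonomy_reversepath[OF lsF])
    also have "\<dots> = u" unfolding q(2) by (simp add: add.assoc[symmetric])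
    finally have "holonomy F ?q = u" .
    moreover have "?q \<in> loops_at ?X x" using \<alpha> q(1) by (simp add: loops_at_def path_image_join)
    ultimately show ?thesis by blast
  qed
  from epi_fundamental_group[OF lsF this] dihedral_epi[OF HOL.refl, of n] show ?thesis
    using epi_compose by blast
qed

end
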